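(* Let $\rho_{AB}\in\mathcal S(AB)$ with $V(A:B)_\rho\ne0$, let $r\in\mathbb R$, and put $R_n:=I(A:B)_\rho+r/\sqrt n$. Then $$\lim_{n\to\infty}\hat\alpha_{n,\rho}(e^{-nR_n})=\Phi\Big(\frac{r}{\sqrt{V(A:B)_\rho}}\Big),$$ where $\Phi(x)=\frac1{\sqrt{2\pi}}\int_{-\infty}^xe^{-t^2/2}dt$ is the standard normal cumulative distribution function. The same holds with $\hat\alpha_{n,\rho}$ replaced by $\hat\alpha^{\mathrm{iid}}_{n,\rho}$.
   Context: All Hilbert spaces are finite-dimensional, $\log$ is natural, $\mathcal S(A)$ is the set of density operators on $A$. $I(A:B)_\rho=H(A)_\rho+H(B)_\rho-H(AB)_\rho$; $V(A:B)_\rho=\operatorname{tr}[\rho_{AB}(\log\rho_{AB}-\log(\rho_A\otimes\rho_B)-I(A:B)_\rho)^2]$. $\mathcal S_{\mathrm{sym}}(A^{\otimes n})$: permutation-invariant states. $\hat\alpha_{n,\rho}(\mu)=\min\{\operatorname{tr}[\rho_{AB}^{\otimes n}(1-T)]:0\le T\le1,\ \max_{\sigma_{A^n}\in\mathcal S_{\mathrm{sym}}(A^{\otimes n}),\tau_{B^n}\in\mathcal S_{\mathrm{sym}}(B^{\otimes n})}\operatorname{tr}[(\sigma_{A^n}\otimes\tau_{B^n})T]\le\mu\}$; $\hat\alpha^{\mathrm{iid}}_{n,\rho}(\mu)=\min\{\operatorname{tr}[\rho_{AB}^{\otimes n}(1-T)]:0\le T\le1,\ \max_{\sigma_A\in\mathcal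 S(A),\tau_B\in\mathcal S(B)}\operatorname{tr}[(\sigma_A^{\otimes n}\otimes\tau_B^{\otimes n})T]\le\mu\}$. *)

theory Defs
  imports "HOL-Analysis.Analysis" "Jordan_Normal_Form.Matrix"
begin

definition mtrace :: "complex mat \<Rightarrow> complex" where
  "mtrace A = (\<Sum>i<dim_row A. A $$ (i,i))"

definition cadj :: "complex mat \<Rightarrow> complex mat" where
  "cadj A = mat (dim_col A) (dim_row A) (\<lambda>(i,j). cnj (A $$ (j,i)))"

definition hermitian :: "complex mat \<Rightarrow> bool" where
  "hermitian A \<longleftrightarrow> A = cadj A"

definition psd :: "nat \<Rightarrow> complex mat \<Rightarrow> bool" where
  "psd d A \<longleftrightarrow> A \<in> carrier_mat d d \<and> hermitian A \<and>
     (\<forall>v \<in> carrier_vec d. 0 \<le> Re (\<Sum>i<d. cnj (v $ i) * (A *\<^sub>v v) $ i))"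

definition density :: "nat \<Rightarrow> complex mat \<Rightarrow> bool" where
  "density d A \<longleftrightarrow> psd d A \<and> mtrace A = 1"

(* Kronecker (tensor) product; basis |i>|j> of C^m (x) C^p has index i*p + j *)
definition kron :: "complex mat \<Rightarrow> complex mat \<Rightarrow> complex mat" where
  "kron A B = mat (dim_row A * dim_row B) (dim_col A * dim_col B)
     (\<lambda>(i,j). A $$ (i div dim_row B, j div dim_col B) * B $$ (i mod dim_row B, j mod dim_col B))"

definition ptrB :: "nat \<Rightarrow> nat \<Rightarrow> complex mat \<Rightarrow> complex mat" where
  "ptrB dA dB X = mat dA dA (\<lambda>(a,a'). \<Sum>b<dB. X $$ (a*dB + b, a'*dB + b))"

definition ptrA :: "nat \<Rightarrow> nat \<Rightarrow> complex mat \<Rightarrow> complex mat" where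
  "ptrA dA dB X = mat dB dB (\<lambda>(b,b'). \<Sum>a<dA. X $$ (a*dB + b, a*dB + b'))"

(* functional calculus for Hermitian A: f(A) acts as f(lambda) on each eigenvector
   with eigenvalue lambda (eigenvalues of Hermitian matrices are real) *)
definition mat_fun :: "(real \<Rightarrow> real) \<Rightarrow> complex mat \<Rightarrow> complex mat" where
  "mat_fun f A = (THE M. M \<in> carrier_mat (dim_row A) (dim_row A) \<and>
     (\<forall>(l::complex) v. v \<in> carrier_vec (dim_row A) \<longrightarrow> A *\<^sub>v v = l \<cdot>\<^sub>v v \<longrightarrow>
        M *\<^sub>v v = complex_of_real (f (Re l)) \<cdot>\<^sub>v v))"

(* matrix logarithm with the usual support convention (log taken on the support) *)
definition mlog :: "complex mat \<Rightarrow> complex mat" where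
  "mlog A = mat_fun (\<lambda>x. if x > 0 then ln x else 0) A"

definition vN_entropy :: "complex mat \<Rightarrow> real" where
  "vN_entropy X = - Re (mtrace (X * mlog X))"

definition mutual_info :: "nat \<Rightarrow> nat \<Rightarrow> complex mat \<Rightarrow> real" where
  "mutual_info dA dB \<rho> = vN_entropy (ptrB dA dB \<rho>) + vN_entropy (ptrA dA dB \<rho>) - vN_entropy \<rho>"

definition mutual_info_var :: "nat \<Rightarrow> nat \<Rightarrow> complex mat \<Rightarrow> real" where
  "mutual_info_var dA dB \<rho> =
    (let L = mlog \<rho> - mlog (kron (ptrB dA dB \<rho>) (ptrA dA dB \<rho>))
             - complex_of_real (mutual_info dA dB \<rho>) \<cdot>\<^sub>m 1\<^sub>m (dA*dB)
     in Re (mtrace (\<rho> * (L * L))))"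

(* k-th tensor factor index of a basis index of (C^d)^{(x) n} *)
definition digit :: "nat \<Rightarrow> nat \<Rightarrow> nat \<Rightarrow> nat" where
  "digit d k i = (i div d ^ k) mod d"

definition tpow :: "nat \<Rightarrow> nat \<Rightarrow> complex mat \<Rightarrow> complex mat" where
  "tpow d n X = mat (d ^ n) (d ^ n) (\<lambda>(i,j). \<Prod>k<n. X $$ (digit d k i, digit d k j))"

(* rho_AB^{(x) n}, regarded as an operator on A^n (x) B^n = (C^dA)^{(x)n} (x) (C^dB)^{(x)n}
   (basis index I = iA * dB^n + iB, consistent with kron) *)
definition rho_pow :: "nat \<Rightarrow> nat \<Rightarrow> nat \<Rightarrow> complex mat \<Rightarrow> complex mat" where
  "rho_pow dA dB n \<rho> = mat (dA ^ n * dB ^ n) (dA ^ n * dB ^ n) (\<lambda>(I,J).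
     \<Prod>k<n. \<rho> $$ (digit dA k (I div dB ^ n) * dB + digit dB k (I mod dB ^ n),
                   digit dA k (J div dB ^ n) * dB + digit dB k (J mod dB ^ n)))"

(* unitary permuting the n tensor factors of (C^d)^{(x) n} according to pi *)
definition perm_op :: "nat \<Rightarrow> nat \<Rightarrow> (nat \<Rightarrow> nat) \<Rightarrow> complex mat" where
  "perm_op d n \<pi> = mat (d ^ n) (d ^ n)
     (\<lambda>(i,j). if i = (\<Sum>k<n. digit d (\<pi> k) j * d ^ k) then 1 else 0)"

definition sym_states :: "nat \<Rightarrow> nat \<Rightarrow> complex mat set" where
  "sym_states d n = {\<sigma>. density (d ^ n) \<sigma> \<and>
     (\<forall>\<pi>. \<pi> permutes {..<n} \<longrightarrow> perm_op d n \<pi> * \<sigma> * cadj (perm_op d n \<pi>) = \<sigma>)}"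

definition is_test :: "nat \<Rightarrow> complex mat \<Rightarrow> bool" where
  "is_test N T \<longleftrightarrow> psd N T \<and> psd N (1\<^sub>m N - T)"

definition alpha_hat :: "nat \<Rightarrow> nat \<Rightarrow> nat \<Rightarrow> complex mat \<Rightarrow> real \<Rightarrow> real" where
  "alpha_hat dA dB n \<rho> \<mu> = Inf {Re (mtrace (rho_pow dA dB n \<rho> * (1\<^sub>m (dA ^ n * dB ^ n) - T))) | T.
     is_test (dA ^ n * dB ^ n) T \<and>
     (\<forall>\<sigma> \<in> sym_states dA n. \<forall>\<tau> \<in> sym_states dB n. Re (mtrace (kron \<sigma> \<tau> * T)) \<le> \<mu>)}"

definition alpha_hat_iid :: "nat \<Rightarrow> nat \<Rightarrow> nat \<Rightarrow> complex mat \<Rightarrow> real \<Rightarrow> real" where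
  "alpha_hat_iid dA dB n \<rho> \<mu> = Inf {Re (mtrace (rho_pow dA dB n \<rho> * (1\<^sub>m (dA ^ n * dB ^ n) - T))) | T.
     is_test (dA ^ n * dB ^ n) T \<and>
     (\<forall>\<sigma> \<tau>. density dA \<sigma> \<longrightarrow> density dB \<tau> \<longrightarrow>
        Re (mtrace (kron (tpow dA n \<sigma>) (tpow dB n \<tau>) * T)) \<le> \<mu>)}"

definition std_normal_cdf :: "real \<Rightarrow> real" where
  "std_normal_cdf x = (1 / sqrt (2 * pi)) * (LBINT t:{..x}. exp (- (t ^ 2) / 2))"

end

(* Converse: expand the two types of error in the eigenbases of rho_AB^n and rho_A^n (x) rho_B^n. The
   inequality |x + y|^2 <= (1 + delta)(|x|^2 + |y|^2 / delta) bounds them from below by the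
   distribution function of the log-likelihood ratio under the Nussbaum-Szkola weights, which are
   i.i.d. with mean I(A:B) and variance V(A:B). The loss delta can be taken of order 1/n, so the
   central limit theorem gives the limit.

   Achievability: all permutation-invariant states on A^n lie below one operator of polynomial trace
   that commutes with rho_A^n, and likewise on B^n. Testing rho_AB^n against the product of these two
   operators, Gram-Schmidt orthogonalisation in order of increasing eigenvalue yields a projection
   whose second error is at most exp(-nR), while its first error is a distribution function of
   Nussbaum-Szkola weights. By Markov's inequality, replacing the universal operators by
   rho_A^n (x) rho_B^n shifts its argument by O(log n) only, at the expense of weight O(1/n). *)
theory Submission
  imports Defs "HOL-Probability.Probability" "HOL-Real_Asymp.Real_Asymp" "HOL-Combinatorics.Permutations"
    "Jordan_Normal_Form.Spectral_Radius"
begin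

text \<open>Both limits come from one sandwich. Tensor powers are permutation-invariant, so the
  i.i.d. constraint is the weaker one; the converse is therefore shown for
  \<open>alpha_hat_iid\<close>, against the single competitor formed by the marginals, and
  achievability only for \<open>alpha_hat\<close>. The obstacle is the lack of a common eigenbasis:
  the universal operator need not commute with \<open>rho_pow\<close>, so eigenvalues cannot be
  compared along one basis. Each eigenvector of \<open>rho_pow\<close> is instead cut down to those
  coordinates in the eigenbasis of the universal operator where its own eigenvalue is large enough,
  and the test projects onto the span of the truncations. The universal operator exists because the
  square root of a permutation-invariant state lies in the span of polynomially many orthogonal
  indicator matrices. It is rotated into an eigenbasis of the marginal, so that the two commute;
  where eigenvalues coincide, their joint eigenbasis may still differ from the product basis behind
  the Nussbaum-Szkola weights. This is harmless, since sums of overlap weights against a function of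
  the eigenvalues depend on the operator alone.\<close>

unbundle no vec_syntax

text \<open>Products are reassociated only with explicit dimensions, and entries of products are
  unfolded as plain sums over initial segments, so the default rewriting of both is switched
  off.\<close>

declare assoc_mult_mat [simp del] index_mult_mat(1) [simp del] index_mult_mat_vec [simp del]

subsection \<open>Adjoints, traces and unitary matrices\<close>

lemma mult_mat_entry:
  assumes "A \<in> carrier_mat n m" "B \<in> carrier_mat m p" "i < n" "j < p"
  shows "(A * B) $$ (i,j) = (\<Sum>k<m. A $$ (i,k) * B $$ (k,j))"
  using assms by (auto simp: index_mult_mat(1) index_mult_mat_vec scalar_prod_def atLeast0LessThan)

lemma mult_mat_vec_entry:
  assumes "A \<in> carrier_mat n m" "v \<in> carrier_vec m" "i < n"
  shows "(A *\<^sub>v v) $ i = (\<Sum>k<m. A $$ (i,k) * v $ k)"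
  using assms by (auto simp: index_mult_mat(1) index_mult_mat_vec scalar_prod_def atLeast0LessThan)

lemma cadj_carrier [simp, intro]: "A \<in> carrier_mat n m \<Longrightarrow> cadj A \<in> carrier_mat m n"
  by (auto simp: cadj_def)

lemma cadj_entry [simp]: "i < dim_col A \<Longrightarrow> j < dim_row A \<Longrightarrow> cadj A $$ (i,j) = cnj (A $$ (j,i))"
  by (auto simp: cadj_def)

lemma dim_cadj [simp]: "dim_row (cadj A) = dim_col A" "dim_col (cadj A) = dim_row A"
  by (auto simp: cadj_def)

lemma cadj_cadj [simp]: "cadj (cadj A) = A"
  by (rule eq_matI) (auto simp: cadj_def)

lemma cadj_mult:
  assumes "A \<in> carrier_mat n m" "B \<in> carrier_mat m p"
  shows "cadj (A * B) = cadj B * cadj A"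
  by (rule eq_matI) (use assms in \<open>auto simp: mult_mat_entry[OF assms]
      mult_mat_entry[OF cadj_carrier[OF assms(2)] cadj_carrier[OF assms(1)]] mult.commute intro!: sum.cong\<close>)

lemma cadj_add: "A \<in> carrier_mat n m \<Longrightarrow> B \<in> carrier_mat n m \<Longrightarrow> cadj (A + B) = cadj A + cadj B"
  by (rule eq_matI) auto

lemma cadj_minus: "A \<in> carrier_mat n m \<Longrightarrow> B \<in> carrier_mat n m \<Longrightarrow> cadj (A - B) = cadj A - cadj B"
  by (rule eq_matI) auto

lemma cadj_smult: "cadj (c \<cdot>\<^sub>m A) = cnj c \<cdot>\<^sub>m cadj A"
  by (rule eq_matI) (auto simp: cadj_def)

lemma cadj_one [simp]: "cadj (1\<^sub>m n) = 1\<^sub>m n"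
  by (rule eq_matI) (auto simp: cadj_def)

lemma mtrace_eq: "A \<in> carrier_mat n m \<Longrightarrow> mtrace A = (\<Sum>i<n. A $$ (i,i))"
  by (auto simp: mtrace_def)

lemma mtrace_mult:
  assumes "A \<in> carrier_mat n m" "B \<in> carrier_mat m n"
  shows "mtrace (A * B) = (\<Sum>i<n. \<Sum>j<m. A $$ (i,j) * B $$ (j,i))"
  using assms by (simp add: mtrace_eq[of _ n n] mult_mat_entry[OF assms])

lemma mtrace_comm:
  assumes "A \<in> carrier_mat n m" "B \<in> carrier_mat m n"
  shows "mtrace (A * B) = mtrace (B * A)"
  unfolding mtrace_mult[OF assms] mtrace_mult[OF assms(2,1)]
  by (subst sum.swap) (simp add: mult.commute)

lemma mtrace_add: "A \<in> carrier_mat n n \<Longrightarrow> B \<in> carrier_mat n n \<Longrightarrow> mtrace (A + B) = mtrace A + mtrace B"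
  by (simp add: mtrace_eq[of _ n n] sum.distrib)

definition unitary :: "nat \<Rightarrow> complex mat \<Rightarrow> bool" where
  "unitary d U \<longleftrightarrow> U \<in> carrier_mat d d \<and> cadj U * U = 1\<^sub>m d \<and> U * cadj U = 1\<^sub>m d"

lemma unitary_carrier: "unitary d U \<Longrightarrow> U \<in> carrier_mat d d"
  by (simp add: unitary_def)

lemma unitary_cadj: "unitary d U \<Longrightarrow> unitary d (cadj U)"
  by (auto simp: unitary_def)

lemma mult_cancel_mid:
  fixes A B C D :: "complex mat"
  assumes "A \<in> carrier_mat n k" "B \<in> carrier_mat k l" "C \<in> carrier_mat l k" "D \<in> carrier_mat k m"
    and "B * C = 1\<^sub>m k"
  shows "(A * B) * (C * D) = A * D"
proof -
  have "(A * B) * (C * D) = A * ((B * C) * D)"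
    using assms(1-4) by (simp add: assoc_mult_mat[of A n k B l "C * D" m] assoc_mult_mat[of B k l C k D m])
  then show ?thesis using assms by (simp add: left_mult_one_mat[of D k m])
qed

lemma unitary_mult:
  assumes "unitary d U" "unitary d V" shows "unitary d (U * V)"
proof -
  have c: "U \<in> carrier_mat d d" "V \<in> carrier_mat d d" "cadj U \<in> carrier_mat d d" "cadj V \<in> carrier_mat d d"
    using assms by (auto simp: unitary_def)
  show ?thesis
    using assms c mult_cancel_mid[of "cadj V" d d "cadj U" d U V d] mult_cancel_mid[of U d d V d "cadj V" "cadj U" d]
    by (auto simp: unitary_def cadj_mult[OF c(1,2)])
qed

section \<open>Diagonal matrices and conjugation by unitaries\<close>

definition cdiag :: "nat \<Rightarrow> (nat \<Rightarrow> complex) \<Rightarrow> complex mat" where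
  "cdiag d f = mat d d (\<lambda>(i,j). if i = j then f i else 0)"

abbreviation rdiag :: "nat \<Rightarrow> (nat \<Rightarrow> real) \<Rightarrow> complex mat" where
  "rdiag d f \<equiv> cdiag d (\<lambda>i. complex_of_real (f i))"

lemma cdiag_carrier [simp, intro]: "cdiag d f \<in> carrier_mat d d"
  by (simp add: cdiag_def)

lemma cdiag_dim [simp]: "dim_row (cdiag d f) = d" "dim_col (cdiag d f) = d"
  by (simp_all add: cdiag_def)

lemma cdiag_entry [simp]: "i < d \<Longrightarrow> j < d \<Longrightarrow> cdiag d f $$ (i,j) = (if i = j then f i else 0)"
  by (simp add: cdiag_def)

lemma cdiag_mult_left:
  assumes "A \<in> carrier_mat d m" "i < d" "j < m"
  shows "(cdiag d f * A) $$ (i,j) = f i * A $$ (i,j)"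
  using assms
  by (simp add: mult_mat_entry[of _ d d _ m] if_distrib[of "\<lambda>x. x * _"] sum.delta cong: if_cong)

lemma cdiag_mult_right:
  assumes "A \<in> carrier_mat m d" "i < m" "j < d"
  shows "(A * cdiag d f) $$ (i,j) = A $$ (i,j) * f j"
  using assms
  by (simp add: mult_mat_entry[of _ m d _ d] if_distrib[of "\<lambda>x. _ * x"] sum.delta cong: if_cong)

lemma cadj_cdiag: "cadj (cdiag d f) = cdiag d (\<lambda>i. cnj (f i))"
  by (rule eq_matI) (auto simp: cadj_def)

lemma cdiag_mult_cdiag: "cdiag d f * cdiag d g = cdiag d (\<lambda>i. f i * g i)"
  by (rule eq_matI) (auto simp: cdiag_mult_left[OF cdiag_carrier])

lemma conj_move:
  fixes A B U :: "complex mat"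
  assumes U: "unitary d U" and A: "A \<in> carrier_mat d d" and B: "B \<in> carrier_mat d d"
  shows "A = U * B * cadj U \<longleftrightarrow> B = cadj U * A * U"
proof -
  have c: "U \<in> carrier_mat d d" "cadj U \<in> carrier_mat d d" and u: "cadj U * U = 1\<^sub>m d" "U * cadj U = 1\<^sub>m d"
    using U by (auto simp: unitary_def)
  have cancel: "P * (Q * X * P) * Q = X"
    if "P \<in> carrier_mat d d" "Q \<in> carrier_mat d d" "X \<in> carrier_mat d d" "P * Q = 1\<^sub>m d" for P Q X :: "complex mat"
  proof -
    have "P * (Q * X * P) * Q = (P * Q) * (X * (P * Q))"
      using that(1-3) by (simp add: assoc_mult_mat[of _ d d _ d _ d])
    then show ?thesis using that by (simp add: left_mult_one_mat[of X d d] right_mult_one_mat[of X d d])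
  qed
  have 1: "cadj U * (U * B * cadj U) * U = B" and 2: "U * (cadj U * A * U) * cadj U = A"
    using cancel c u A B by blast+
  show ?thesis using 1 2 by metis
qed

lemma conj_undo:
  assumes "unitary d U" "A \<in> carrier_mat d d" "B \<in> carrier_mat d d" "A = U * B * cadj U"
  shows "cadj U * A * U = B"
  by (rule iffD1[OF conj_move[OF assms(1-3)] assms(4), symmetric])

lemma conj_mult_conj:
  assumes U: "unitary d U" and A: "A \<in> carrier_mat d d" and B: "B \<in> carrier_mat d d"
  shows "(U * A * cadj U) * (U * B * cadj U) = U * (A * B) * cadj U"
proof -
  have c: "U \<in> carrier_mat d d" "cadj U \<in> carrier_mat d d" and u: "cadj U * U = 1\<^sub>m d"
    using U by (auto simp: unitary_def)
  have "(U * A * cadj U) * (U * B * cadj U) = (U * A) * (B * cadj U)"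
    using mult_cancel_mid[of "U * A" d d "cadj U" d U "B * cadj U" d] c u A B
    by (simp add: assoc_mult_mat[of U d d B d "cadj U" d])
  then show ?thesis using c A B by (simp add: assoc_mult_mat[of _ d d _ d _ d])
qed

lemma cadj_conj:
  assumes "U \<in> carrier_mat n d" and "A \<in> carrier_mat d d"
  shows "cadj (U * A * cadj U) = U * cadj A * cadj U"
  using assms by (simp add: cadj_mult[of "U * A" n d "cadj U" n] cadj_mult[of U n d A d] assoc_mult_mat[of U n d "cadj A" d "cadj U" n])

lemma conj_entry:
  assumes "U \<in> carrier_mat n d" "A \<in> carrier_mat d d" "V \<in> carrier_mat d m" "i < n" "j < m"
  shows "(U * A * V) $$ (i,j) = (\<Sum>k<d. \<Sum>l<d. U $$ (i,k) * A $$ (k,l) * V $$ (l,j))"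
proof -
  have "(U * A * V) $$ (i,j) = (\<Sum>l<d. (\<Sum>k<d. U $$ (i,k) * A $$ (k,l)) * V $$ (l,j))"
    using assms by (simp add: mult_mat_entry[of _ n d _ m] mult_mat_entry[of _ n d _ d])
  then show ?thesis by (simp add: sum_distrib_right) (subst sum.swap, simp)
qed

lemma conj_cdiag_entry:
  assumes "U \<in> carrier_mat n d" "V \<in> carrier_mat d m" "i < n" "j < m"
  shows "(U * cdiag d f * V) $$ (i,j) = (\<Sum>k<d. U $$ (i,k) * f k * V $$ (k,j))"
  using assms by (simp add: mult_mat_entry[of _ n d _ m] cdiag_mult_right)

lemma mtrace_conj:
  assumes U: "unitary d U" and A: "A \<in> carrier_mat d d"
  shows "mtrace (U * A * cadj U) = mtrace A"
proof -
  have c: "U \<in> carrier_mat d d" "cadj U \<in> carrier_mat d d" and u: "cadj U * U = 1\<^sub>m d"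
    using U by (auto simp: unitary_def)
  have "mtrace (U * A * cadj U) = mtrace (cadj U * (U * A))"
    using c A by (intro mtrace_comm[of _ d d]) auto
  also have "cadj U * (U * A) = A"
    using c u A by (simp add: assoc_mult_mat[of _ d d _ d _ d, symmetric])
  finally show ?thesis .
qed

subsection \<open>Positive semidefinite matrices\<close>

definition qform :: "nat \<Rightarrow> complex mat \<Rightarrow> complex vec \<Rightarrow> complex" where
  "qform d A v = (\<Sum>i<d. cnj (v $ i) * (A *\<^sub>v v) $ i)"

lemma psd_alt: "psd d A \<longleftrightarrow> A \<in> carrier_mat d d \<and> cadj A = A \<and> (\<forall>v \<in> carrier_vec d. 0 \<le> Re (qform d A v))"
  by (auto simp: psd_def hermitian_def qform_def)

lemma psd_carrier: "psd d A \<Longrightarrow> A \<in> carrier_mat d d"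
  by (simp add: psd_def)

lemma psd_cadj: "psd d A \<Longrightarrow> cadj A = A"
  by (simp add: psd_alt)

lemma psd_entry_cnj: "psd d A \<Longrightarrow> i < d \<Longrightarrow> j < d \<Longrightarrow> cnj (A $$ (i,j)) = A $$ (j,i)"
  by (metis cadj_entry psd_alt carrier_matD)

lemma qform_eq:
  assumes "A \<in> carrier_mat d d" "v \<in> carrier_vec d"
  shows "qform d A v = (\<Sum>i<d. \<Sum>j<d. cnj (v $ i) * A $$ (i,j) * v $ j)"
  unfolding qform_def using assms
  by (intro sum.cong) (simp_all add: mult_mat_vec_entry[of _ d d] sum_distrib_left mult.assoc)

lemma qform_congruence:
  assumes A: "A \<in> carrier_mat d d" and C: "C \<in> carrier_mat d e" and v: "v \<in> carrier_vec e"
  shows "qform e (cadj C * A * C) v = qform d A (C *\<^sub>v v)"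
proof -
  have w: "C *\<^sub>v v \<in> carrier_vec d" using C v by auto
  let ?w = "A *\<^sub>v (C *\<^sub>v v)"
  have "(cadj C * A * C) *\<^sub>v v = cadj C *\<^sub>v ?w"
    using A C v by (simp add: assoc_mult_mat_vec[of _ e d _ e] assoc_mult_mat_vec[of _ e d _ d] assoc_mult_mat[of _ e d _ d _ e]
       assoc_mult_mat_vec[of _ d d _ e])
  then have "qform e (cadj C * A * C) v = (\<Sum>i<e. cnj (v $ i) * (\<Sum>k<d. cnj (C $$ (k,i)) * ?w $ k))"
    unfolding qform_def using A C v w by (intro sum.cong) (auto simp: mult_mat_vec_entry[of _ e d])
  also have "\<dots> = (\<Sum>k<d. (\<Sum>i<e. cnj (C $$ (k,i)) * cnj (v $ i)) * ?w $ k)"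
    by (simp add: sum_distrib_left sum_distrib_right mult_ac) (subst sum.swap, simp)
  also have "\<dots> = qform d A (C *\<^sub>v v)"
    unfolding qform_def using A C v by (intro sum.cong) (auto simp: mult_mat_vec_entry[of C d e])
  finally show ?thesis .
qed

lemma psd_congruence:
  assumes A: "psd d A" and C: "C \<in> carrier_mat d e"
  shows "psd e (cadj C * A * C)"
proof -
  have c: "A \<in> carrier_mat d d" using A by (rule psd_carrier)
  have "cadj (cadj C * A * C) = cadj C * A * C"
    using cadj_conj[of "cadj C" e d A] A C c by (simp add: psd_cadj)
  moreover have "C *\<^sub>v v \<in> carrier_vec d" if "v \<in> carrier_vec e" for v
    using that C by auto
  ultimately show ?thesis
    using A C c by (auto simp: psd_alt qform_congruence)
qed

lemma qform_add:
  assumes "A \<in> carrier_mat d d" "B \<in> carrier_mat d d" "v \<in> carrier_vec d"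
  shows "qform d (A + B) v = qform d A v + qform d B v"
  using assms by (simp add: minus_carrier_mat qform_eq algebra_simps sum.distrib)

lemma qform_minus:
  assumes "A \<in> carrier_mat d d" "B \<in> carrier_mat d d" "v \<in> carrier_vec d"
  shows "qform d (A - B) v = qform d A v - qform d B v"
  using assms by (simp add: minus_carrier_mat qform_eq algebra_simps sum_subtractf)

lemma psd_add:
  assumes "psd d A" "psd d B" shows "psd d (A + B)"
  using assms by (auto simp: psd_alt qform_add cadj_add[of _ d d])

lemma psd_diff:
  assumes "psd d A" "psd d B" "\<And>v. v \<in> carrier_vec d \<Longrightarrow> Re (qform d A v) \<le> Re (qform d B v)"
  shows "psd d (B - A)"
  using assms by (auto simp: psd_alt qform_minus cadj_minus[of _ d d])

lemma psd_diag:
  assumes "psd d A" "i < d"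
  shows "0 \<le> Re (A $$ (i,i))" "Im (A $$ (i,i)) = 0"
proof -
  have c: "A \<in> carrier_mat d d" using assms by (simp add: psd_carrier)
  have "qform d A (unit_vec d i) = A $$ (i,i)"
  proof -
    have "qform d A (unit_vec d i) = (\<Sum>a<d. \<Sum>b<d. if b = i then (if a = i then A $$ (i,i) else 0) else 0)"
      unfolding qform_eq[OF c unit_vec_carrier] using assms(2) by (intro sum.cong refl) auto
    then show ?thesis using assms(2) by (simp add: sum.delta)
  qed
  then show "0 \<le> Re (A $$ (i,i))"
    using assms by (metis psd_alt unit_vec_carrier)
  show "Im (A $$ (i,i)) = 0"
    using psd_entry_cnj[OF assms(1,2,2)] by (metis Reals_cnj_iff complex_is_Real_iff)
qed

lemma psd_cdiag:
  assumes "\<And>i. i < d \<Longrightarrow> 0 \<le> f i" shows "psd d (rdiag d f)"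
proof -
  have "qform d (rdiag d f) v = (\<Sum>i<d. complex_of_real (f i * (cmod (v $ i))\<^sup>2))" if v: "v \<in> carrier_vec d" for v
  proof -
    have "qform d (rdiag d f) v = (\<Sum>a<d. \<Sum>b<d. if b = a then complex_of_real (f a * (cmod (v $ a))\<^sup>2) else 0)"
      unfolding qform_eq[OF cdiag_carrier v]
      by (intro sum.cong refl) (auto simp: complex_norm_square mult_ac simp del: of_real_power)
    then show ?thesis by (simp add: sum.delta)
  qed
  then show ?thesis using assms by (auto simp: psd_alt cadj_cdiag intro!: sum_nonneg)
qed

lemma psd_conj_rdiag:
  assumes "U \<in> carrier_mat n d" "\<And>i. i < d \<Longrightarrow> 0 \<le> f i"
  shows "psd n (U * rdiag d f * cadj U)"
  using psd_congruence[OF psd_cdiag, of d f "cadj U" n] assms by auto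

subsection \<open>Spectral theorem\<close>

text \<open>The reflection along \<open>w = e_0 - v\<close>. For a unit vector \<open>v\<close> with
  real first entry the squared norm of \<open>w\<close> is \<open>2 * (1 - v 0)\<close>, so the
  usual factor 2 / |w|^2 becomes \<open>1 / (1 - v 0)\<close>. It exchanges the first basis vector
  and \<open>v\<close>.\<close>

definition householder :: "nat \<Rightarrow> (nat \<Rightarrow> complex) \<Rightarrow> complex mat" where
  "householder d v = mat d d (\<lambda>(i,j). (if i = j then 1 else 0) -
     ((if i = 0 then 1 else 0) - v i) * cnj ((if j = 0 then 1 else 0) - v j) / (1 - v 0))"

text \<open>A nonpositive first entry keeps the denominator \<open>1 - v 0\<close> away from 0, and
  its being real makes the reflection Hermitian, hence its own inverse.\<close>

lemma householder:
  assumes d: "0 < d" and v0: "v 0 = complex_of_real x" and x: "x \<le> 0"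
    and nrm: "(\<Sum>i<d. v i * cnj (v i)) = 1"
  shows "unitary d (householder d v)" "cadj (householder d v) = householder d v"
    "\<And>i. i < d \<Longrightarrow> householder d v $$ (i,0) = v i"
proof -
  define w where "w i = (if i = 0 then 1 else 0) - v i" for i
  define c where "c = 1 - v 0"
  have cc: "cnj c = c" by (simp add: c_def v0)
  have c0: "c \<noteq> 0"
  proof
    assume "c = 0"
    then have "complex_of_real x = 1" by (simp add: c_def v0)
    then have "x = 1" by (metis of_real_eq_1_iff)
    with x show False by simp
  qed
  let ?H = "householder d v"
  have H: "?H $$ (i,j) = (if i = j then 1 else 0) - w i * cnj (w j) / c" if "i < d" "j < d" for i j
    using that by (simp add: householder_def w_def c_def)
  have Hc: "?H \<in> carrier_mat d d" by (simp add: householder_def)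
  have ww: "(\<Sum>i<d. w i * cnj (w i)) = 2 * c"
  proof -
    have "(\<Sum>i<d. w i * cnj (w i)) = (\<Sum>i<d. (if i = 0 then 1 - v 0 - cnj (v 0) else 0) + v i * cnj (v i))"
      by (intro sum.cong refl) (auto simp: w_def algebra_simps)
    also have "\<dots> = 1 - v 0 - cnj (v 0) + 1"
      using d by (simp add: sum.distrib nrm)
    finally show ?thesis by (simp add: c_def v0)
  qed
  show self: "cadj ?H = ?H"
    by (rule eq_matI) (use Hc in \<open>auto simp: H cc mult.commute\<close>)
  have "?H * ?H = 1\<^sub>m d"
  proof (rule eq_matI)
    fix i j assume "i < dim_row (1\<^sub>m d :: complex mat)" "j < dim_col (1\<^sub>m d :: complex mat)"
    then have ij: "i < d" "j < d" by auto
    have "(?H * ?H) $$ (i,j) = (\<Sum>k<d. ((if k = i then 1 else 0) - w i * cnj (w k) / c) * ((if k = j then 1 else 0) - w k * cnj (w j) / c))"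
      unfolding mult_mat_entry[OF Hc Hc ij] using ij by (intro sum.cong refl) (auto simp: H)
    also have "\<dots> = (\<Sum>k<d. (if k = j then (if i = j then 1 else 0) - w i * cnj (w j) / c else 0)
        - (if k = i then w i * cnj (w j) / c else 0) + (w i * cnj (w j) / c\<^sup>2) * (w k * cnj (w k)))"
      by (intro sum.cong refl) (use c0 in \<open>auto simp: field_simps power2_eq_square\<close>)
    also have "\<dots> = (if i = j then 1 else 0) - w i * cnj (w j) / c - w i * cnj (w j) / c + (w i * cnj (w j) / c\<^sup>2) * (2 * c)"
      unfolding ww[symmetric] sum.distrib sum_subtractf sum_distrib_left using ij by simp
    also have "\<dots> = (if i = j then 1 else 0)"
      using c0 by (simp add: field_simps power2_eq_square)
    finally show "(?H * ?H) $$ (i,j) = 1\<^sub>m d $$ (i,j)" using ij by simp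
  qed (use Hc in auto)
  then show "unitary d ?H" using Hc self by (simp add: unitary_def)
  show "?H $$ (i,0) = v i" if "i < d" for i
    using that d c0 cc H[OF that d] by (simp add: w_def c_def)
qed

text \<open>The direct sum of a 1x1 identity block and \<open>U\<close>; it extends the unitary
  found for the trailing block in the induction of \<open>spectral_normal\<close>.\<close>

definition block_one :: "nat \<Rightarrow> complex mat \<Rightarrow> complex mat" where
  "block_one n U = mat (Suc n) (Suc n)
     (\<lambda>(i,j). if i = 0 \<and> j = 0 then 1 else if i = 0 \<or> j = 0 then 0 else U $$ (i - 1, j - 1))"

lemma unitary_block_one:
  assumes "unitary n U" shows "unitary (Suc n) (block_one n U)"
proof -
  let ?B = "block_one n U"
  have U: "U \<in> carrier_mat n n" and u: "cadj U * U = 1\<^sub>m n" "U * cadj U = 1\<^sub>m n"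
    using assms by (auto simp: unitary_def)
  have B: "?B \<in> carrier_mat (Suc n) (Suc n)" by (simp add: block_one_def)
  have e: "?B $$ (0,0) = 1" "\<And>i. i < n \<Longrightarrow> ?B $$ (Suc i,0) = 0" "\<And>i. i < n \<Longrightarrow> ?B $$ (0,Suc i) = 0"
    "\<And>i j. i < n \<Longrightarrow> j < n \<Longrightarrow> ?B $$ (Suc i,Suc j) = U $$ (i,j)"
    by (auto simp: block_one_def)
  have m: "(\<Sum>k<n. cnj (U $$ (k,i)) * U $$ (k,j)) = (if i = j then 1 else 0)"
    "(\<Sum>k<n. U $$ (i,k) * cnj (U $$ (j,k))) = (if i = j then 1 else 0)" if "i < n" "j < n" for i j
    using arg_cong[OF u(1), of "\<lambda>M. M $$ (i,j)"] arg_cong[OF u(2), of "\<lambda>M. M $$ (i,j)"] U that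
    by (simp_all add: mult_mat_entry[of _ n n _ n])
  have "cadj ?B * ?B = 1\<^sub>m (Suc n)"
  proof (rule eq_matI)
    fix i j assume "i < dim_row (1\<^sub>m (Suc n) :: complex mat)" "j < dim_col (1\<^sub>m (Suc n) :: complex mat)"
    then show "(cadj ?B * ?B) $$ (i,j) = 1\<^sub>m (Suc n) $$ (i,j)"
      using B by (cases i; cases j) (simp_all add: mult_mat_entry[of _ "Suc n" "Suc n" _ "Suc n"] sum.lessThan_Suc_shift e m del: sum.lessThan_Suc)
  qed (use B in auto)
  moreover have "?B * cadj ?B = 1\<^sub>m (Suc n)"
  proof (rule eq_matI)
    fix i j assume "i < dim_row (1\<^sub>m (Suc n) :: complex mat)" "j < dim_col (1\<^sub>m (Suc n) :: complex mat)"
    then show "(?B * cadj ?B) $$ (i,j) = 1\<^sub>m (Suc n) $$ (i,j)"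
      using B by (cases i; cases j) (simp_all add: mult_mat_entry[of _ "Suc n" "Suc n" _ "Suc n"] sum.lessThan_Suc_shift e m del: sum.lessThan_Suc)
  qed (use B in auto)
  ultimately show ?thesis using B by (simp add: unitary_def)
qed

text \<open>An eigenvector exists because the spectrum of a complex matrix is nonempty. It is scaled
  to unit norm, and its phase is chosen to give the first entry the sign that
  \<open>householder\<close> asks for.\<close>

lemma ex_unit_eigenvector:
  assumes A: "A \<in> carrier_mat (Suc n) (Suc n)"
  shows "\<exists>l v x. (\<forall>i<Suc n. (\<Sum>k<Suc n. A $$ (i,k) * v k) = l * v i) \<and>
    v 0 = complex_of_real x \<and> x \<le> 0 \<and> (\<Sum>i<Suc n. v i * cnj (v i)) = 1"
proof -
  from spectrum_non_empty[OF A] obtain l where "eigenvalue A l"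
    by (auto simp: spectrum_def)
  then obtain u where u: "u \<in> carrier_vec (Suc n)" "u \<noteq> 0\<^sub>v (Suc n)" "A *\<^sub>v u = l \<cdot>\<^sub>v u"
    using A by (auto simp: eigenvalue_def eigenvector_def)
  define s where "s = (\<Sum>i<Suc n. (cmod (u $ i))\<^sup>2)"
  obtain i where i: "i < Suc n" "u $ i \<noteq> 0"
    using u(1,2) by (metis carrier_vecD eq_vecI index_zero_vec)
  have "(cmod (u $ i))\<^sup>2 \<le> s" unfolding s_def using i by (intro member_le_sum) auto
  then have s: "0 < s" using i by (smt (verit) norm_eq_zero zero_less_power2)
  \<comment> \<open>The phase that turns \<open>u $ 0\<close> into \<open>- cmod (u $ 0)\<close>. If
    this entry is 0 every phase does so, and 1 is taken.\<close>
  define p where "p = (if u $ 0 = 0 then 1 else - cnj (sgn (u $ 0)))"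
  have p1: "cmod p = 1" by (simp add: p_def norm_sgn)
  have pu: "p * u $ 0 = complex_of_real (- cmod (u $ 0))"
  proof (cases "u $ 0 = 0")
    case False
    then have "cnj (sgn (u $ 0)) * u $ 0 = complex_of_real (cmod (u $ 0))"
      by (simp add: sgn_eq mult.commute[of "cnj _"] complex_norm_square[symmetric] power2_eq_square field_simps)
    then show ?thesis using False by (simp add: p_def)
  qed (simp add: p_def)
  define v where "v i = p * u $ i / complex_of_real (sqrt s)" for i
  show ?thesis
  proof (intro exI[of _ l] exI[of _ v] exI[of _ "- cmod (u $ 0) / sqrt s"] conjI allI impI)
    fix i assume i: "i < Suc n"
    have "(\<Sum>k<Suc n. A $$ (i,k) * u $ k) = l * u $ i"
      using arg_cong[OF u(3), of "\<lambda>w. w $ i"] i u(1) A by (simp add: mult_mat_vec_entry[OF A u(1)])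
    moreover have "(\<Sum>k<Suc n. A $$ (i,k) * v k) = (\<Sum>k<Suc n. A $$ (i,k) * u $ k) * (p / complex_of_real (sqrt s))"
      unfolding sum_distrib_right by (intro sum.cong) (auto simp: v_def)
    ultimately show "(\<Sum>k<Suc n. A $$ (i,k) * v k) = l * v i"
      by (simp add: v_def)
  next
    show "v 0 = complex_of_real (- cmod (u $ 0) / sqrt s)" by (simp add: v_def pu)
    show "- cmod (u $ 0) / sqrt s \<le> 0" using s by simp
    have "(\<Sum>i<Suc n. v i * cnj (v i)) = (\<Sum>i<Suc n. complex_of_real ((cmod (u $ i))\<^sup>2 / s))"
    proof (intro sum.cong refl)
      fix i
      have "cmod (v i) ^ 2 = (cmod (u $ i))\<^sup>2 / s"
        using s by (simp add: v_def norm_mult norm_divide p1 power_divide)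
      then show "v i * cnj (v i) = complex_of_real ((cmod (u $ i))\<^sup>2 / s)"
        by (metis complex_norm_square)
    qed
    also have "\<dots> = 1" using s by (simp only: of_real_sum[symmetric] sum_divide_distrib[symmetric] s_def[symmetric]) simp
    finally show "(\<Sum>i<Suc n. v i * cnj (v i)) = 1" .
  qed
qed

text \<open>Induction on the dimension: a Householder reflection moves a unit eigenvector to the
  first basis vector, normality clears the rest of the first row, and the trailing block is again
  normal. Normal rather than Hermitian matrices are treated because two commuting Hermitian matrices
  are later diagonalised together through \<open>A + i B\<close>.\<close>

theorem spectral_normal:
  assumes "A \<in> carrier_mat d d" "A * cadj A = cadj A * A"
  shows "\<exists>U f. unitary d U \<and> A = U * cdiag d f * cadj U"
  using assms
proof (induction d arbitrary: A)
  case 0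
  have "unitary 0 (1\<^sub>m 0)" by (simp add: unitary_def)
  moreover have "A = 1\<^sub>m 0 * cdiag 0 f * cadj (1\<^sub>m 0)" for f
    by (rule eq_matI) (use 0 in auto)
  ultimately show ?case by blast
next
  case (Suc n)
  note A = Suc.prems(1)
  obtain l v x where v: "\<And>i. i < Suc n \<Longrightarrow> (\<Sum>k<Suc n. A $$ (i,k) * v k) = l * v i"
    "v 0 = complex_of_real x" "x \<le> 0" "(\<Sum>i<Suc n. v i * cnj (v i)) = 1"
    using ex_unit_eigenvector[OF A] by blast
  define H where "H = householder (Suc n) v"
  have H: "unitary (Suc n) H" "cadj H = H" "\<And>i. i < Suc n \<Longrightarrow> H $$ (i,0) = v i"
    using householder[of "Suc n" v x] v by (auto simp: H_def)
  have Hc: "H \<in> carrier_mat (Suc n) (Suc n)" using H(1) by (rule unitary_carrier)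
  have HH: "H * H = 1\<^sub>m (Suc n)" using H by (simp add: unitary_def)
  define B where "B = H * A * cadj H"
  have Bc: "B \<in> carrier_mat (Suc n) (Suc n)" using Hc A by (auto simp: B_def)
  have B0: "B $$ (i,0) = (if i = 0 then l else 0)" if "i < Suc n" for i
  proof -
    have AH: "(A * H) $$ (k,0) = l * H $$ (k,0)" if "k < Suc n" for k
      unfolding mult_mat_entry[OF A Hc that zero_less_Suc] using v(1)[OF that] H(3) that by simp
    have "B $$ (i,0) = (\<Sum>k<Suc n. H $$ (i,k) * (A * H) $$ (k,0))"
      unfolding B_def H(2) using A Hc that
      by (simp only: assoc_mult_mat[OF Hc A Hc]) (rule mult_mat_entry[of _ "Suc n" "Suc n" _ "Suc n"]; simp)
    also have "\<dots> = l * (\<Sum>k<Suc n. H $$ (i,k) * H $$ (k,0))"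
      unfolding sum_distrib_left by (intro sum.cong) (auto simp: AH)
    also have "\<dots> = l * (H * H) $$ (i,0)"
      using that by (simp only: mult_mat_entry[OF Hc Hc that zero_less_Suc])
    finally show ?thesis using that by (simp add: HH)
  qed
  have Bn: "B * cadj B = cadj B * B"
    unfolding B_def cadj_conj[OF Hc A] conj_mult_conj[OF H(1) A cadj_carrier[OF A]]
      conj_mult_conj[OF H(1) cadj_carrier[OF A] A] Suc.prems(2) ..
  have BB: "(\<Sum>k<Suc n. B $$ (i,k) * cnj (B $$ (j,k))) = (\<Sum>k<Suc n. cnj (B $$ (k,i)) * B $$ (k,j))"
    if "i < Suc n" "j < Suc n" for i j
    using arg_cong[OF Bn, of "\<lambda>M. M $$ (i,j)"] that Bc
    by (simp add: mult_mat_entry[OF Bc cadj_carrier[OF Bc]] mult_mat_entry[OF cadj_carrier[OF Bc] Bc] del: sum.lessThan_Suc)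
  \<comment> \<open>The (0,0) entries of the two sides of \<open>Bn\<close> say that the first row
    and the first column have equal norm. The column contributes only \<open>l\<close>, so nothing
    is left for the remaining entries of the row.\<close>
  have row0: "B $$ (0,Suc j) = 0" if "j < n" for j
  proof -
    have "(\<Sum>k<Suc n. B $$ (0,k) * cnj (B $$ (0,k))) = l * cnj l"
      unfolding BB[OF zero_less_Suc zero_less_Suc] by (simp add: sum.lessThan_Suc_shift B0 del: sum.lessThan_Suc)
    then have "(\<Sum>k<n. B $$ (0,Suc k) * cnj (B $$ (0,Suc k))) = 0"
      by (simp add: sum.lessThan_Suc_shift B0 del: sum.lessThan_Suc)
    then have "(\<Sum>k<n. complex_of_real ((cmod (B $$ (0,Suc k)))\<^sup>2)) = 0"
      by (simp only: complex_norm_square)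
    then have "(\<Sum>k<n. (cmod (B $$ (0,Suc k)))\<^sup>2) = 0"
      by (metis of_real_sum of_real_eq_0_iff)
    then show ?thesis using that by (simp add: sum_nonneg_eq_0_iff)
  qed
  define B' where "B' = mat n n (\<lambda>(i,j). B $$ (Suc i, Suc j))"
  have B'c: "B' \<in> carrier_mat n n" by (simp add: B'_def)
  have "B' * cadj B' = cadj B' * B'"
  proof (rule eq_matI)
    fix i j assume "i < dim_row (cadj B' * B')" "j < dim_col (cadj B' * B')"
    then have ij: "i < n" "j < n" using B'c by auto
    show "(B' * cadj B') $$ (i,j) = (cadj B' * B') $$ (i,j)"
      using BB[of "Suc i" "Suc j"] ij B'c
      by (simp add: mult_mat_entry[of _ n n _ n] sum.lessThan_Suc_shift B0 row0 B'_def del: sum.lessThan_Suc)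
  qed (use B'c in auto)
  then obtain U' f' where U': "unitary n U'" "B' = U' * cdiag n f' * cadj U'"
    using Suc.IH[OF B'c] by blast
  have U'c: "U' \<in> carrier_mat n n" using U'(1) by (rule unitary_carrier)
  define V where "V = block_one n U'"
  define f where "f = case_nat l f'"
  have V: "unitary (Suc n) V" unfolding V_def by (rule unitary_block_one[OF U'(1)])
  have Vc: "V \<in> carrier_mat (Suc n) (Suc n)" using V by (rule unitary_carrier)
  have e: "V $$ (0,0) = 1" "\<And>i. i < n \<Longrightarrow> V $$ (Suc i,0) = 0" "\<And>i. i < n \<Longrightarrow> V $$ (0,Suc i) = 0"
    "\<And>i j. i < n \<Longrightarrow> j < n \<Longrightarrow> V $$ (Suc i,Suc j) = U' $$ (i,j)"
    by (auto simp: V_def block_one_def)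
  have "B = V * cdiag (Suc n) f * cadj V"
  proof (rule eq_matI)
    fix i j assume "i < dim_row (V * cdiag (Suc n) f * cadj V)" "j < dim_col (V * cdiag (Suc n) f * cadj V)"
    then have ij: "i < Suc n" "j < Suc n" using Vc by auto
    have B'e: "B $$ (Suc a, Suc b) = (\<Sum>k<n. U' $$ (a,k) * f' k * cnj (U' $$ (b,k)))" if "a < n" "b < n" for a b
      using arg_cong[OF U'(2), of "\<lambda>M. M $$ (a,b)"] that U'c
      by (simp add: conj_cdiag_entry[of _ n n _ n] B'_def)
    show "B $$ (i,j) = (V * cdiag (Suc n) f * cadj V) $$ (i,j)"
      unfolding conj_cdiag_entry[OF Vc cadj_carrier[OF Vc] ij] using ij Vc
      by (cases i; cases j) (simp_all add: sum.lessThan_Suc_shift e f_def B0 row0 B'e del: sum.lessThan_Suc)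
  qed (use Vc Bc in auto)
  moreover have "A = cadj H * B * H"
    using conj_move[OF H(1) Bc A] B_def by simp
  ultimately have "A = H * (V * cdiag (Suc n) f * cadj V) * H" using H(2) by simp
  also have "\<dots> = (H * V) * cdiag (Suc n) f * cadj (H * V)"
    using Hc Vc H(2) by (simp add: cadj_mult[OF Hc Vc] assoc_mult_mat[of _ "Suc n" "Suc n" _ "Suc n" _ "Suc n"] mult_carrier_mat[of _ "Suc n" "Suc n" _ "Suc n"])
  finally show ?case using unitary_mult[OF H(1) V] by blast
qed

lemma spectral_hermitian:
  assumes A: "A \<in> carrier_mat d d" and h: "cadj A = A"
  obtains U f where "unitary d U" "A = U * rdiag d f * cadj U"
proof -
  obtain U f where U: "unitary d U" "A = U * cdiag d f * cadj U"
    using spectral_normal[OF A] h by auto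
  have c: "U \<in> carrier_mat d d" using U(1) by (rule unitary_carrier)
  have D: "cdiag d f = cadj U * A * U" using conj_move[OF U(1) A cdiag_carrier] U(2) by blast
  have "cadj (cdiag d f) = cdiag d f"
    unfolding D using cadj_conj[of "cadj U" d d A] c A h by simp
  then have "cnj (f i) = f i" if "i < d" for i
  proof -
    have "cnj (f i) = cadj (cdiag d f) $$ (i,i)" using that by simp
    also have "\<dots> = f i" unfolding \<open>cadj (cdiag d f) = cdiag d f\<close> using that by simp
    finally show ?thesis .
  qed
  then have "cdiag d f = rdiag d (\<lambda>i. Re (f i))"
    by (intro eq_matI) (auto simp: Reals_cnj_iff[symmetric])
  with U that show thesis by metis
qed

lemma spectral_psd:
  assumes A: "psd d A"
  shows "\<exists>U f. unitary d U \<and> A = U * rdiag d f * cadj U \<and> (\<forall>i<d. 0 \<le> f i)"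
proof -
  have c: "A \<in> carrier_mat d d" and h: "cadj A = A" using A by (auto simp: psd_alt)
  obtain U f where U: "unitary d U" "A = U * rdiag d f * cadj U"
    using spectral_hermitian[OF c h] .
  have D: "rdiag d f = cadj U * A * U" using conj_move[OF U(1) c cdiag_carrier] U(2) by blast
  have "psd d (rdiag d f)" unfolding D by (rule psd_congruence[OF A unitary_carrier[OF U(1)]])
  then have "0 \<le> f i" if "i < d" for i
    using psd_diag(1)[of d "rdiag d f" i] that by simp
  with U show ?thesis by blast
qed

section \<open>Traces and functional calculus in an eigenbasis\<close>

lemma mtrace_diag_mult:
  assumes U: "unitary d U" and B: "B \<in> carrier_mat d d"
  shows "mtrace (U * cdiag d f * cadj U * B) = (\<Sum>i<d. f i * (cadj U * B * U) $$ (i,i))"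
proof -
  have c: "U \<in> carrier_mat d d" "cadj U \<in> carrier_mat d d" "cdiag d f \<in> carrier_mat d d" using U by (auto simp: unitary_def)
  have "mtrace (U * cdiag d f * cadj U * B) = mtrace (U * (cdiag d f * cadj U * B))"
    using c B by (simp add: assoc_mult_mat[of _ d d _ d _ d] mult_carrier_mat[of _ d d _ d])
  also have "\<dots> = mtrace (cdiag d f * cadj U * B * U)"
    using c B by (intro mtrace_comm[of _ d d]) auto
  also have "\<dots> = mtrace (cdiag d f * (cadj U * B * U))"
    using c B by (simp add: assoc_mult_mat[of _ d d _ d _ d] mult_carrier_mat[of _ d d _ d])
  also have "\<dots> = (\<Sum>i<d. f i * (cadj U * B * U) $$ (i,i))"
  proof -
    have M: "cadj U * B * U \<in> carrier_mat d d" using c B by auto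
    show ?thesis by (simp add: mtrace_eq[OF mult_carrier_mat[OF cdiag_carrier M]] cdiag_mult_left[OF M])
  qed
  finally show ?thesis .
qed

text \<open>In an eigenbasis of \<open>A\<close> the trace is a sum of nonnegative eigenvalues times
  nonnegative diagonal entries of \<open>B\<close>.\<close>

lemma mtrace_psd_mult_nonneg:
  assumes A: "psd d A" and B: "psd d B"
  shows "0 \<le> Re (mtrace (A * B))"
proof -
  obtain U f where U: "unitary d U" "A = U * rdiag d f * cadj U" "\<And>i. i < d \<Longrightarrow> 0 \<le> f i"
    using spectral_psd[OF A] by blast
  have p: "psd d (cadj U * B * U)" by (rule psd_congruence[OF B unitary_carrier[OF U(1)]])
  show ?thesis unfolding U(2) mtrace_diag_mult[OF U(1) psd_carrier[OF B]]
    using U(3) psd_diag(1)[OF p] by (auto intro!: sum_nonneg)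
qed

text \<open>\<open>mat_fun\<close> is a definite description, so existence and uniqueness are both
  due. The candidate acts correctly on every eigenvector, and the columns of \<open>U\<close> are
  eigenvectors that determine a matrix. Since \<open>U\<close> is an arbitrary eigenbasis, the lemma
  also says that the result does not depend on it; this independence is what later proofs
  exploit.\<close>

lemma mat_fun_diag:
  assumes U: "unitary d U" and A: "A = U * rdiag d f * cadj U"
  shows "mat_fun h A = U * rdiag d (\<lambda>i. h (f i)) * cadj U"
proof -
  have c: "U \<in> carrier_mat d d" "cadj U \<in> carrier_mat d d" and u: "cadj U * U = 1\<^sub>m d" "U * cadj U = 1\<^sub>m d"
    using U by (auto simp: unitary_def)
  have Ac: "A \<in> carrier_mat d d" using c by (auto simp: A)
  then have dr: "dim_row A = d" by auto
  let ?M = "U * rdiag d (\<lambda>i. h (f i)) * cadj U"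
  have act: "U * cdiag d g * cadj U *\<^sub>v v = U *\<^sub>v (cdiag d g *\<^sub>v (cadj U *\<^sub>v v))" if "v \<in> carrier_vec d" for g v
    using c that by (simp add: mult_mat_vec_carrier[of _ d d] assoc_mult_mat_vec[of _ d d _ d] mult_carrier_mat[of _ d d _ d])
  have dv: "(cdiag d g *\<^sub>v w) $ i = g i * w $ i" if "w \<in> carrier_vec d" "i < d" for g w i
    using that by (simp add: mult_mat_vec_entry[of _ d d] if_distrib[of "\<lambda>x. x * _"] sum.delta cong: if_cong)
  show ?thesis unfolding mat_fun_def dr
  proof (rule the_equality, intro conjI allI impI)
    show "?M \<in> carrier_mat d d" using c by auto
  next
    fix l v assume v: "v \<in> carrier_vec d" and ev: "A *\<^sub>v v = l \<cdot>\<^sub>v v"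
    define w where "w = cadj U *\<^sub>v v"
    have w: "w \<in> carrier_vec d" unfolding w_def using c(2) v by (rule mult_mat_vec_carrier)
    have v': "v = U *\<^sub>v w" using c v u by (simp add: w_def assoc_mult_mat_vec[of _ d d _ d, symmetric])
    have "cadj U *\<^sub>v (A *\<^sub>v v) = rdiag d f *\<^sub>v w"
    proof -
      have "cadj U *\<^sub>v (U *\<^sub>v x) = x" if "x \<in> carrier_vec d" for x
        using c u that by (simp add: assoc_mult_mat_vec[of _ d d _ d, symmetric])
      moreover have "rdiag d f *\<^sub>v w \<in> carrier_vec d" using w by (auto intro: mult_mat_vec_carrier)
      ultimately show ?thesis unfolding A act[OF v] w_def[symmetric] by blast
    qed
    moreover have "cadj U *\<^sub>v (A *\<^sub>v v) = l \<cdot>\<^sub>v w"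
      unfolding ev w_def using c v by (intro mult_mat_vec)
    ultimately have eqv: "rdiag d f *\<^sub>v w = l \<cdot>\<^sub>v w" by metis
    \<comment> \<open>A coordinate of \<open>w\<close> is either 0 or sits at an index with
      \<open>f i = l\<close>; in the second case \<open>l\<close> is real and
      \<open>h (Re l)\<close> is \<open>h (f i)\<close>.\<close>
    have lw: "complex_of_real (f i) * w $ i = l * w $ i" if "i < d" for i
      using dv[OF w that, of "\<lambda>i. complex_of_real (f i)"] that w unfolding eqv by auto
    have "rdiag d (\<lambda>i. h (f i)) *\<^sub>v w = complex_of_real (h (Re l)) \<cdot>\<^sub>v w"
    proof (rule eq_vecI)
      fix i assume "i < dim_vec (complex_of_real (h (Re l)) \<cdot>\<^sub>v w)"
      then have i: "i < d" using w by simp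
      show "(rdiag d (\<lambda>i. h (f i)) *\<^sub>v w) $ i = (complex_of_real (h (Re l)) \<cdot>\<^sub>v w) $ i"
        using lw[OF i] i w by (cases "w $ i = 0") (auto simp: dv)
    qed (use w in auto)
    then show "?M *\<^sub>v v = complex_of_real (h (Re l)) \<cdot>\<^sub>v v"
      unfolding act[OF v] w_def[symmetric] using c w v' by (simp add: mult_mat_vec)
  next
    fix M assume M: "M \<in> carrier_mat d d \<and> (\<forall>l v. v \<in> carrier_vec d \<longrightarrow> A *\<^sub>v v = l \<cdot>\<^sub>v v \<longrightarrow>
        M *\<^sub>v v = complex_of_real (h (Re l)) \<cdot>\<^sub>v v)"
    then have Mc: "M \<in> carrier_mat d d" by blast
    have AU: "A * U = U * rdiag d f"
      unfolding A using c u cdiag_carrier[of d "\<lambda>i. complex_of_real (f i)"] by (simp add: assoc_mult_mat[of _ d d _ d _ d] mult_carrier_mat[of _ d d _ d])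
    have colD: "col (U * cdiag d g) j = g j \<cdot>\<^sub>v col U j" if "j < d" for g j
      by (rule eq_vecI) (use that c in \<open>auto simp: cdiag_mult_right[OF c(1)]\<close>)
    have "M * U = U * rdiag d (\<lambda>i. h (f i))"
    proof (rule eq_matI)
      fix i j assume "i < dim_row (U * rdiag d (\<lambda>i. h (f i)))" "j < dim_col (U * rdiag d (\<lambda>i. h (f i)))"
      then have ij: "i < d" "j < d" using c by auto
      have "A *\<^sub>v col U j = complex_of_real (f j) \<cdot>\<^sub>v col U j"
        using col_mult2[OF Ac c(1) ij(2)] colD[OF ij(2)] AU by metis
      then have "M *\<^sub>v col U j = complex_of_real (h (f j)) \<cdot>\<^sub>v col U j"
        using M c ij by (metis Re_complex_of_real col_carrier_vec carrier_matD(2))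
      then have "col (M * U) j = col (U * rdiag d (\<lambda>i. h (f i))) j"
        using col_mult2[OF Mc c(1) ij(2)] colD[OF ij(2)] by metis
      then show "(M * U) $$ (i,j) = (U * rdiag d (\<lambda>i. h (f i))) $$ (i,j)"
        using ij c Mc by (metis carrier_matD cdiag_dim index_col index_mult_mat(2,3))
    qed (use c Mc in auto)
    then have "M * U * cadj U = ?M" by simp
    then show "M = ?M" using Mc c u by (simp add: assoc_mult_mat[of _ d d _ d _ d] mult_carrier_mat[of _ d d _ d])
  qed
qed

lemma mlog_diag:
  assumes "unitary d U" "A = U * rdiag d f * cadj U"
  shows "mlog A = U * rdiag d (\<lambda>i. if f i > 0 then ln (f i) else 0) * cadj U"
  unfolding mlog_def by (rule mat_fun_diag[OF assms])

subsection \<open>Tensor products and tensor powers\<close>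

lemma sum_div_mod: "(\<Sum>I<m * p. f I) = (\<Sum>a<m. \<Sum>b<p. f (a * p + b))" for m p :: nat
proof -
  have "(\<Sum>I<m * p. f I) = (\<Sum>a<m. sum f {a * p..<a * p + p})"
    by (simp add: sum.nat_group)
  also have "\<dots> = (\<Sum>a<m. \<Sum>b<p. f (a * p + b))"
  proof (rule sum.cong[OF refl])
    fix a
    show "sum f {a * p..<a * p + p} = (\<Sum>b<p. f (a * p + b))"
      using sum.shift_bounds_nat_ivl[of f 0 "a * p" p] by (simp add: atLeast0LessThan add.commute)
  qed
  finally show ?thesis .
qed

lemma mult_add_less: "a < m \<Longrightarrow> b < p \<Longrightarrow> a * p + b < m * p" for a b m p :: nat
proof -
  assume "a < m" "b < p"
  then have "a * p + b < (a + 1) * p" by simp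
  also have "\<dots> \<le> m * p" using \<open>a < m\<close> by (intro mult_le_mono1) simp
  finally show ?thesis .
qed

lemma div_mod_less:
  fixes m p i :: nat assumes "i < m * p" shows "i div p < m" "i mod p < p"
proof -
  have "0 < p" using assms by (cases p) auto
  then show "i div p < m" "i mod p < p" using assms by (auto simp: less_mult_imp_div_less)
qed

lemma mult_add_div_mod:
  fixes a b p :: nat assumes "b < p" shows "(a * p + b) div p = a" "(a * p + b) mod p = b"
  using assms by auto

lemma kron_carrier [intro]: "A \<in> carrier_mat m m' \<Longrightarrow> B \<in> carrier_mat p p' \<Longrightarrow> kron A B \<in> carrier_mat (m * p) (m' * p')"
  by (auto simp: kron_def)

lemma kron_entry:
  assumes "A \<in> carrier_mat m m'" "B \<in> carrier_mat p p'" "i < m * p" "j < m' * p'"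
  shows "kron A B $$ (i,j) = A $$ (i div p, j div p') * B $$ (i mod p, j mod p')"
  using assms by (auto simp: kron_def)

lemma kron_mult:
  assumes A: "A \<in> carrier_mat m m'" and B: "B \<in> carrier_mat p p'"
    and C: "C \<in> carrier_mat m' m''" and D: "D \<in> carrier_mat p' p''"
  shows "kron A B * kron C D = kron (A * C) (B * D)"
proof (rule eq_matI)
  fix i j assume "i < dim_row (kron (A * C) (B * D))" "j < dim_col (kron (A * C) (B * D))"
  then have ij: "i < m * p" "j < m'' * p''" using A B C D by (auto simp: kron_def)
  have "(kron A B * kron C D) $$ (i,j) = (\<Sum>a<m'. \<Sum>b<p'. (A $$ (i div p, a) * C $$ (a, j div p'')) * (B $$ (i mod p, b) * D $$ (b, j mod p'')))"
    unfolding mult_mat_entry[OF kron_carrier[OF A B] kron_carrier[OF C D] ij] sum_div_mod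
    by (intro sum.cong refl)
       (use ij A B C D in \<open>simp add: kron_entry[OF A B ij(1)] kron_entry[OF C D _ ij(2)] mult_add_less mult_ac\<close>)
  also have "\<dots> = (A * C) $$ (i div p, j div p'') * (B * D) $$ (i mod p, j mod p'')"
    using div_mod_less[OF ij(1)] div_mod_less[OF ij(2)]
    by (simp add: mult_mat_entry[OF A C] mult_mat_entry[OF B D] sum_product)
  also have "\<dots> = kron (A * C) (B * D) $$ (i,j)"
    using kron_entry[OF mult_carrier_mat[OF A C] mult_carrier_mat[OF B D] ij] by simp
  finally show "(kron A B * kron C D) $$ (i,j) = kron (A * C) (B * D) $$ (i,j)" .
qed (use A B C D in \<open>auto simp: kron_def\<close>)

lemma cadj_kron: "cadj (kron A B) = kron (cadj A) (cadj B)"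
proof (rule eq_matI)
  fix i j assume "i < dim_row (kron (cadj A) (cadj B))" "j < dim_col (kron (cadj A) (cadj B))"
  then have ij: "i < dim_col A * dim_col B" "j < dim_row A * dim_row B" by (auto simp: kron_def)
  show "cadj (kron A B) $$ (i,j) = kron (cadj A) (cadj B) $$ (i,j)"
    using ij div_mod_less[OF ij(1)] div_mod_less[OF ij(2)] by (simp add: kron_def)
qed (auto simp: kron_def)

lemma kron_cdiag: "kron (cdiag m f) (cdiag p g) = cdiag (m * p) (\<lambda>i. f (i div p) * g (i mod p))"
proof (rule eq_matI)
  fix i j assume "i < dim_row (cdiag (m * p) (\<lambda>i. f (i div p) * g (i mod p)))"
    "j < dim_col (cdiag (m * p) (\<lambda>i. f (i div p) * g (i mod p)))"
  then have ij: "i < m * p" "j < m * p" by auto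
  have "i = j" if "i div p = j div p" "i mod p = j mod p"
    using that by (metis div_mod_decomp)
  then show "kron (cdiag m f) (cdiag p g) $$ (i,j) = cdiag (m * p) (\<lambda>i. f (i div p) * g (i mod p)) $$ (i,j)"
    using ij div_mod_less[OF ij(1)] div_mod_less[OF ij(2)]
    by (auto simp: kron_entry[OF cdiag_carrier cdiag_carrier])
qed (auto simp: kron_def)

lemma one_eq_cdiag: "1\<^sub>m d = cdiag d (\<lambda>i. 1)"
  by (rule eq_matI) auto

lemma kron_one: "kron (1\<^sub>m m) (1\<^sub>m p) = 1\<^sub>m (m * p)"
  by (simp add: one_eq_cdiag kron_cdiag)

lemma unitary_kron:
  assumes "unitary m U" "unitary p V" shows "unitary (m * p) (kron U V)"
  using assms by (auto simp: unitary_def cadj_kron kron_one kron_mult[of _ m m _ p p _ m _ p])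

lemma kron_conj:
  assumes U: "U \<in> carrier_mat m m" and D: "D \<in> carrier_mat m m" and V: "V \<in> carrier_mat p p" and E: "E \<in> carrier_mat p p"
  shows "kron (U * D * cadj U) (V * E * cadj V) = kron U V * kron D E * cadj (kron U V)"
  using assms by (simp add: cadj_kron kron_mult[OF U V D E] kron_mult[OF mult_carrier_mat[OF U D] mult_carrier_mat[OF V E] cadj_carrier[OF U] cadj_carrier[OF V]])

lemma psd_kron:
  assumes "psd m A" "psd p B" shows "psd (m * p) (kron A B)"
proof -
  obtain U f where U: "unitary m U" "A = U * rdiag m f * cadj U" "\<forall>i<m. 0 \<le> f i" using spectral_psd[OF assms(1)] by blast
  obtain V g where V: "unitary p V" "B = V * rdiag p g * cadj V" "\<forall>i<p. 0 \<le> g i" using spectral_psd[OF assms(2)] by blast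
  have "kron A B = kron U V * rdiag (m * p) (\<lambda>i. f (i div p) * g (i mod p)) * cadj (kron U V)"
    unfolding U(2) V(2) using kron_conj[OF unitary_carrier[OF U(1)] cdiag_carrier unitary_carrier[OF V(1)] cdiag_carrier]
    by (simp add: kron_cdiag)
  then show ?thesis
    using psd_conj_rdiag[OF unitary_carrier[OF unitary_kron[OF U(1) V(1)]], of "\<lambda>i. f (i div p) * g (i mod p)"] U(3) V(3)
    by (simp add: div_mod_less)
qed

lemma kron_add_left:
  assumes "A \<in> carrier_mat m m" "A' \<in> carrier_mat m m" "B \<in> carrier_mat p p"
  shows "kron (A + A') B = kron A B + kron A' B"
  by (rule eq_matI) (use assms in \<open>auto simp: kron_def div_mod_less algebra_simps\<close>)

lemma kron_add_right:
  assumes "A \<in> carrier_mat m m" "B' \<in> carrier_mat p p" "B \<in> carrier_mat p p"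
  shows "kron A (B + B') = kron A B + kron A B'"
  by (rule eq_matI) (use assms in \<open>auto simp: kron_def div_mod_less algebra_simps\<close>)

text \<open>The difference of the two Kronecker products is \<sigma> (x) (Z - \<tau>) + (W -
  \<sigma>) (x) Z, a sum of positive terms. This carries the second-error bound from the universal
  operators to all symmetric states.\<close>

lemma mtrace_kron_mono:
  assumes s: "psd m \<sigma>" and t: "psd p \<tau>" and ds: "psd m (W - \<sigma>)" and dt: "psd p (Z - \<tau>)"
    and W: "psd m W" and Z: "psd p Z" and T: "psd (m * p) T"
  shows "Re (mtrace (kron \<sigma> \<tau> * T)) \<le> Re (mtrace (kron W Z * T))"
proof -
  have c: "\<sigma> \<in> carrier_mat m m" "\<tau> \<in> carrier_mat p p" "W \<in> carrier_mat m m" "Z \<in> carrier_mat p p" "T \<in> carrier_mat (m * p) (m * p)"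
    "W - \<sigma> \<in> carrier_mat m m" "Z - \<tau> \<in> carrier_mat p p"
    using assms by (auto dest: psd_carrier)
  have k: "kron \<sigma> \<tau> \<in> carrier_mat (m * p) (m * p)" "kron (W - \<sigma>) Z \<in> carrier_mat (m * p) (m * p)" "kron \<sigma> (Z - \<tau>) \<in> carrier_mat (m * p) (m * p)"
    using c by auto
  have e: "\<sigma> + (W - \<sigma>) = W" "\<tau> + (Z - \<tau>) = Z"
    by (rule eq_matI; use c in auto)+
  have "kron W Z = kron \<sigma> Z + kron (W - \<sigma>) Z"
    using kron_add_left[OF c(1,6,4)] e by simp
  also have "kron \<sigma> Z = kron \<sigma> \<tau> + kron \<sigma> (Z - \<tau>)"
    using kron_add_right[OF c(1,7,2)] e by simp
  finally have "kron W Z * T = kron \<sigma> \<tau> * T + (kron \<sigma> (Z - \<tau>) * T + kron (W - \<sigma>) Z * T)"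
    using k c by (simp add: add_mult_distrib_mat[of _ "m * p" "m * p" _ _ "m * p"])
  then have "mtrace (kron W Z * T) = mtrace (kron \<sigma> \<tau> * T) + mtrace (kron \<sigma> (Z - \<tau>) * T) + mtrace (kron (W - \<sigma>) Z * T)"
    using k c by (simp add: mtrace_add[of _ "m * p"] mult_carrier_mat[of _ "m * p" "m * p" _ "m * p"])
  moreover have "0 \<le> Re (mtrace (kron \<sigma> (Z - \<tau>) * T))" "0 \<le> Re (mtrace (kron (W - \<sigma>) Z * T))"
    using assms by (auto intro!: mtrace_psd_mult_nonneg[of "m * p"] psd_kron)
  ultimately show ?thesis by simp
qed

section \<open>Diagonals in product bases and their marginals\<close>

lemma sum_swap5:
  "(\<Sum>l\<in>L. \<Sum>a\<in>A. \<Sum>b\<in>B. \<Sum>c\<in>C. \<Sum>d\<in>D. f a b c d l) = (\<Sum>a\<in>A. \<Sum>b\<in>B. \<Sum>c\<in>C. \<Sum>d\<in>D. \<Sum>l\<in>L. f a b c d l)"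
  by (rule trans[OF sum.swap], rule sum.cong[OF refl], rule trans[OF sum.swap], rule sum.cong[OF refl],
      rule trans[OF sum.swap], rule sum.cong[OF refl], rule sum.swap)

text \<open>The basis of the traced-out factor disappears because \<open>V * cadj V = 1\<close>.
  Hence in every product basis the diagonal has as first marginal the diagonal of the reduced
  operator.\<close>

lemma ptrB_marginal:
  assumes R: "R \<in> carrier_mat (dA * dB) (dA * dB)" and U: "U \<in> carrier_mat dA dA" and V: "unitary dB V" and k: "k < dA"
  shows "(\<Sum>l<dB. (cadj (kron U V) * R * kron U V) $$ (k * dB + l, k * dB + l)) = (cadj U * ptrB dA dB R * U) $$ (k,k)"
proof -
  have Vc: "V \<in> carrier_mat dB dB" using V by (rule unitary_carrier)
  have VV: "(\<Sum>l<dB. cnj (V $$ (b,l)) * V $$ (b',l)) = (if b = b' then 1 else 0)" if "b < dB" "b' < dB" for b b'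
  proof -
    have "(V * cadj V) $$ (b',b) = (if b = b' then 1 else 0)" using V that by (auto simp: unitary_def)
    then show ?thesis using that Vc by (simp add: mult_mat_entry[of _ dB dB _ dB] mult.commute)
  qed
  have K: "kron U V \<in> carrier_mat (dA * dB) (dA * dB)" using U Vc by auto
  have Pc: "ptrB dA dB R \<in> carrier_mat dA dA" by (simp add: ptrB_def)
  let ?f = "\<lambda>a b a' b' l. (cnj (U $$ (a,k)) * R $$ (a * dB + b, a' * dB + b') * U $$ (a',k)) * (cnj (V $$ (b,l)) * V $$ (b',l))"
  have "(\<Sum>l<dB. (cadj (kron U V) * R * kron U V) $$ (k * dB + l, k * dB + l))
      = (\<Sum>l<dB. \<Sum>a<dA. \<Sum>b<dB. \<Sum>a'<dA. \<Sum>b'<dB. ?f a b a' b' l)"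
  proof (intro sum.cong refl)
    fix l assume l: "l \<in> {..<dB}"
    then have kl: "k * dB + l < dA * dB" using k by (auto intro: mult_add_less)
    show "(cadj (kron U V) * R * kron U V) $$ (k * dB + l, k * dB + l) = (\<Sum>a<dA. \<Sum>b<dB. \<Sum>a'<dA. \<Sum>b'<dB. ?f a b a' b' l)"
      unfolding conj_entry[OF cadj_carrier[OF K] R K kl kl] sum_div_mod
      by (intro sum.cong refl) (use kl l K in \<open>simp add: kron_entry[OF U Vc] mult_add_less mult_ac\<close>)
  qed
  also have "\<dots> = (\<Sum>a<dA. \<Sum>b<dB. \<Sum>a'<dA. \<Sum>b'<dB. \<Sum>l<dB. ?f a b a' b' l)"
    by (rule sum_swap5)
  also have "\<dots> = (\<Sum>a<dA. \<Sum>b<dB. \<Sum>a'<dA. cnj (U $$ (a,k)) * R $$ (a * dB + b, a' * dB + b) * U $$ (a',k))"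
  proof (rule sum.cong[OF refl], rule sum.cong[OF refl], rule sum.cong[OF refl])
    fix a b a' assume b: "b \<in> {..<dB}"
    have "(\<Sum>b'<dB. \<Sum>l<dB. ?f a b a' b' l) = (\<Sum>b'<dB. if b = b' then cnj (U $$ (a,k)) * R $$ (a * dB + b, a' * dB + b') * U $$ (a',k) else 0)"
      by (rule sum.cong[OF refl]) (use b in \<open>simp add: sum_distrib_left[symmetric] VV\<close>)
    then show "(\<Sum>b'<dB. \<Sum>l<dB. ?f a b a' b' l) = cnj (U $$ (a,k)) * R $$ (a * dB + b, a' * dB + b) * U $$ (a',k)"
      using b by (simp add: sum.delta)
  qed
  also have "\<dots> = (\<Sum>a<dA. \<Sum>a'<dA. \<Sum>b<dB. cnj (U $$ (a,k)) * R $$ (a * dB + b, a' * dB + b) * U $$ (a',k))"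
    by (rule sum.cong[OF refl], rule sum.swap)
  also have "\<dots> = (cadj U * ptrB dA dB R * U) $$ (k,k)"
    unfolding conj_entry[OF cadj_carrier[OF U] Pc U k k]
    by (intro sum.cong refl) (use k U in \<open>simp add: ptrB_def sum_distrib_left sum_distrib_right\<close>)
  finally show ?thesis .
qed

lemma ptrA_marginal:
  assumes R: "R \<in> carrier_mat (dA * dB) (dA * dB)" and U: "unitary dA U" and V: "V \<in> carrier_mat dB dB" and l: "l < dB"
  shows "(\<Sum>k<dA. (cadj (kron U V) * R * kron U V) $$ (k * dB + l, k * dB + l)) = (cadj V * ptrA dA dB R * V) $$ (l,l)"
proof -
  have Uc: "U \<in> carrier_mat dA dA" using U by (rule unitary_carrier)
  have UU: "(\<Sum>k<dA. cnj (U $$ (b,k)) * U $$ (b',k)) = (if b = b' then 1 else 0)" if "b < dA" "b' < dA" for b b'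
  proof -
    have "(U * cadj U) $$ (b',b) = (if b = b' then 1 else 0)" using U that by (auto simp: unitary_def)
    then show ?thesis using that Uc by (simp add: mult_mat_entry[of _ dA dA _ dA] mult.commute)
  qed
  have K: "kron U V \<in> carrier_mat (dA * dB) (dA * dB)" using Uc V by auto
  have Pc: "ptrA dA dB R \<in> carrier_mat dB dB" by (simp add: ptrA_def)
  let ?f = "\<lambda>a b a' b' k. (cnj (V $$ (b,l)) * R $$ (a * dB + b, a' * dB + b') * V $$ (b',l)) * (cnj (U $$ (a,k)) * U $$ (a',k))"
  have "(\<Sum>k<dA. (cadj (kron U V) * R * kron U V) $$ (k * dB + l, k * dB + l))
      = (\<Sum>k<dA. \<Sum>a<dA. \<Sum>b<dB. \<Sum>a'<dA. \<Sum>b'<dB. ?f a b a' b' k)"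
  proof (intro sum.cong refl)
    fix k assume k: "k \<in> {..<dA}"
    then have kl: "k * dB + l < dA * dB" using l by (auto intro: mult_add_less)
    show "(cadj (kron U V) * R * kron U V) $$ (k * dB + l, k * dB + l) = (\<Sum>a<dA. \<Sum>b<dB. \<Sum>a'<dA. \<Sum>b'<dB. ?f a b a' b' k)"
      unfolding conj_entry[OF cadj_carrier[OF K] R K kl kl] sum_div_mod
      by (intro sum.cong refl) (use kl l K in \<open>simp add: kron_entry[OF Uc V] mult_add_less mult_ac\<close>)
  qed
  also have "\<dots> = (\<Sum>a<dA. \<Sum>b<dB. \<Sum>a'<dA. \<Sum>b'<dB. \<Sum>k<dA. ?f a b a' b' k)"
    by (rule sum_swap5)
  also have "\<dots> = (\<Sum>a<dA. \<Sum>b<dB. \<Sum>b'<dB. cnj (V $$ (b,l)) * R $$ (a * dB + b, a * dB + b') * V $$ (b',l))"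
  proof (rule sum.cong[OF refl], rule sum.cong[OF refl])
    fix a b assume a: "a \<in> {..<dA}"
    have "(\<Sum>a'<dA. \<Sum>b'<dB. \<Sum>k<dA. ?f a b a' b' k)
        = (\<Sum>a'<dA. if a = a' then (\<Sum>b'<dB. cnj (V $$ (b,l)) * R $$ (a * dB + b, a' * dB + b') * V $$ (b',l)) else 0)"
      by (rule sum.cong[OF refl]) (use a in \<open>simp add: sum_distrib_left[symmetric] UU\<close>)
    then show "(\<Sum>a'<dA. \<Sum>b'<dB. \<Sum>k<dA. ?f a b a' b' k)
        = (\<Sum>b'<dB. cnj (V $$ (b,l)) * R $$ (a * dB + b, a * dB + b') * V $$ (b',l))"
      using a by (simp add: sum.delta)
  qed
  also have "\<dots> = (\<Sum>b<dB. \<Sum>b'<dB. \<Sum>a<dA. cnj (V $$ (b,l)) * R $$ (a * dB + b, a * dB + b') * V $$ (b',l))"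
    by (subst sum.swap, rule sum.cong[OF refl], rule sum.swap)
  also have "\<dots> = (cadj V * ptrA dA dB R * V) $$ (l,l)"
    unfolding conj_entry[OF cadj_carrier[OF V] Pc V l l]
    by (intro sum.cong refl) (use l V in \<open>simp add: ptrA_def sum_distrib_left sum_distrib_right\<close>)
  finally show ?thesis .
qed

text \<open>An indexing \<open>\<delta>\<close> of a basis of size \<open>N\<close> by words of length \<open>n\<close> over \<open>d\<close> letters covers both
  the basis of \<open>(C\<^sup>d)\<^sup>\<otimes>\<^sup>n\<close> and the reordered basis of \<open>A\<^sup>n \<otimes> B\<^sup>n\<close>.\<close>

definition word_index :: "nat \<Rightarrow> nat \<Rightarrow> nat \<Rightarrow> (nat \<Rightarrow> nat \<Rightarrow> nat) \<Rightarrow> bool" where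
  "word_index N d n \<delta> \<longleftrightarrow> bij_betw (\<lambda>I. restrict (\<delta> I) {..<n}) {..<N} ({..<n} \<rightarrow>\<^sub>E {..<d})"

definition tensor_power :: "nat \<Rightarrow> nat \<Rightarrow> (nat \<Rightarrow> nat \<Rightarrow> nat) \<Rightarrow> complex mat \<Rightarrow> complex mat" where
  "tensor_power N n \<delta> X = mat N N (\<lambda>(I,J). \<Prod>k<n. X $$ (\<delta> I k, \<delta> J k))"

lemma tensor_power_carrier [intro, simp]: "tensor_power N n \<delta> X \<in> carrier_mat N N"
  by (simp add: tensor_power_def)

lemma tensor_power_dim [simp]: "dim_row (tensor_power N n \<delta> X) = N" "dim_col (tensor_power N n \<delta> X) = N"
  by (simp_all add: tensor_power_def)

lemma tensor_power_entry: "I < N \<Longrightarrow> J < N \<Longrightarrow> tensor_power N n \<delta> X $$ (I,J) = (\<Prod>k<n. X $$ (\<delta> I k, \<delta> J k))"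
  by (simp add: tensor_power_def)

lemma word_index_less: "word_index N d n \<delta> \<Longrightarrow> I < N \<Longrightarrow> k < n \<Longrightarrow> \<delta> I k < d"
proof -
  assume w: "word_index N d n \<delta>" and I: "I < N" and k: "k < n"
  have "restrict (\<delta> I) {..<n} \<in> {..<n} \<rightarrow>\<^sub>E {..<d}"
    using bij_betwE[OF w[unfolded word_index_def]] I by auto
  then show ?thesis using k by auto
qed

lemma sum_word_index:
  assumes "word_index N d n \<delta>"
  shows "(\<Sum>I<N. F (restrict (\<delta> I) {..<n})) = (\<Sum>f\<in>{..<n} \<rightarrow>\<^sub>E {..<d}. F f)"
  using sum.reindex_bij_betw[OF assms[unfolded word_index_def]] .

text \<open>The distributive law over all words. Products, traces and partial traces of tensor
  powers reduce to it.\<close>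

lemma sum_prod_word_index:
  fixes g :: "nat \<Rightarrow> nat \<Rightarrow> 'a :: comm_semiring_1"
  assumes "word_index N d n \<delta>"
  shows "(\<Sum>I<N. \<Prod>k<n. g k (\<delta> I k)) = (\<Prod>k<n. \<Sum>j<d. g k j)"
proof -
  have "(\<Sum>I<N. \<Prod>k<n. g k (\<delta> I k)) = (\<Sum>I<N. \<Prod>k<n. g k (restrict (\<delta> I) {..<n} k))"
    by (intro sum.cong prod.cong) auto
  then show ?thesis unfolding sum_word_index[OF assms, of "\<lambda>f. \<Prod>k<n. g k (f k)"]
    by (simp add: prod_sum_PiE)
qed

lemma word_index_eqI:
  assumes "word_index N d n \<delta>" "I < N" "J < N" "\<And>k. k < n \<Longrightarrow> \<delta> I k = \<delta> J k"
  shows "I = J"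
proof -
  have "restrict (\<delta> I) {..<n} = restrict (\<delta> J) {..<n}" using assms(4) by (auto simp: restrict_def)
  then show ?thesis using assms(1-3) by (auto simp: word_index_def bij_betw_def inj_on_def)
qed

lemma tensor_power_mult:
  assumes w: "word_index N d n \<delta>" and X: "X \<in> carrier_mat d d" and Y: "Y \<in> carrier_mat d d"
  shows "tensor_power N n \<delta> X * tensor_power N n \<delta> Y = tensor_power N n \<delta> (X * Y)"
proof (rule eq_matI)
  fix I J assume "I < dim_row (tensor_power N n \<delta> (X * Y))" "J < dim_col (tensor_power N n \<delta> (X * Y))"
  then have IJ: "I < N" "J < N" by auto
  have "(tensor_power N n \<delta> X * tensor_power N n \<delta> Y) $$ (I,J)
      = (\<Sum>K<N. \<Prod>k<n. X $$ (\<delta> I k, \<delta> K k) * Y $$ (\<delta> K k, \<delta> J k))"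
    unfolding mult_mat_entry[OF tensor_power_carrier tensor_power_carrier IJ]
    by (intro sum.cong refl) (use IJ in \<open>simp add: tensor_power_entry prod.distrib\<close>)
  also have "\<dots> = (\<Prod>k<n. \<Sum>j<d. X $$ (\<delta> I k, j) * Y $$ (j, \<delta> J k))"
    by (rule sum_prod_word_index[OF w])
  also have "\<dots> = tensor_power N n \<delta> (X * Y) $$ (I,J)"
    using IJ by (simp add: tensor_power_entry mult_mat_entry[OF X Y] word_index_less[OF w])
  finally show "(tensor_power N n \<delta> X * tensor_power N n \<delta> Y) $$ (I,J) = tensor_power N n \<delta> (X * Y) $$ (I,J)" .
qed auto

lemma cadj_tensor_power:
  assumes w: "word_index N d n \<delta>" and X: "X \<in> carrier_mat d d"
  shows "cadj (tensor_power N n \<delta> X) = tensor_power N n \<delta> (cadj X)"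
  by (rule eq_matI) (use X in \<open>auto simp: tensor_power_entry word_index_less[OF w]\<close>)

lemma tensor_power_cdiag:
  assumes w: "word_index N d n \<delta>"
  shows "tensor_power N n \<delta> (cdiag d f) = cdiag N (\<lambda>I. \<Prod>k<n. f (\<delta> I k))"
proof (rule eq_matI)
  fix I J assume "I < dim_row (cdiag N (\<lambda>I. \<Prod>k<n. f (\<delta> I k)))" "J < dim_col (cdiag N (\<lambda>I. \<Prod>k<n. f (\<delta> I k)))"
  then have IJ: "I < N" "J < N" by auto
  show "tensor_power N n \<delta> (cdiag d f) $$ (I,J) = cdiag N (\<lambda>I. \<Prod>k<n. f (\<delta> I k)) $$ (I,J)"
  proof (cases "I = J")
    case True
    then show ?thesis using IJ by (simp add: tensor_power_entry word_index_less[OF w])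
  next
    case False
    then obtain k where "k < n" "\<delta> I k \<noteq> \<delta> J k" using word_index_eqI[OF w IJ] by blast
    then show ?thesis using IJ False by (auto simp: tensor_power_entry word_index_less[OF w])
  qed
qed auto

lemma tensor_power_one: "word_index N d n \<delta> \<Longrightarrow> tensor_power N n \<delta> (1\<^sub>m d) = 1\<^sub>m N"
  by (simp add: one_eq_cdiag tensor_power_cdiag)

lemma unitary_tensor_power:
  assumes w: "word_index N d n \<delta>" and "unitary d U"
  shows "unitary N (tensor_power N n \<delta> U)"
  using assms(2) by (auto simp: unitary_def cadj_tensor_power[OF w] tensor_power_mult[OF w] tensor_power_one[OF w])

lemma tensor_power_diag:
  assumes w: "word_index N d n \<delta>" and U: "U \<in> carrier_mat d d"
  shows "tensor_power N n \<delta> (U * rdiag d f * cadj U)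
    = tensor_power N n \<delta> U * rdiag N (\<lambda>I. \<Prod>k<n. f (\<delta> I k)) * cadj (tensor_power N n \<delta> U)"
  using tensor_power_cdiag[OF w, of "\<lambda>i. complex_of_real (f i)"] U
  by (simp add: cadj_tensor_power[OF w] tensor_power_mult[OF w, symmetric] mult_carrier_mat[of _ d d _ d])

lemma mtrace_tensor_power:
  assumes w: "word_index N d n \<delta>" and X: "X \<in> carrier_mat d d"
  shows "mtrace (tensor_power N n \<delta> X) = mtrace X ^ n"
  using X sum_prod_word_index[OF w, of "\<lambda>k j. X $$ (j,j)"]
  by (simp add: mtrace_eq[of _ N N] mtrace_eq[of _ d d] tensor_power_entry)

section \<open>Base-\<open>d\<close> digits as an indexing by words\<close>

lemma digit_less: "i < d ^ n \<Longrightarrow> k < n \<Longrightarrow> digit d k i < d"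
  by (cases "d = 0") (auto simp: digit_def power_0_left split: if_splits)

lemma sum_digits: "(\<Sum>k<n. digit d k i * d ^ k) = i mod d ^ n"
proof (induction n)
  case (Suc n)
  have "i mod (d ^ n * d) = d ^ n * (i div d ^ n mod d) + i mod d ^ n" by (rule mod_mult2_eq)
  then show ?case using Suc by (simp add: digit_def mult.commute add.commute)
qed simp

lemma digits_eqI: "i < d ^ n \<Longrightarrow> j < d ^ n \<Longrightarrow> (\<And>k. k < n \<Longrightarrow> digit d k i = digit d k j) \<Longrightarrow> i = j"
proof -
  assume ij: "i < d ^ n" "j < d ^ n" and e: "\<And>k. k < n \<Longrightarrow> digit d k i = digit d k j"
  have "(\<Sum>k<n. digit d k i * d ^ k) = (\<Sum>k<n. digit d k j * d ^ k)"
    by (rule sum.cong[OF refl]) (simp add: e)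
  then show "i = j" using ij by (simp add: sum_digits)
qed

text \<open>Injectivity suffices, because there are exactly \<open>d ^ n\<close> words to be
  hit.\<close>

lemma word_indexI:
  assumes less: "\<And>I k. I < d ^ n \<Longrightarrow> k < n \<Longrightarrow> \<delta> I k < d"
    and eq: "\<And>I J. I < d ^ n \<Longrightarrow> J < d ^ n \<Longrightarrow> (\<And>k. k < n \<Longrightarrow> \<delta> I k = \<delta> J k) \<Longrightarrow> I = J"
  shows "word_index (d ^ n) d n \<delta>"
proof -
  let ?F = "\<lambda>I. restrict (\<delta> I) {..<n}"
  have inj: "inj_on ?F {..<d ^ n}"
  proof (rule inj_onI)
    fix I J assume IJ: "I \<in> {..<d ^ n}" "J \<in> {..<d ^ n}" and e: "?F I = ?F J"
    have "\<delta> I k = \<delta> J k" if "k < n" for k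
      using fun_cong[OF e, of k] that by simp
    then show "I = J" using eq[of I J] IJ by blast
  qed
  have sub: "?F ` {..<d ^ n} \<subseteq> {..<n} \<rightarrow>\<^sub>E {..<d}"
  proof
    fix f assume "f \<in> ?F ` {..<d ^ n}"
    then obtain I where "I < d ^ n" "f = ?F I" by blast
    then show "f \<in> {..<n} \<rightarrow>\<^sub>E {..<d}" using less by (simp add: restrict_PiE_iff)
  qed
  have "?F ` {..<d ^ n} = {..<n} \<rightarrow>\<^sub>E {..<d}"
    by (rule card_subset_eq[OF _ sub]) (simp_all add: card_image[OF inj] card_PiE finite_PiE)
  with inj show ?thesis by (simp add: word_index_def bij_betw_def)
qed

lemma word_index_digit: "word_index (d ^ n) d n (\<lambda>I k. digit d k I)"
  by (rule word_indexI) (auto intro: digit_less digits_eqI)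

lemma tpow_eq: "tpow d n X = tensor_power (d ^ n) n (\<lambda>I k. digit d k I) X"
  by (simp add: tpow_def tensor_power_def)

text \<open>A number with the prescribed digits exists by the bijectivity of the digit indexing;
  \<open>sum_digits\<close> then identifies it as the given sum.\<close>

lemma ex_digits:
  assumes "\<And>k. k < n \<Longrightarrow> f k < d"
  shows "(\<Sum>k<n. f k * d ^ k) < d ^ n" "\<And>k. k < n \<Longrightarrow> digit d k (\<Sum>k<n. f k * d ^ k) = f k"
proof -
  have "restrict f {..<n} \<in> (\<lambda>I. restrict (\<lambda>k. digit d k I) {..<n}) ` {..<d ^ n}"
    using word_index_digit[of d n] assms by (auto simp: word_index_def bij_betw_def)
  then obtain I where I: "I < d ^ n" "restrict f {..<n} = restrict (\<lambda>k. digit d k I) {..<n}" by auto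
  have e: "f k = digit d k I" if "k < n" for k using fun_cong[OF I(2), of k] that by simp
  have "(\<Sum>k<n. f k * d ^ k) = (\<Sum>k<n. digit d k I * d ^ k)"
    by (rule sum.cong[OF refl]) (simp add: e)
  then have "(\<Sum>k<n. f k * d ^ k) = I" using I(1) by (simp add: sum_digits)
  with I(1) e show "(\<Sum>k<n. f k * d ^ k) < d ^ n" "\<And>k. k < n \<Longrightarrow> digit d k (\<Sum>k<n. f k * d ^ k) = f k" by auto
qed

text \<open>The letter of a basis vector of \<open>A^n (x) B^n\<close> at position \<open>k\<close>,
  read as a basis index of the \<open>k\<close>-th copy of \<open>A (x) B\<close>. It turns the
  reordering of factors inside \<open>rho_pow\<close> into a mere choice of word index.\<close>

definition pair_digit :: "nat \<Rightarrow> nat \<Rightarrow> nat \<Rightarrow> nat \<Rightarrow> nat \<Rightarrow> nat" where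
  "pair_digit dA dB n I k = digit dA k (I div dB ^ n) * dB + digit dB k (I mod dB ^ n)"

lemma word_index_pair_digit: "word_index (dA ^ n * dB ^ n) (dA * dB) n (pair_digit dA dB n)"
  unfolding power_mult_distrib[symmetric]
proof (rule word_indexI, unfold power_mult_distrib)
  fix I k assume "I < dA ^ n * dB ^ n" "k < n"
  then show "pair_digit dA dB n I k < dA * dB"
    unfolding pair_digit_def by (intro mult_add_less digit_less[of _ _ n] div_mod_less)
next
  fix I J assume I: "I < dA ^ n * dB ^ n" and J: "J < dA ^ n * dB ^ n"
    and e: "\<And>k. k < n \<Longrightarrow> pair_digit dA dB n I k = pair_digit dA dB n J k"
  note i = div_mod_less[OF I] and j = div_mod_less[OF J]
  have "digit dA k (I div dB ^ n) = digit dA k (J div dB ^ n) \<and> digit dB k (I mod dB ^ n) = digit dB k (J mod dB ^ n)"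
    if "k < n" for k
  proof -
    have "digit dB k (I mod dB ^ n) < dB" "digit dB k (J mod dB ^ n) < dB"
      using digit_less[OF i(2) that] digit_less[OF j(2) that] by auto
    then show ?thesis
      using e[OF that] mult_add_div_mod[of _ dB] unfolding pair_digit_def by metis
  qed
  then have "I div dB ^ n = J div dB ^ n" "I mod dB ^ n = J mod dB ^ n"
    using digits_eqI[OF i(1) j(1)] digits_eqI[OF i(2) j(2)] by auto
  then show "I = J" by (metis div_mod_decomp)
qed

lemma rho_pow_eq: "rho_pow dA dB n X = tensor_power (dA ^ n * dB ^ n) n (pair_digit dA dB n) X"
  by (simp add: rho_pow_def tensor_power_def pair_digit_def)

lemma kron_tpow:
  assumes X: "X \<in> carrier_mat dA dA" and Y: "Y \<in> carrier_mat dB dB"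
  shows "kron (tpow dA n X) (tpow dB n Y) = rho_pow dA dB n (kron X Y)"
proof (rule eq_matI)
  fix I J assume "I < dim_row (rho_pow dA dB n (kron X Y))" "J < dim_col (rho_pow dA dB n (kron X Y))"
  then have I: "I < dA ^ n * dB ^ n" and J: "J < dA ^ n * dB ^ n" by (auto simp: rho_pow_eq)
  note i = div_mod_less[OF I] and j = div_mod_less[OF J]
  have "kron X Y $$ (pair_digit dA dB n I k, pair_digit dA dB n J k)
      = X $$ (digit dA k (I div dB ^ n), digit dA k (J div dB ^ n)) * Y $$ (digit dB k (I mod dB ^ n), digit dB k (J mod dB ^ n))"
    if k: "k < n" for k
    using digit_less[OF i(1) k] digit_less[OF i(2) k] digit_less[OF j(1) k] digit_less[OF j(2) k]
    by (simp add: pair_digit_def kron_entry[OF X Y] mult_add_less)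
  then show "kron (tpow dA n X) (tpow dB n Y) $$ (I,J) = rho_pow dA dB n (kron X Y) $$ (I,J)"
    using I J i j unfolding rho_pow_eq tpow_eq
    by (simp add: kron_entry[OF tensor_power_carrier tensor_power_carrier] tensor_power_entry prod.distrib)
qed (auto simp: kron_def tpow_def rho_pow_def)

section \<open>Partial traces of tensor powers and of states\<close>

lemma ptrB_rho_pow:
  "ptrB (dA ^ n) (dB ^ n) (rho_pow dA dB n \<rho>) = tpow dA n (ptrB dA dB \<rho>)"
proof (rule eq_matI)
  fix a a' assume "a < dim_row (tpow dA n (ptrB dA dB \<rho>))" "a' < dim_col (tpow dA n (ptrB dA dB \<rho>))"
  then have a: "a < dA ^ n" "a' < dA ^ n" by (auto simp: tpow_def)
  have "ptrB (dA ^ n) (dB ^ n) (rho_pow dA dB n \<rho>) $$ (a,a')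
      = (\<Sum>b<dB ^ n. \<Prod>k<n. \<rho> $$ (digit dA k a * dB + digit dB k b, digit dA k a' * dB + digit dB k b))"
    using a by (simp add: ptrB_def rho_pow_def mult_add_less mult_add_div_mod)
  also have "\<dots> = (\<Prod>k<n. \<Sum>b<dB. \<rho> $$ (digit dA k a * dB + b, digit dA k a' * dB + b))"
    by (rule sum_prod_word_index[OF word_index_digit])
  also have "\<dots> = tpow dA n (ptrB dA dB \<rho>) $$ (a,a')"
    using a by (simp add: tpow_def ptrB_def digit_less)
  finally show "ptrB (dA ^ n) (dB ^ n) (rho_pow dA dB n \<rho>) $$ (a,a') = tpow dA n (ptrB dA dB \<rho>) $$ (a,a')" .
qed (auto simp: ptrB_def tpow_def)

lemma ptrA_rho_pow:
  "ptrA (dA ^ n) (dB ^ n) (rho_pow dA dB n \<rho>) = tpow dB n (ptrA dA dB \<rho>)"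
proof (rule eq_matI)
  fix b b' assume "b < dim_row (tpow dB n (ptrA dA dB \<rho>))" "b' < dim_col (tpow dB n (ptrA dA dB \<rho>))"
  then have b: "b < dB ^ n" "b' < dB ^ n" by (auto simp: tpow_def)
  have "ptrA (dA ^ n) (dB ^ n) (rho_pow dA dB n \<rho>) $$ (b,b')
      = (\<Sum>a<dA ^ n. \<Prod>k<n. \<rho> $$ (digit dA k a * dB + digit dB k b, digit dA k a * dB + digit dB k b'))"
    using b by (simp add: ptrA_def rho_pow_def mult_add_less mult_add_div_mod)
  also have "\<dots> = (\<Prod>k<n. \<Sum>a<dA. \<rho> $$ (a * dB + digit dB k b, a * dB + digit dB k b'))"
    by (rule sum_prod_word_index[OF word_index_digit])
  also have "\<dots> = tpow dB n (ptrA dA dB \<rho>) $$ (b,b')"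
    using b by (simp add: tpow_def ptrA_def digit_less)
  finally show "ptrA (dA ^ n) (dB ^ n) (rho_pow dA dB n \<rho>) $$ (b,b') = tpow dB n (ptrA dA dB \<rho>) $$ (b,b')" .
qed (auto simp: ptrA_def tpow_def)

text \<open>In an eigenbasis of the reduced operator, \<open>ptrB_marginal\<close> writes each
  eigenvalue as a sum of diagonal entries of a conjugate of \<open>R\<close>, which are
  nonnegative.\<close>

lemma psd_ptrB:
  assumes R: "psd (dA * dB) R" shows "psd dA (ptrB dA dB R)"
proof -
  have Rc: "R \<in> carrier_mat (dA * dB) (dA * dB)" using R by (rule psd_carrier)
  let ?P = "ptrB dA dB R"
  have c: "?P \<in> carrier_mat dA dA" by (simp add: ptrB_def)
  have h: "cadj ?P = ?P"
    by (rule eq_matI) (auto simp: ptrB_def psd_entry_cnj[OF R] mult_add_less intro!: sum.cong)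
  obtain U f where U: "unitary dA U" "?P = U * rdiag dA f * cadj U"
    using spectral_hermitian[OF c h] .
  have D: "rdiag dA f = cadj U * ?P * U" using conj_move[OF U(1) c cdiag_carrier] U(2) by blast
  have one: "unitary dB (1\<^sub>m dB)" by (simp add: unitary_def)
  have p: "psd (dA * dB) (cadj (kron U (1\<^sub>m dB)) * R * kron U (1\<^sub>m dB))"
    using unitary_carrier[OF U(1)] by (intro psd_congruence[OF R]) auto
  have "0 \<le> f k" if k: "k < dA" for k
  proof -
    have "complex_of_real (f k) = (cadj U * ?P * U) $$ (k,k)" unfolding D[symmetric] using k by simp
    also have "\<dots> = (\<Sum>l<dB. (cadj (kron U (1\<^sub>m dB)) * R * kron U (1\<^sub>m dB)) $$ (k * dB + l, k * dB + l))"
      by (rule ptrB_marginal[OF Rc unitary_carrier[OF U(1)] one k, symmetric])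
    finally have "f k = (\<Sum>l<dB. Re ((cadj (kron U (1\<^sub>m dB)) * R * kron U (1\<^sub>m dB)) $$ (k * dB + l, k * dB + l)))"
      by (metis Re_complex_of_real Re_sum)
    then show ?thesis using k by (auto intro!: sum_nonneg psd_diag(1)[OF p] mult_add_less)
  qed
  then show ?thesis unfolding U(2) by (intro psd_conj_rdiag unitary_carrier[OF U(1)])
qed

lemma psd_ptrA:
  assumes R: "psd (dA * dB) R" shows "psd dB (ptrA dA dB R)"
proof -
  have Rc: "R \<in> carrier_mat (dA * dB) (dA * dB)" using R by (rule psd_carrier)
  let ?P = "ptrA dA dB R"
  have c: "?P \<in> carrier_mat dB dB" by (simp add: ptrA_def)
  have h: "cadj ?P = ?P"
    by (rule eq_matI) (auto simp: ptrA_def psd_entry_cnj[OF R] mult_add_less intro!: sum.cong)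
  obtain V f where V: "unitary dB V" "?P = V * rdiag dB f * cadj V"
    using spectral_hermitian[OF c h] .
  have D: "rdiag dB f = cadj V * ?P * V" using conj_move[OF V(1) c cdiag_carrier] V(2) by blast
  have one: "unitary dA (1\<^sub>m dA)" by (simp add: unitary_def)
  have p: "psd (dA * dB) (cadj (kron (1\<^sub>m dA) V) * R * kron (1\<^sub>m dA) V)"
    using unitary_carrier[OF V(1)] by (intro psd_congruence[OF R]) auto
  have "0 \<le> f l" if l: "l < dB" for l
  proof -
    have "complex_of_real (f l) = (cadj V * ?P * V) $$ (l,l)" unfolding D[symmetric] using l by simp
    also have "\<dots> = (\<Sum>k<dA. (cadj (kron (1\<^sub>m dA) V) * R * kron (1\<^sub>m dA) V) $$ (k * dB + l, k * dB + l))"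
      by (rule ptrA_marginal[OF Rc one unitary_carrier[OF V(1)] l, symmetric])
    finally have "f l = (\<Sum>k<dA. Re ((cadj (kron (1\<^sub>m dA) V) * R * kron (1\<^sub>m dA) V) $$ (k * dB + l, k * dB + l)))"
      by (metis Re_complex_of_real Re_sum)
    then show ?thesis using l by (auto intro!: sum_nonneg psd_diag(1)[OF p] mult_add_less)
  qed
  then show ?thesis unfolding V(2) by (intro psd_conj_rdiag unitary_carrier[OF V(1)])
qed

lemma mtrace_ptr:
  assumes "R \<in> carrier_mat (dA * dB) (dA * dB)"
  shows "mtrace (ptrB dA dB R) = mtrace R" "mtrace (ptrA dA dB R) = mtrace R"
  using assms sum.swap[of "\<lambda>a b. R $$ (a * dB + b, a * dB + b)" "{..<dB}" "{..<dA}"]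
  by (simp_all add: mtrace_eq[of _ dA dA] mtrace_eq[of _ dB dB] mtrace_eq[OF assms] ptrB_def ptrA_def sum_div_mod)

lemma density_ptr:
  assumes "density (dA * dB) R"
  shows "density dA (ptrB dA dB R)" "density dB (ptrA dA dB R)"
  using assms by (auto simp: density_def psd_ptrB psd_ptrA mtrace_ptr psd_carrier)

subsection \<open>A universal permutation-invariant operator\<close>

text \<open>\<open>perm_op\<close> maps the basis vector \<open>j\<close> to this one, so
  conjugation by it only relabels matrix entries.\<close>

definition perm_idx :: "nat \<Rightarrow> nat \<Rightarrow> (nat \<Rightarrow> nat) \<Rightarrow> nat \<Rightarrow> nat" where
  "perm_idx d n \<pi> j = (\<Sum>k<n. digit d (\<pi> k) j * d ^ k)"

lemma perm_idx:
  assumes "\<pi> permutes {..<n}" "j < d ^ n"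
  shows "perm_idx d n \<pi> j < d ^ n" "\<And>k. k < n \<Longrightarrow> digit d k (perm_idx d n \<pi> j) = digit d (\<pi> k) j"
proof -
  have "digit d (\<pi> k) j < d" if "k < n" for k
    using assms permutes_in_image[OF assms(1), of k] that by (auto intro: digit_less)
  then show "perm_idx d n \<pi> j < d ^ n" "\<And>k. k < n \<Longrightarrow> digit d k (perm_idx d n \<pi> j) = digit d (\<pi> k) j"
    unfolding perm_idx_def using ex_digits[of n "\<lambda>k. digit d (\<pi> k) j" d] by auto
qed

lemma perm_idx_inj:
  assumes p: "\<pi> permutes {..<n}" and ij: "i < d ^ n" "j < d ^ n" and e: "perm_idx d n \<pi> i = perm_idx d n \<pi> j"
  shows "i = j"
proof (rule digits_eqI[OF ij])
  fix k assume "k < n"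
  then obtain k' where "k' < n" "k = \<pi> k'" using permutes_image[OF p] by (metis imageE lessThan_iff)
  then show "digit d k i = digit d k j" using perm_idx(2)[OF p ij(1)] perm_idx(2)[OF p ij(2)] e by metis
qed

lemma perm_idx_surj:
  assumes p: "\<pi> permutes {..<n}" and i: "i < d ^ n"
  obtains j where "j < d ^ n" "i = perm_idx d n \<pi> j"
proof -
  have "inj_on (perm_idx d n \<pi>) {..<d ^ n}" using perm_idx_inj[OF p] by (auto intro!: inj_onI)
  moreover have "perm_idx d n \<pi> ` {..<d ^ n} \<subseteq> {..<d ^ n}" using perm_idx(1)[OF p] by auto
  ultimately have "perm_idx d n \<pi> ` {..<d ^ n} = {..<d ^ n}" by (intro endo_inj_surj) auto
  then show thesis using that i by (metis imageE lessThan_iff)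
qed

lemma perm_op_carrier [simp]: "perm_op d n \<pi> \<in> carrier_mat (d ^ n) (d ^ n)"
  by (simp add: perm_op_def)

lemma perm_op_dim [simp]: "dim_row (perm_op d n \<pi>) = d ^ n" "dim_col (perm_op d n \<pi>) = d ^ n"
  by (simp_all add: perm_op_def)

lemma perm_op_entry: "i < d ^ n \<Longrightarrow> j < d ^ n \<Longrightarrow> perm_op d n \<pi> $$ (i,j) = (if i = perm_idx d n \<pi> j then 1 else 0)"
  by (simp add: perm_op_def perm_idx_def)

lemma unitary_perm_op:
  assumes p: "\<pi> permutes {..<n}" shows "unitary (d ^ n) (perm_op d n \<pi>)"
proof -
  let ?P = "perm_op d n \<pi>" and ?N = "d ^ n"
  have c: "?P \<in> carrier_mat ?N ?N" "cadj ?P \<in> carrier_mat ?N ?N" by auto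
  have 1: "cadj ?P * ?P = 1\<^sub>m ?N"
  proof (rule eq_matI)
    fix i j assume "i < dim_row (1\<^sub>m ?N :: complex mat)" "j < dim_col (1\<^sub>m ?N :: complex mat)"
    then have ij: "i < ?N" "j < ?N" by auto
    have "(cadj ?P * ?P) $$ (i,j) = (\<Sum>k<?N. if k = perm_idx d n \<pi> i then (if i = j then 1 else 0) else 0)"
      unfolding mult_mat_entry[OF c(2,1) ij]
      by (rule sum.cong[OF refl]) (use ij c perm_idx_inj[OF p ij] in \<open>auto simp: perm_op_entry\<close>)
    then show "(cadj ?P * ?P) $$ (i,j) = 1\<^sub>m ?N $$ (i,j)"
      using ij perm_idx(1)[OF p ij(1)] by (simp add: sum.delta)
  qed (use c in auto)
  show ?thesis using c 1 mat_mult_left_right_inverse[OF c(2,1) 1] by (simp add: unitary_def)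
qed

lemma perm_op_conj_entry:
  assumes p: "\<pi> permutes {..<n}" and S: "S \<in> carrier_mat (d ^ n) (d ^ n)" and ij: "i < d ^ n" "j < d ^ n"
  shows "(perm_op d n \<pi> * S * cadj (perm_op d n \<pi>)) $$ (perm_idx d n \<pi> i, perm_idx d n \<pi> j) = S $$ (i,j)"
proof -
  let ?P = "perm_op d n \<pi>" and ?N = "d ^ n"
  note s = perm_idx(1)[OF p ij(1)] perm_idx(1)[OF p ij(2)]
  have "(?P * S * cadj ?P) $$ (perm_idx d n \<pi> i, perm_idx d n \<pi> j)
      = (\<Sum>k<?N. \<Sum>l<?N. if l = j then (if k = i then S $$ (i,j) else 0) else 0)"
    unfolding conj_entry[OF perm_op_carrier S cadj_carrier[OF perm_op_carrier] s]
  proof (rule sum.cong[OF refl], rule sum.cong[OF refl])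
    fix k l assume "k \<in> {..<?N}" "l \<in> {..<?N}"
    then show "?P $$ (perm_idx d n \<pi> i, k) * S $$ (k,l) * cadj ?P $$ (l, perm_idx d n \<pi> j)
        = (if l = j then (if k = i then S $$ (i,j) else 0) else 0)"
      using s ij perm_op_carrier[of d n \<pi>] perm_idx_inj[OF p ij(1), of k] perm_idx_inj[OF p ij(2), of l]
      by (auto simp: perm_op_entry)
  qed
  then show ?thesis using ij by (simp add: sum.delta)
qed

lemma perm_invariant_iff:
  assumes p: "\<pi> permutes {..<n}" and S: "S \<in> carrier_mat (d ^ n) (d ^ n)"
  shows "perm_op d n \<pi> * S * cadj (perm_op d n \<pi>) = S \<longleftrightarrow>
    (\<forall>i<d ^ n. \<forall>j<d ^ n. S $$ (perm_idx d n \<pi> i, perm_idx d n \<pi> j) = S $$ (i,j))"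
proof
  assume "perm_op d n \<pi> * S * cadj (perm_op d n \<pi>) = S"
  then show "\<forall>i<d ^ n. \<forall>j<d ^ n. S $$ (perm_idx d n \<pi> i, perm_idx d n \<pi> j) = S $$ (i,j)"
    using perm_op_conj_entry[OF p S] by metis
next
  assume e: "\<forall>i<d ^ n. \<forall>j<d ^ n. S $$ (perm_idx d n \<pi> i, perm_idx d n \<pi> j) = S $$ (i,j)"
  show "perm_op d n \<pi> * S * cadj (perm_op d n \<pi>) = S"
  proof (rule eq_matI)
    fix i j assume "i < dim_row S" "j < dim_col S"
    then have ij: "i < d ^ n" "j < d ^ n" using S by auto
    obtain i' where i': "i' < d ^ n" "i = perm_idx d n \<pi> i'" using perm_idx_surj[OF p ij(1)] .
    obtain j' where j': "j' < d ^ n" "j = perm_idx d n \<pi> j'" using perm_idx_surj[OF p ij(2)] .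
    show "(perm_op d n \<pi> * S * cadj (perm_op d n \<pi>)) $$ (i,j) = S $$ (i,j)"
      unfolding i'(2) j'(2) perm_op_conj_entry[OF p S i'(1) j'(1)] using e i'(1) j'(1) by simp
  qed (use S in \<open>auto simp: perm_op_def\<close>)
qed

lemma perm_op_tpow:
  assumes p: "\<pi> permutes {..<n}"
  shows "perm_op d n \<pi> * tpow d n X * cadj (perm_op d n \<pi>) = tpow d n X"
proof -
  have c: "tpow d n X \<in> carrier_mat (d ^ n) (d ^ n)" by (simp add: tpow_def)
  have "tpow d n X $$ (perm_idx d n \<pi> i, perm_idx d n \<pi> j) = tpow d n X $$ (i,j)" if ij: "i < d ^ n" "j < d ^ n" for i j
  proof -
    have "tpow d n X $$ (perm_idx d n \<pi> i, perm_idx d n \<pi> j) = (\<Prod>k<n. X $$ (digit d (\<pi> k) i, digit d (\<pi> k) j))"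
      using perm_idx[OF p ij(1)] perm_idx[OF p ij(2)] by (simp add: tpow_def)
    also have "\<dots> = (\<Prod>k<n. X $$ (digit d k i, digit d k j))"
      by (rule prod.reindex_bij_betw[OF permutes_imp_bij[OF p]])
    finally show ?thesis using ij by (simp add: tpow_def)
  qed
  then show ?thesis using perm_invariant_iff[OF p c] by blast
qed

lemma tpow_sym_state:
  assumes s: "density d \<sigma>" shows "tpow d n \<sigma> \<in> sym_states d n"
proof -
  have P: "psd d \<sigma>" and t: "mtrace \<sigma> = 1" using s by (auto simp: density_def)
  obtain U f where U: "unitary d U" "\<sigma> = U * rdiag d f * cadj U" "\<forall>i<d. 0 \<le> f i" using spectral_psd[OF P] by blast
  have "psd (d ^ n) (tpow d n \<sigma>)"
    unfolding tpow_eq U(2) tensor_power_diag[OF word_index_digit unitary_carrier[OF U(1)]]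
    using U(3) by (intro psd_conj_rdiag prod_nonneg) (auto simp: digit_less)
  moreover have "mtrace (tpow d n \<sigma>) = 1"
    unfolding tpow_eq mtrace_tensor_power[OF word_index_digit psd_carrier[OF P]] t by simp
  ultimately show ?thesis by (simp add: sym_states_def density_def perm_op_tpow)
qed

text \<open>Two pairs of basis vectors have the same type iff a permutation of the tensor factors maps
  one pair to the other, so permutation-invariant matrices have entries depending on the type only.\<close>

definition pair_type :: "nat \<Rightarrow> nat \<Rightarrow> nat \<Rightarrow> nat \<Rightarrow> (nat \<times> nat) multiset" where
  "pair_type d n i j = mset (map (\<lambda>k. (digit d k i, digit d k j)) [0..<n])"

definition pair_class :: "nat \<Rightarrow> nat \<Rightarrow> (nat \<times> nat) multiset \<Rightarrow> (nat \<times> nat) set" where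
  "pair_class d n c = {p \<in> {..<d ^ n} \<times> {..<d ^ n}. pair_type d n (fst p) (snd p) = c}"

definition pair_types :: "nat \<Rightarrow> nat \<Rightarrow> (nat \<times> nat) multiset set" where
  "pair_types d n = (\<lambda>p. pair_type d n (fst p) (snd p)) ` ({..<d ^ n} \<times> {..<d ^ n})"

text \<open>Lists with the same multiset differ by a permutation of positions. Because the list
  entries are pairs of digits, a single permutation serves both indices at once.\<close>

lemma pair_type_eq_perm:
  assumes e: "pair_type d n i' j' = pair_type d n i j" and i': "i' < d ^ n" and j': "j' < d ^ n"
  obtains \<pi> where "\<pi> permutes {..<n}" "i' = perm_idx d n \<pi> i" "j' = perm_idx d n \<pi> j"
proof -
  let ?xs = "\<lambda>i j. map (\<lambda>k. (digit d k i, digit d k j)) [0..<n]"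
  from e have "mset (?xs i' j') = mset (?xs i j)" unfolding pair_type_def .
  then obtain \<pi> where p: "\<pi> permutes {..<length (?xs i j)}" "permute_list \<pi> (?xs i j) = ?xs i' j'"
    by (rule mset_eq_permutation)
  have pn: "\<pi> permutes {..<n}" using p(1) by simp
  have "digit d k i' = digit d (\<pi> k) i \<and> digit d k j' = digit d (\<pi> k) j" if k: "k < n" for k
  proof -
    have "\<pi> k < n" using permutes_in_image[OF pn, of k] k by simp
    then show ?thesis using arg_cong[OF p(2), of "\<lambda>l. l ! k"] k by (simp add: permute_list_def)
  qed
  then have "perm_idx d n \<pi> i = (\<Sum>k<n. digit d k i' * d ^ k)" "perm_idx d n \<pi> j = (\<Sum>k<n. digit d k j' * d ^ k)"
    unfolding perm_idx_def by (auto intro: sum.cong)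
  then have "i' = perm_idx d n \<pi> i" "j' = perm_idx d n \<pi> j"
    using i' j' by (simp_all add: sum_digits)
  with pn that show thesis by blast
qed

lemma finite_pair_class [simp]: "finite (pair_class d n c)"
  by (auto simp: pair_class_def)

lemma finite_pair_types [simp]: "finite (pair_types d n)"
  by (simp add: pair_types_def)

lemma card_pair_class_pos:
  assumes "c \<in> pair_types d n" shows "0 < card (pair_class d n c)"
proof -
  obtain p where "p \<in> {..<d ^ n} \<times> {..<d ^ n}" "c = pair_type d n (fst p) (snd p)"
    using assms unfolding pair_types_def by blast
  then have "p \<in> pair_class d n c" by (simp add: pair_class_def)
  then show ?thesis by (auto simp: card_gt_0_iff)
qed

text \<open>A type is a multiset of size \<open>n\<close> over \<open>d * d\<close> pairs of letters
  and is determined by its \<open>d * d\<close> counts, each between 0 and \<open>n\<close>.\<close>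

lemma card_pair_types: "card (pair_types d n) \<le> (n + 1) ^ (d * d)"
proof -
  let ?D = "{..<d} \<times> {..<d}"
  let ?F = "\<lambda>c. restrict (count c) ?D"
  have sub: "set_mset c \<subseteq> ?D" "size c = n" if c: "c \<in> pair_types d n" for c
    using c by (auto simp: pair_types_def pair_type_def digit_less)
  have "inj_on ?F (pair_types d n)"
  proof (rule inj_onI)
    fix c c' assume c: "c \<in> pair_types d n" "c' \<in> pair_types d n" and e: "?F c = ?F c'"
    show "c = c'"
    proof (rule multiset_eqI)
      fix x
      show "count c x = count c' x"
      proof (cases "x \<in> ?D")
        case True
        then show ?thesis using fun_cong[OF e, of x] by simp
      next
        case False
        then have "x \<notin># c" "x \<notin># c'" using sub c by blast+
        then show ?thesis by (simp add: not_in_iff)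
      qed
    qed
  qed
  moreover have "?F ` pair_types d n \<subseteq> ?D \<rightarrow>\<^sub>E {..n}"
  proof
    fix f assume "f \<in> ?F ` pair_types d n"
    then obtain c where c: "c \<in> pair_types d n" "f = ?F c" by blast
    have "count c x \<le> n" for x using sub(2)[OF c(1)] count_le_size[of c x] by simp
    then show "f \<in> ?D \<rightarrow>\<^sub>E {..n}" using c(2) by (simp add: restrict_PiE_iff)
  qed
  ultimately have "card (pair_types d n) \<le> card (?D \<rightarrow>\<^sub>E {..n})"
    by (intro card_inj_on_le[of ?F]) (auto intro: finite_PiE)
  then show ?thesis by (simp add: card_PiE)
qed

text \<open>The sum over types of E times its adjoint, where E is the indicator matrix of a type
  class divided by the square root of the class size. In each summand \<open>j\<close> is the shared
  column index of the two factors.\<close>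

definition univ_op :: "nat \<Rightarrow> nat \<Rightarrow> complex mat" where
  "univ_op d n = mat (d ^ n) (d ^ n) (\<lambda>(i,i'). \<Sum>j<d ^ n.
     if pair_type d n i j = pair_type d n i' j then 1 / of_nat (card (pair_class d n (pair_type d n i j))) else 0)"

lemma univ_op_carrier [simp]: "univ_op d n \<in> carrier_mat (d ^ n) (d ^ n)"
  by (simp add: univ_op_def)

lemma sum_pair_types:
  "(\<Sum>i<d ^ n. \<Sum>j<d ^ n. F i j) = (\<Sum>c\<in>pair_types d n. \<Sum>p\<in>pair_class d n c. F (fst p) (snd p))"
proof -
  have "(\<Sum>i<d ^ n. \<Sum>j<d ^ n. F i j) = (\<Sum>p\<in>{..<d ^ n} \<times> {..<d ^ n}. F (fst p) (snd p))"
    by (simp add: sum.cartesian_product case_prod_unfold)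
  also have "\<dots> = (\<Sum>c\<in>pair_types d n. \<Sum>p\<in>pair_class d n c. F (fst p) (snd p))"
    unfolding pair_types_def pair_class_def by (rule sum.image_gen) simp
  finally show ?thesis .
qed

text \<open>Each normalised indicator has Hilbert-Schmidt norm 1, so the trace counts the
  types.\<close>

lemma mtrace_univ_op: "mtrace (univ_op d n) = of_nat (card (pair_types d n))"
proof -
  have "mtrace (univ_op d n) = (\<Sum>i<d ^ n. \<Sum>j<d ^ n. 1 / of_nat (card (pair_class d n (pair_type d n i j))))"
    unfolding mtrace_eq[OF univ_op_carrier] by (rule sum.cong[OF refl]) (simp add: univ_op_def)
  also have "\<dots> = (\<Sum>c\<in>pair_types d n. \<Sum>p\<in>pair_class d n c. 1 / of_nat (card (pair_class d n c)))"
    unfolding sum_pair_types by (intro sum.cong refl) (auto simp: pair_class_def)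
  also have "\<dots> = (\<Sum>c\<in>pair_types d n. 1)"
  proof (rule sum.cong[OF refl])
    fix c assume "c \<in> pair_types d n"
    then have "card (pair_class d n c) \<noteq> 0" using card_pair_class_pos by fastforce
    then show "(\<Sum>p\<in>pair_class d n c. 1 / of_nat (card (pair_class d n c))) = (1 :: complex)" by simp
  qed
  finally show ?thesis by simp
qed

lemma pair_type_mem: "i < d ^ n \<Longrightarrow> j < d ^ n \<Longrightarrow> pair_type d n i j \<in> pair_types d n"
  by (force simp: pair_types_def)

text \<open>The \<open>j\<close>-th coordinate of the transposed indicator matrix of type
  \<open>c\<close> applied to \<open>v\<close>.\<close>

definition type_sum :: "nat \<Rightarrow> nat \<Rightarrow> complex vec \<Rightarrow> (nat \<times> nat) multiset \<Rightarrow> nat \<Rightarrow> complex" where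
  "type_sum d n v c j = (\<Sum>i<d ^ n. if pair_type d n i j = c then v $ i else 0)"

text \<open>The form is the sum of the squared norms of \<open>v\<close> under the adjoints of the
  normalised indicators, written out in coordinates.\<close>

lemma qform_univ_op:
  assumes v: "v \<in> carrier_vec (d ^ n)"
  shows "qform (d ^ n) (univ_op d n) v =
    complex_of_real (\<Sum>j<d ^ n. \<Sum>c\<in>pair_types d n. (cmod (type_sum d n v c j))\<^sup>2 / real (card (pair_class d n c)))"
proof -
  let ?N = "d ^ n" and ?ty = "pair_type d n" and ?k = "\<lambda>c. of_nat (card (pair_class d n c)) :: complex"
  have "qform ?N (univ_op d n) v = (\<Sum>i<?N. \<Sum>i'<?N. \<Sum>j<?N. \<Sum>c\<in>pair_types d n.
      (if ?ty i j = c then cnj (v $ i) else 0) * (if ?ty i' j = c then v $ i' else 0) / ?k c)"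
    unfolding qform_eq[OF univ_op_carrier v]
  proof (rule sum.cong[OF refl], rule sum.cong[OF refl])
    fix i i' assume "i \<in> {..<?N}" "i' \<in> {..<?N}"
    then have i: "i < ?N" "i' < ?N" by auto
    have "cnj (v $ i) * univ_op d n $$ (i,i') * v $ i' =
        (\<Sum>j<?N. if ?ty i j = ?ty i' j then cnj (v $ i) * v $ i' / ?k (?ty i j) else 0)"
      using i by (simp add: univ_op_def sum_distrib_left sum_distrib_right if_distrib[of "\<lambda>x. _ * x"] if_distrib[of "\<lambda>x. x * _"] cong: if_cong)
    also have "\<dots> = (\<Sum>j<?N. \<Sum>c\<in>pair_types d n.
        (if ?ty i j = c then cnj (v $ i) else 0) * (if ?ty i' j = c then v $ i' else 0) / ?k c)"
    proof (rule sum.cong[OF refl])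
      fix j assume "j \<in> {..<?N}"
      then have m: "?ty i j \<in> pair_types d n" using i by (simp add: pair_type_mem)
      have "(\<Sum>c\<in>pair_types d n. (if ?ty i j = c then cnj (v $ i) else 0) * (if ?ty i' j = c then v $ i' else 0) / ?k c)
          = (\<Sum>c\<in>pair_types d n. if c = ?ty i j then (if ?ty i j = ?ty i' j then cnj (v $ i) * v $ i' / ?k (?ty i j) else 0) else 0)"
        by (rule sum.cong[OF refl]) auto
      then show "(if ?ty i j = ?ty i' j then cnj (v $ i) * v $ i' / ?k (?ty i j) else 0) =
          (\<Sum>c\<in>pair_types d n. (if ?ty i j = c then cnj (v $ i) else 0) * (if ?ty i' j = c then v $ i' else 0) / ?k c)"
        using m by (simp add: sum.delta)
    qed
    finally show "cnj (v $ i) * univ_op d n $$ (i,i') * v $ i' = (\<Sum>j<?N. \<Sum>c\<in>pair_types d n.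
        (if ?ty i j = c then cnj (v $ i) else 0) * (if ?ty i' j = c then v $ i' else 0) / ?k c)" .
  qed
  also have "\<dots> = (\<Sum>j<?N. \<Sum>c\<in>pair_types d n. \<Sum>i<?N. \<Sum>i'<?N.
      (if ?ty i j = c then cnj (v $ i) else 0) * (if ?ty i' j = c then v $ i' else 0) / ?k c)"
  proof -
    let ?f = "\<lambda>i i' j c. (if ?ty i j = c then cnj (v $ i) else 0) * (if ?ty i' j = c then v $ i' else 0) / ?k c"
    have "(\<Sum>i<?N. \<Sum>i'<?N. \<Sum>j<?N. \<Sum>c\<in>pair_types d n. ?f i i' j c) = (\<Sum>i<?N. \<Sum>j<?N. \<Sum>c\<in>pair_types d n. \<Sum>i'<?N. ?f i i' j c)"
      by (rule sum.cong[OF refl], rule trans[OF sum.swap], rule sum.cong[OF refl], rule sum.swap)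
    also have "\<dots> = (\<Sum>j<?N. \<Sum>c\<in>pair_types d n. \<Sum>i<?N. \<Sum>i'<?N. ?f i i' j c)"
      by (rule trans[OF sum.swap], rule sum.cong[OF refl], rule sum.swap)
    finally show ?thesis .
  qed
  also have "\<dots> = (\<Sum>j<?N. \<Sum>c\<in>pair_types d n. cnj (type_sum d n v c j) * type_sum d n v c j / ?k c)"
  proof (rule sum.cong[OF refl], rule sum.cong[OF refl])
    fix j c
    have "cnj (type_sum d n v c j) = (\<Sum>i<?N. if ?ty i j = c then cnj (v $ i) else 0)"
      unfolding type_sum_def cnj_sum by (rule sum.cong[OF refl]) simp
    then show "(\<Sum>i<?N. \<Sum>i'<?N. (if ?ty i j = c then cnj (v $ i) else 0) * (if ?ty i' j = c then v $ i' else 0) / ?k c)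
        = cnj (type_sum d n v c j) * type_sum d n v c j / ?k c"
      by (simp only: type_sum_def sum_product sum_divide_distrib)
  qed
  also have "\<dots> = complex_of_real (\<Sum>j<?N. \<Sum>c\<in>pair_types d n. (cmod (type_sum d n v c j))\<^sup>2 / real (card (pair_class d n c)))"
    by (simp only: of_real_sum of_real_divide complex_norm_square of_real_of_nat_eq mult.commute)
  finally show ?thesis .
qed

lemma psd_univ_op: "psd (d ^ n) (univ_op d n)"
proof -
  have "cadj (univ_op d n) = univ_op d n"
    by (rule eq_matI) (auto simp: univ_op_def intro!: sum.cong)
  then show ?thesis by (auto simp: psd_alt qform_univ_op intro!: sum_nonneg)
qed

text \<open>\<open>\<surd>\<sigma>\<close> is permutation-invariant too, so its entries depend on the type only; \<open>univ_op\<close> is the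
  sum of \<open>E E\<^sup>*\<close> over the orthonormal basis of normalised type indicators \<open>E\<close>, and the bound
  \<open>\<sigma> \<le> univ_op\<close> is the Cauchy--Schwarz inequality for the expansion of \<open>\<surd>\<sigma>\<close> in that basis.\<close>

lemma sym_state_le_univ_op:
  assumes s: "\<sigma> \<in> sym_states d n"
  shows "psd (d ^ n) (univ_op d n - \<sigma>)"
proof -
  let ?N = "d ^ n" and ?ty = "pair_type d n"
  have P: "psd ?N \<sigma>" and t: "mtrace \<sigma> = 1" and inv: "\<And>\<pi>. \<pi> permutes {..<n} \<Longrightarrow> perm_op d n \<pi> * \<sigma> * cadj (perm_op d n \<pi>) = \<sigma>"
    using s by (auto simp: sym_states_def density_def)
  obtain U f where U: "unitary ?N U" "\<sigma> = U * rdiag ?N f * cadj U" "\<forall>i<?N. 0 \<le> f i" using spectral_psd[OF P] by blast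
  have Uc: "U \<in> carrier_mat ?N ?N" using U(1) by (rule unitary_carrier)
  define S where "S = U * rdiag ?N (\<lambda>i. sqrt (f i)) * cadj U"
  have Sc: "S \<in> carrier_mat ?N ?N" unfolding S_def using Uc by auto
  have Sh: "cadj S = S" unfolding S_def cadj_conj[OF Uc cdiag_carrier] by (simp add: cadj_cdiag)
  have SS: "\<sigma> = S * S"
  proof -
    have "rdiag ?N (\<lambda>i. sqrt (f i)) * rdiag ?N (\<lambda>i. sqrt (f i)) = rdiag ?N f"
      unfolding cdiag_mult_cdiag by (rule eq_matI) (use U(3) in \<open>auto simp: of_real_mult[symmetric] simp del: of_real_mult\<close>)
    then show ?thesis unfolding S_def conj_mult_conj[OF U(1) cdiag_carrier cdiag_carrier] U(2) by simp
  qed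
  have Sf: "S = mat_fun sqrt \<sigma>" unfolding S_def by (rule mat_fun_diag[OF U(1,2), symmetric])
  \<comment> \<open>Invariance of \<sigma> under \<open>?P\<close> means that \<open>?P * U\<close>
    is an eigenbasis with the same eigenvalues. As the functional calculus does not depend on the
    eigenbasis, the square root is invariant too.\<close>
  have Sinv: "S $$ (perm_idx d n \<pi> i, perm_idx d n \<pi> j) = S $$ (i,j)"
    if p: "\<pi> permutes {..<n}" and ij: "i < ?N" "j < ?N" for \<pi> i j
  proof -
    let ?P = "perm_op d n \<pi>"
    have PU: "unitary ?N (?P * U)" by (rule unitary_mult[OF unitary_perm_op[OF p] U(1)])
    have conj: "?P * (U * D * cadj U) * cadj ?P = (?P * U) * D * cadj (?P * U)" if "D \<in> carrier_mat ?N ?N" for D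
      using that Uc cadj_carrier[OF Uc] cadj_carrier[OF perm_op_carrier[of d n \<pi>]]
      by (simp add: cadj_mult[OF perm_op_carrier Uc] assoc_mult_mat[of _ ?N ?N _ ?N _ ?N] mult_carrier_mat[of _ ?N ?N _ ?N])
    have "\<sigma> = (?P * U) * rdiag ?N f * cadj (?P * U)"
      using inv[OF p] conj[OF cdiag_carrier] U(2) by metis
    then have "mat_fun sqrt \<sigma> = (?P * U) * rdiag ?N (\<lambda>i. sqrt (f i)) * cadj (?P * U)"
      by (rule mat_fun_diag[OF PU])
    then have "?P * S * cadj ?P = S"
      unfolding Sf[symmetric] conj[OF cdiag_carrier, symmetric] S_def[symmetric] by simp
    then show ?thesis using perm_invariant_iff[OF p Sc] ij by blast
  qed
  \<comment> \<open>The witness reads \<open>S\<close> at an arbitrarily chosen pair of the given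
    type; invariance makes the choice irrelevant.\<close>
  have "\<exists>h. \<forall>i<?N. \<forall>j<?N. S $$ (i,j) = h (?ty i j)"
  proof (intro exI allI impI)
    fix i j assume ij: "i < ?N" "j < ?N"
    let ?Q = "\<lambda>p. p \<in> {..<?N} \<times> {..<?N} \<and> ?ty (fst p) (snd p) = ?ty i j"
    have Q: "?Q (SOME p. ?Q p)" by (rule someI[of ?Q "(i,j)"]) (use ij in simp)
    obtain i' j' where q1: "(SOME p. ?Q p) = (i',j')" by (rule prod.exhaust)
    have q: "?ty i' j' = ?ty i j" "i' < ?N" "j' < ?N" using Q unfolding q1 by simp_all
    obtain \<pi> where "\<pi> permutes {..<n}" "i' = perm_idx d n \<pi> i" "j' = perm_idx d n \<pi> j"
      by (rule pair_type_eq_perm[OF q])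
    then have "S $$ (i',j') = S $$ (i,j)" using Sinv ij by simp
    then show "S $$ (i,j) = (\<lambda>c. S $$ (SOME p. p \<in> {..<?N} \<times> {..<?N} \<and> ?ty (fst p) (snd p) = c)) (?ty i j)"
      by (simp add: q1)
  qed
  then obtain h where h: "\<And>i j. i < ?N \<Longrightarrow> j < ?N \<Longrightarrow> S $$ (i,j) = h (?ty i j)" by blast
  define K where "K c = real (card (pair_class d n c))" for c
  have K: "0 < K c" if "c \<in> pair_types d n" for c
    using card_pair_class_pos[OF that] by (simp add: K_def)
  \<comment> \<open>The squared Hilbert-Schmidt norm of \<open>S\<close> is the trace of \<sigma>,
    grouped here by type.\<close>
  have norm1: "(\<Sum>c\<in>pair_types d n. K c * (cmod (h c))\<^sup>2) = 1"
  proof -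
    have "complex_of_real (\<Sum>i<?N. \<Sum>j<?N. (cmod (S $$ (i,j)))\<^sup>2) = mtrace (S * cadj S)"
      unfolding mtrace_mult[OF Sc cadj_carrier[OF Sc]]
      by (simp only: of_real_sum complex_norm_square) (intro sum.cong refl, use Sc in auto)
    then have "(\<Sum>i<?N. \<Sum>j<?N. (cmod (S $$ (i,j)))\<^sup>2) = 1"
      unfolding Sh SS[symmetric] t by (metis of_real_eq_1_iff)
    also have "(\<Sum>i<?N. \<Sum>j<?N. (cmod (S $$ (i,j)))\<^sup>2) = (\<Sum>c\<in>pair_types d n. \<Sum>p\<in>pair_class d n c. (cmod (h c))\<^sup>2)"
      unfolding sum_pair_types by (intro sum.cong refl) (auto simp: pair_class_def h)
    finally show ?thesis by (simp add: K_def)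
  qed
  have bound: "Re (qform ?N \<sigma> v) \<le> Re (qform ?N (univ_op d n) v)" if v: "v \<in> carrier_vec ?N" for v
  proof -
    have Sv: "(cmod ((S *\<^sub>v v) $ j))\<^sup>2 \<le> (\<Sum>c\<in>pair_types d n. (cmod (type_sum d n v c j))\<^sup>2 / K c)" if j: "j < ?N" for j
    proof -
      have "(S *\<^sub>v v) $ j = (\<Sum>i<?N. cnj (h (?ty i j)) * v $ i)"
        unfolding mult_mat_vec_entry[OF Sc v j]
      proof (rule sum.cong[OF refl])
        fix i assume "i \<in> {..<?N}"
        then have i: "i < ?N" by simp
        have "S $$ (j,i) = cadj S $$ (j,i)" by (simp add: Sh)
        also have "\<dots> = cnj (S $$ (i,j))" using i j Sc by simp
        finally show "S $$ (j,i) * v $ i = cnj (h (?ty i j)) * v $ i" using h[OF i j] by simp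
      qed
      also have "\<dots> = (\<Sum>i<?N. \<Sum>c\<in>pair_types d n. cnj (h c) * (if ?ty i j = c then v $ i else 0))"
      proof (rule sum.cong[OF refl])
        fix i assume "i \<in> {..<?N}"
        then have m: "?ty i j \<in> pair_types d n" using j by (simp add: pair_type_mem)
        have "(\<Sum>c\<in>pair_types d n. cnj (h c) * (if ?ty i j = c then v $ i else 0))
            = (\<Sum>c\<in>pair_types d n. if c = ?ty i j then cnj (h (?ty i j)) * v $ i else 0)"
          by (rule sum.cong[OF refl]) auto
        then show "cnj (h (?ty i j)) * v $ i = (\<Sum>c\<in>pair_types d n. cnj (h c) * (if ?ty i j = c then v $ i else 0))"
          using m by (simp add: sum.delta)
      qed
      also have "\<dots> = (\<Sum>c\<in>pair_types d n. cnj (h c) * type_sum d n v c j)"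
        by (subst sum.swap) (simp add: type_sum_def sum_distrib_left)
      finally have "cmod ((S *\<^sub>v v) $ j) \<le> (\<Sum>c\<in>pair_types d n. cmod (cnj (h c) * type_sum d n v c j))"
        using norm_sum by metis
      \<comment> \<open>The class size is divided between the factors so that the first has total
        square 1 by \<open>norm1\<close>, and the second produces the terms of
        \<open>qform_univ_op\<close>.\<close>
      also have "\<dots> = (\<Sum>c\<in>pair_types d n. (sqrt (K c) * cmod (h c)) * (cmod (type_sum d n v c j) / sqrt (K c)))"
      proof (rule sum.cong[OF refl])
        fix c assume "c \<in> pair_types d n"
        from K[OF this] show "cmod (cnj (h c) * type_sum d n v c j) = (sqrt (K c) * cmod (h c)) * (cmod (type_sum d n v c j) / sqrt (K c))"
          by (simp add: norm_mult)
      qed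
      finally have "(cmod ((S *\<^sub>v v) $ j))\<^sup>2 \<le> (\<Sum>c\<in>pair_types d n. (sqrt (K c) * cmod (h c)) * (cmod (type_sum d n v c j) / sqrt (K c)))\<^sup>2"
        by (intro power_mono) auto
      also have "\<dots> \<le> (\<Sum>c\<in>pair_types d n. (sqrt (K c) * cmod (h c))\<^sup>2) * (\<Sum>c\<in>pair_types d n. (cmod (type_sum d n v c j) / sqrt (K c))\<^sup>2)"
        by (rule Cauchy_Schwarz_ineq_sum)
      also have "(\<Sum>c\<in>pair_types d n. (sqrt (K c) * cmod (h c))\<^sup>2) = 1"
        unfolding norm1[symmetric] by (rule sum.cong[OF refl]) (use K in \<open>auto simp: power_mult_distrib less_imp_le\<close>)
      also have "(\<Sum>c\<in>pair_types d n. (cmod (type_sum d n v c j) / sqrt (K c))\<^sup>2) = (\<Sum>c\<in>pair_types d n. (cmod (type_sum d n v c j))\<^sup>2 / K c)"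
        by (rule sum.cong[OF refl]) (use K in \<open>auto simp: power_divide less_imp_le\<close>)
      finally show ?thesis by simp
    qed
    have "\<sigma> = cadj S * 1\<^sub>m ?N * S" using SS Sc Sh by simp
    then have "qform ?N \<sigma> v = qform ?N (1\<^sub>m ?N) (S *\<^sub>v v)"
      using qform_congruence[OF one_carrier_mat Sc v] by simp
    also have "\<dots> = (\<Sum>j<?N. complex_of_real ((cmod ((S *\<^sub>v v) $ j))\<^sup>2))"
      unfolding qform_def using mult_mat_vec_carrier[OF Sc v]
      by (intro sum.cong refl) (simp only: complex_norm_square one_mult_mat_vec mult.commute)
    finally have "Re (qform ?N \<sigma> v) = (\<Sum>j<?N. (cmod ((S *\<^sub>v v) $ j))\<^sup>2)"
      by (simp only: of_real_sum[symmetric] Re_complex_of_real)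
    also have "\<dots> \<le> (\<Sum>j<?N. \<Sum>c\<in>pair_types d n. (cmod (type_sum d n v c j))\<^sup>2 / K c)"
      by (rule sum_mono) (simp add: Sv)
    also have "\<dots> = Re (qform ?N (univ_op d n) v)"
      unfolding qform_univ_op[OF v] K_def by (simp only: Re_complex_of_real)
    finally show ?thesis .
  qed
  show ?thesis by (rule psd_diff[OF P psd_univ_op bound])
qed

text \<open>If \<open>(i,j)\<close> and \<open>(i',j)\<close> have the same type, the words of
  \<open>i\<close> and \<open>i'\<close> are rearrangements of each other, and products of letter
  weights agree on them. The vanishing entries make \<open>univ_op\<close> commute with diagonal
  tensor powers.\<close>

lemma univ_op_zero:
  fixes f :: "nat \<Rightarrow> real"
  assumes i: "i < d ^ n" "i' < d ^ n" and ne: "(\<Prod>k<n. f (digit d k i)) \<noteq> (\<Prod>k<n. f (digit d k i'))"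
  shows "univ_op d n $$ (i,i') = 0"
proof -
  have "pair_type d n i j \<noteq> pair_type d n i' j" for j
  proof
    assume e: "pair_type d n i j = pair_type d n i' j"
    have pr: "prod_mset (image_mset (f \<circ> fst) (pair_type d n i j)) = (\<Prod>k<n. f (digit d k i))" for i
    proof -
      have "prod_mset (image_mset (f \<circ> fst) (pair_type d n i j)) = prod_list (map (\<lambda>k. f (digit d k i)) [0..<n])"
        by (simp add: pair_type_def prod_mset_prod_list[symmetric] o_def mset_map[symmetric] del: mset_map)
      also have "\<dots> = (\<Prod>k<n. f (digit d k i))"
        by (simp add: prod.distinct_set_conv_list[symmetric] atLeast0LessThan)
      finally show ?thesis .
    qed
    show False using ne pr[of i] pr[of i'] e by simp
  qed
  then show ?thesis using i by (simp add: univ_op_def)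
qed

text \<open>For commuting Hermitian \<open>A\<close> and \<open>B\<close> the matrix
  \<open>A + i B\<close> is normal. The real and imaginary parts of its eigenvalues are the
  eigenvalues of \<open>A\<close> and \<open>B\<close> in the same basis.\<close>

lemma simultaneous_diag:
  assumes A: "A \<in> carrier_mat N N" "cadj A = A" and B: "B \<in> carrier_mat N N" "cadj B = B" and AB: "A * B = B * A"
  shows "\<exists>Z a b. unitary N Z \<and> A = Z * rdiag N a * cadj Z \<and> B = Z * rdiag N b * cadj Z"
proof -
  define M where "M = A + \<i> \<cdot>\<^sub>m B"
  have Mc: "M \<in> carrier_mat N N" using A B by (simp add: M_def)
  have Ma: "cadj M = A + (- \<i>) \<cdot>\<^sub>m B"
    unfolding M_def using A B by (simp add: cadj_add[of A N N "\<i> \<cdot>\<^sub>m B"] cadj_smult)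
  have "M * cadj M = cadj M * M"
  proof (rule eq_matI)
    fix i j assume "i < dim_row (cadj M * M)" "j < dim_col (cadj M * M)"
    then have ij: "i < N" "j < N" using Mc by auto
    have e: "(A * B) $$ (i,j) = (B * A) $$ (i,j)" by (simp add: AB)
    have cs: "A + (- \<i>) \<cdot>\<^sub>m B \<in> carrier_mat N N" using A B by simp
    show "(M * cadj M) $$ (i,j) = (cadj M * M) $$ (i,j)"
      unfolding Ma mult_mat_entry[OF Mc cs ij] mult_mat_entry[OF cs Mc ij]
      using e[unfolded mult_mat_entry[OF A(1) B(1) ij] mult_mat_entry[OF B(1) A(1) ij]] ij A(1) B(1)
      by (simp add: M_def algebra_simps sum.distrib sum_subtractf sum_distrib_left[symmetric] sum_negf)
  qed (use Mc in auto)
  then obtain Z f where Z: "unitary N Z" "M = Z * cdiag N f * cadj Z" using spectral_normal[OF Mc] by blast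
  have Zc: "Z \<in> carrier_mat N N" using Z(1) by (rule unitary_carrier)
  have Ma': "cadj M = Z * cdiag N (\<lambda>i. cnj (f i)) * cadj Z"
    unfolding Z(2) cadj_conj[OF Zc cdiag_carrier] cadj_cdiag ..
  have ent: "M $$ (i,j) = (\<Sum>k<N. Z $$ (i,k) * f k * cadj Z $$ (k,j))"
    "cadj M $$ (i,j) = (\<Sum>k<N. Z $$ (i,k) * cnj (f k) * cadj Z $$ (k,j))" if "i < N" "j < N" for i j
    using conj_cdiag_entry[OF Zc cadj_carrier[OF Zc] that, of f] conj_cdiag_entry[OF Zc cadj_carrier[OF Zc] that, of "\<lambda>i. cnj (f i)"]
    by (simp_all add: Z(2)[symmetric] Ma'[symmetric])
  have "A = Z * rdiag N (\<lambda>i. Re (f i)) * cadj Z"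
  proof (rule eq_matI)
    fix i j assume "i < dim_row (Z * rdiag N (\<lambda>i. Re (f i)) * cadj Z)" "j < dim_col (Z * rdiag N (\<lambda>i. Re (f i)) * cadj Z)"
    then have ij: "i < N" "j < N" using Zc by auto
    have "A $$ (i,j) = (M $$ (i,j) + cadj M $$ (i,j)) / 2"
      using ij A B by (simp add: M_def Ma[unfolded M_def])
    also have "\<dots> = (\<Sum>k<N. Z $$ (i,k) * complex_of_real (Re (f k)) * cadj Z $$ (k,j))"
      unfolding ent[OF ij] sum.distrib[symmetric] sum_divide_distrib
      by (rule sum.cong[OF refl]) (simp add: distrib_left[symmetric] distrib_right[symmetric] complex_add_cnj)
    finally show "A $$ (i,j) = (Z * rdiag N (\<lambda>i. Re (f i)) * cadj Z) $$ (i,j)"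
      by (simp only: conj_cdiag_entry[OF Zc cadj_carrier[OF Zc] ij])
  qed (use A Zc in auto)
  moreover have "B = Z * rdiag N (\<lambda>i. Im (f i)) * cadj Z"
  proof (rule eq_matI)
    fix i j assume "i < dim_row (Z * rdiag N (\<lambda>i. Im (f i)) * cadj Z)" "j < dim_col (Z * rdiag N (\<lambda>i. Im (f i)) * cadj Z)"
    then have ij: "i < N" "j < N" using Zc by auto
    have "B $$ (i,j) = (M $$ (i,j) - cadj M $$ (i,j)) / (2 * \<i>)"
      using ij A B by (simp add: M_def Ma[unfolded M_def])
    also have "\<dots> = (\<Sum>k<N. Z $$ (i,k) * complex_of_real (Im (f k)) * cadj Z $$ (k,j))"
      unfolding ent[OF ij] sum_subtractf[symmetric] sum_divide_distrib
    proof (rule sum.cong[OF refl])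
      fix k
      have "(f k - cnj (f k)) / (2 * \<i>) = complex_of_real (Im (f k))" by (subst nonzero_divide_eq_eq) (simp_all add: complex_eq_iff)
      moreover have "(Z $$ (i,k) * f k * cadj Z $$ (k,j) - Z $$ (i,k) * cnj (f k) * cadj Z $$ (k,j)) / (2 * \<i>)
          = Z $$ (i,k) * ((f k - cnj (f k)) / (2 * \<i>)) * cadj Z $$ (k,j)"
        by (simp add: field_simps)
      ultimately show "(Z $$ (i,k) * f k * cadj Z $$ (k,j) - Z $$ (i,k) * cnj (f k) * cadj Z $$ (k,j)) / (2 * \<i>)
          = Z $$ (i,k) * complex_of_real (Im (f k)) * cadj Z $$ (k,j)" by simp
    qed
    finally show "B $$ (i,j) = (Z * rdiag N (\<lambda>i. Im (f i)) * cadj Z) $$ (i,j)"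
      by (simp only: conj_cdiag_entry[OF Zc cadj_carrier[OF Zc] ij])
  qed (use B Zc in auto)
  ultimately show ?thesis using Z(1)
    by (intro exI[of _ Z] exI[of _ "\<lambda>i. Re (f i)"] exI[of _ "\<lambda>i. Im (f i)"] conjI)
qed

text \<open>\<open>univ_op\<close> commutes with tensor powers that are diagonal in the standard
  basis. Conjugating it by the tensor power of \<open>V\<close> makes it commute with the power of
  the given state, and keeps both its trace and its domination of symmetric states.\<close>

lemma universal_operator:
  assumes V: "unitary d V" and q: "\<forall>i<d. 0 \<le> q i"
  shows "\<exists>W Z w p. psd (d ^ n) W \<and> (\<forall>\<sigma>\<in>sym_states d n. psd (d ^ n) (W - \<sigma>)) \<and> unitary (d ^ n) Z \<and>
    W = Z * rdiag (d ^ n) w * cadj Z \<and> tpow d n (V * rdiag d q * cadj V) = Z * rdiag (d ^ n) p * cadj Z \<and>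
    (\<forall>i<d ^ n. 0 \<le> w i) \<and> (\<forall>i<d ^ n. 0 \<le> p i) \<and> (\<Sum>i<d ^ n. w i) \<le> real ((n + 1) ^ (d * d))"
proof -
  let ?N = "d ^ n"
  define Y where "Y = tpow d n V"
  have Y: "unitary ?N Y" unfolding Y_def tpow_eq by (rule unitary_tensor_power[OF word_index_digit V])
  have Yc: "Y \<in> carrier_mat ?N ?N" "cadj Y \<in> carrier_mat ?N ?N" using Y by (auto simp: unitary_def)
  define D where "D = rdiag ?N (\<lambda>I. \<Prod>k<n. q (digit d k I))"
  have An: "tpow d n (V * rdiag d q * cadj V) = Y * D * cadj Y"
    unfolding tpow_eq Y_def D_def by (rule tensor_power_diag[OF word_index_digit unitary_carrier[OF V]])
  have Dpsd: "psd ?N D" unfolding D_def using q by (intro psd_cdiag prod_nonneg) (auto simp: digit_less)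
  have Dc: "D \<in> carrier_mat ?N ?N" by (simp add: D_def)
  define W where "W = Y * univ_op d n * cadj Y"
  have Wpsd: "psd ?N W" unfolding W_def using psd_congruence[OF psd_univ_op Yc(2)] by simp
  have Apsd: "psd ?N (Y * D * cadj Y)" using psd_congruence[OF Dpsd Yc(2)] by simp
  have comm: "univ_op d n * D = D * univ_op d n"
  proof (rule eq_matI)
    fix i j assume "i < dim_row (D * univ_op d n)" "j < dim_col (D * univ_op d n)"
    then have ij: "i < ?N" "j < ?N" by (auto simp: D_def univ_op_def)
    show "(univ_op d n * D) $$ (i,j) = (D * univ_op d n) $$ (i,j)"
      unfolding D_def cdiag_mult_left[OF univ_op_carrier ij] cdiag_mult_right[OF univ_op_carrier ij]
      using univ_op_zero[OF ij, of q] by (cases "(\<Prod>k<n. q (digit d k i)) = (\<Prod>k<n. q (digit d k j))") auto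
  qed (auto simp: D_def univ_op_def)
  have WA: "W * (Y * D * cadj Y) = (Y * D * cadj Y) * W"
    unfolding W_def conj_mult_conj[OF Y univ_op_carrier Dc] conj_mult_conj[OF Y Dc univ_op_carrier] comm ..
  obtain Z w p where Z: "unitary ?N Z" "W = Z * rdiag ?N w * cadj Z" "Y * D * cadj Y = Z * rdiag ?N p * cadj Z"
    using simultaneous_diag[OF psd_carrier[OF Wpsd] psd_cadj[OF Wpsd] psd_carrier[OF Apsd] psd_cadj[OF Apsd] WA] by blast
  have nonneg: "0 \<le> g i" if X: "psd ?N X" "X = Z * rdiag ?N g * cadj Z" and i: "i < ?N" for X g i
  proof -
    have "rdiag ?N g = cadj Z * X * Z" using conj_move[OF Z(1) psd_carrier[OF X(1)] cdiag_carrier] X(2) by blast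
    then have "psd ?N (rdiag ?N g)" using psd_congruence[OF X(1) unitary_carrier[OF Z(1)]] by simp
    from psd_diag(1)[OF this i] show ?thesis using i by simp
  qed
  have trace: "(\<Sum>i<?N. w i) = real (card (pair_types d n))"
  proof -
    have "complex_of_real (\<Sum>i<?N. w i) = mtrace (rdiag ?N w)" by (simp add: mtrace_eq[OF cdiag_carrier])
    also have "\<dots> = mtrace W" unfolding Z(2) by (rule mtrace_conj[OF Z(1) cdiag_carrier, symmetric])
    also have "\<dots> = of_nat (card (pair_types d n))"
      unfolding W_def mtrace_conj[OF Y univ_op_carrier] by (rule mtrace_univ_op)
    finally show ?thesis by (metis of_real_eq_iff of_real_of_nat_eq)
  qed
  have dom: "psd ?N (W - \<sigma>)" if s: "\<sigma> \<in> sym_states d n" for \<sigma>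
  proof -
    have sp: "psd ?N \<sigma>" and st: "mtrace \<sigma> = 1" and inv: "\<And>\<pi>. \<pi> permutes {..<n} \<Longrightarrow> perm_op d n \<pi> * \<sigma> * cadj (perm_op d n \<pi>) = \<sigma>"
      using s by (auto simp: sym_states_def density_def)
    have sc: "\<sigma> \<in> carrier_mat ?N ?N" using sp by (rule psd_carrier)
    define \<sigma>' where "\<sigma>' = cadj Y * \<sigma> * Y"
    have s'c: "\<sigma>' \<in> carrier_mat ?N ?N" using Yc sc by (auto simp: \<sigma>'_def)
    \<comment> \<open>\<open>Y\<close> is itself a tensor power and therefore commutes with all
      permutations of the factors.\<close>
    have "\<sigma>' \<in> sym_states d n"
    proof -
      have "psd ?N \<sigma>'" unfolding \<sigma>'_def by (rule psd_congruence[OF sp Yc(1)])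
      moreover have "mtrace \<sigma>' = 1"
        using mtrace_conj[OF unitary_cadj[OF Y] sc] st by (simp add: \<sigma>'_def)
      moreover have "perm_op d n \<pi> * \<sigma>' * cadj (perm_op d n \<pi>) = \<sigma>'" if p: "\<pi> permutes {..<n}" for \<pi>
      proof -
        let ?P = "perm_op d n \<pi>"
        have Pu: "unitary ?N ?P" by (rule unitary_perm_op[OF p])
        have Pc: "?P \<in> carrier_mat ?N ?N" "cadj ?P \<in> carrier_mat ?N ?N" by auto
        have YP: "?P * Y * cadj ?P = Y" unfolding Y_def by (rule perm_op_tpow[OF p])
        have YP': "?P * cadj Y * cadj ?P = cadj Y" using cadj_conj[OF Pc(1) Yc(1)] YP by simp
        have "?P * \<sigma>' * cadj ?P = (?P * cadj Y * cadj ?P) * (?P * \<sigma> * cadj ?P) * (?P * Y * cadj ?P)"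
          unfolding conj_mult_conj[OF Pu Yc(2) sc] conj_mult_conj[OF Pu mult_carrier_mat[OF Yc(2) sc] Yc(1)] \<sigma>'_def ..
        then show ?thesis unfolding YP YP' inv[OF p] \<sigma>'_def .
      qed
      ultimately show ?thesis by (simp add: sym_states_def density_def)
    qed
    then have "psd ?N (univ_op d n - \<sigma>')" by (rule sym_state_le_univ_op)
    then have "psd ?N (Y * (univ_op d n - \<sigma>') * cadj Y)"
      using psd_congruence[OF _ Yc(2)] by (metis cadj_cadj)
    moreover have "Y * (univ_op d n - \<sigma>') * cadj Y = W - Y * \<sigma>' * cadj Y"
      unfolding W_def using Yc s'c
      by (simp add: mult_minus_distrib_mat[of _ ?N ?N _ ?N] minus_mult_distrib_mat[of _ ?N ?N _ _ ?N] mult_carrier_mat[of _ ?N ?N _ ?N])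
    moreover have "Y * \<sigma>' * cadj Y = \<sigma>" using conj_move[OF Y sc s'c] \<sigma>'_def by simp
    ultimately show ?thesis by simp
  qed
  show ?thesis
    unfolding An
    using Wpsd dom Z nonneg[OF Wpsd Z(2)] nonneg[OF Apsd Z(3)] trace card_pair_types[of d n]
    by (intro exI[of _ W] exI[of _ Z] exI[of _ w] exI[of _ p]) (auto simp del: of_nat_power)
qed

subsection \<open>Hypothesis tests\<close>

lemma is_test_carrier: "is_test N T \<Longrightarrow> T \<in> carrier_mat N N"
  by (simp add: is_test_def psd_carrier)

lemma psd_one: "psd N (1\<^sub>m N)"
proof -
  have "1\<^sub>m N = rdiag N (\<lambda>_. 1)" by (rule eq_matI) auto
  then show ?thesis using psd_cdiag[of N "\<lambda>_. 1"] by simp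
qed

lemma is_test_compl:
  assumes "is_test N T" shows "is_test N (1\<^sub>m N - T)"
proof -
  have "1\<^sub>m N - (1\<^sub>m N - T) = T" by (rule eq_matI) (use is_test_carrier[OF assms] in auto)
  then show ?thesis using assms by (simp add: is_test_def)
qed

text \<open>With \<open>R = 1 - S\<close>, which commutes with \<open>S\<close>, the difference is
  \<open>S * R * S + R * S * R\<close>.\<close>

lemma psd_test_minus_square:
  assumes "is_test N S" shows "psd N (S - S * S)"
proof -
  define R where "R = 1\<^sub>m N - S"
  have S: "psd N S" and R: "psd N R" using assms by (auto simp: is_test_def R_def)
  have c: "S \<in> carrier_mat N N" "R \<in> carrier_mat N N" using S R by (auto dest: psd_carrier)
  have SR: "S * R = S - S * S" "R * S = S - S * S"
    unfolding R_def using c by (simp_all add: mult_minus_distrib_mat[of _ N N _ N] minus_mult_distrib_mat[of _ N N _ _ N])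
  have one: "S + R = 1\<^sub>m N" unfolding R_def by (rule eq_matI) (use c in auto)
  have "S - S * S = S * R * (S + R)" using c SR by (simp add: one)
  also have "\<dots> = S * R * S + S * R * R"
    using c by (simp add: mult_add_distrib_mat[of _ N N _ N] mult_carrier_mat[of _ N N _ N])
  also have "S * R * R = R * S * R" using SR by simp
  finally show ?thesis
    using psd_add[OF psd_congruence[OF R c(1)] psd_congruence[OF S c(2)]] S R by (simp add: psd_cadj)
qed

text \<open>A test dominates its square. Inserting \<open>V * cadj V = 1\<close> between the two
  factors of \<open>S * S\<close> turns the diagonal in the basis \<open>U\<close> into sums of
  squared mixed entries, for any orthonormal basis \<open>V\<close>.\<close>

lemma mtrace_test_ge:
  assumes U: "unitary N U" and V: "unitary N V" and f: "\<And>i. i < N \<Longrightarrow> 0 \<le> f i" and S: "is_test N S"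
  shows "(\<Sum>i<N. \<Sum>j<N. f i * (cmod ((cadj U * S * V) $$ (i,j)))\<^sup>2) \<le> Re (mtrace (U * rdiag N f * cadj U * S))"
proof -
  have c: "U \<in> carrier_mat N N" "V \<in> carrier_mat N N" "S \<in> carrier_mat N N" "cadj U \<in> carrier_mat N N" "cadj V \<in> carrier_mat N N"
    using U V S by (auto simp: unitary_def is_test_carrier)
  have Sh: "cadj S = S" using S by (simp add: is_test_def psd_cadj[of N])
  let ?X = "cadj U * S * V"
  have Xc: "?X \<in> carrier_mat N N" using c by auto
  have XX: "?X * cadj ?X = cadj U * (S * S) * U"
  proof -
    have "cadj ?X = cadj V * (S * U)"
      using c Sh by (simp add: cadj_mult[of "cadj U * S" N N V N] cadj_mult[of "cadj U" N N S N] mult_carrier_mat[of _ N N _ N])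
    then have "?X * cadj ?X = (cadj U * S) * (S * U)"
      using mult_cancel_mid[of "cadj U * S" N N V N "cadj V" "S * U" N] c V by (simp add: unitary_def)
    then show ?thesis using c by (simp add: assoc_mult_mat[of _ N N _ N _ N] mult_carrier_mat[of _ N N _ N])
  qed
  have "(\<Sum>j<N. (cmod (?X $$ (i,j)))\<^sup>2) \<le> Re ((cadj U * S * U) $$ (i,i))" if i: "i < N" for i
  proof -
    have "complex_of_real (\<Sum>j<N. (cmod (?X $$ (i,j)))\<^sup>2) = (\<Sum>j<N. ?X $$ (i,j) * cnj (?X $$ (i,j)))"
      by (simp only: of_real_sum complex_norm_square)
    also have "\<dots> = (?X * cadj ?X) $$ (i,i)"
      unfolding mult_mat_entry[OF Xc cadj_carrier[OF Xc] i i] using i c by (intro sum.cong refl) auto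
    finally have e: "(\<Sum>j<N. (cmod (?X $$ (i,j)))\<^sup>2) = Re ((cadj U * (S * S) * U) $$ (i,i))"
      unfolding XX by (metis Re_complex_of_real)
    have "cadj U * (S - S * S) * U = cadj U * S * U - cadj U * (S * S) * U"
      using c by (simp add: mult_minus_distrib_mat[of _ N N _ N] minus_mult_distrib_mat[of _ N N _ _ N] mult_carrier_mat[of _ N N _ N])
    moreover have "0 \<le> Re ((cadj U * (S - S * S) * U) $$ (i,i))"
      by (rule psd_diag(1)[OF psd_congruence[OF psd_test_minus_square[OF S] c(1)] i])
    ultimately show ?thesis using e i c by (simp add: mult_carrier_mat[of _ N N _ N])
  qed
  then have "(\<Sum>i<N. f i * (\<Sum>j<N. (cmod (?X $$ (i,j)))\<^sup>2)) \<le> (\<Sum>i<N. f i * Re ((cadj U * S * U) $$ (i,i)))"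
    using f by (intro sum_mono mult_left_mono) auto
  then show ?thesis by (simp add: mtrace_diag_mult[OF U c(3)] sum_distrib_left)
qed

lemma add_square_weighted:
  fixes x y :: complex and \<delta> :: real
  assumes "0 < \<delta>"
  shows "(cmod (x + y))\<^sup>2 / (1 + \<delta>) \<le> (cmod x)\<^sup>2 + (cmod y)\<^sup>2 / \<delta>"
proof -
  have "(cmod (x + y))\<^sup>2 \<le> (cmod x + cmod y)\<^sup>2" by (intro power_mono norm_triangle_ineq) simp
  also have "\<dots> \<le> (1 + \<delta>) * ((cmod x)\<^sup>2 + (cmod y)\<^sup>2 / \<delta>)"
  proof -
    have "(1 + \<delta>) * ((cmod x)\<^sup>2 + (cmod y)\<^sup>2 / \<delta>) - (cmod x + cmod y)\<^sup>2 = (\<delta> * cmod x - cmod y)\<^sup>2 / \<delta>"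
      using assms by (simp add: field_simps power2_eq_square)
    moreover have "0 \<le> (\<delta> * cmod x - cmod y)\<^sup>2 / \<delta>" using assms by simp
    ultimately show ?thesis by linarith
  qed
  finally show ?thesis using assms by (simp add: divide_le_eq mult.commute)
qed

text \<open>The entries of \<open>U\<^sup>* V\<close> split as those of \<open>U\<^sup>* (1 - T) V\<close> plus those of \<open>U\<^sup>* T V\<close>. Where
  \<open>\<lambda>\<^sub>i\<close> is much smaller than \<open>\<theta> \<mu>\<^sub>j\<close>, the weighted inequality above loses only a factor \<open>1 + \<delta>\<close>.\<close>

lemma test_converse:
  assumes U: "unitary N U" and V: "unitary N V"
    and f: "\<And>i. i < N \<Longrightarrow> 0 \<le> f i" and g: "\<And>i. i < N \<Longrightarrow> 0 \<le> g i"
    and T: "is_test N T" and d: "0 < \<delta>" and th: "0 < \<theta>"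
  shows "(\<Sum>i<N. \<Sum>j<N. if f i \<le> \<delta> * \<theta> * g j then f i * (cmod ((cadj U * V) $$ (i,j)))\<^sup>2 else 0) / (1 + \<delta>)
    \<le> Re (mtrace (U * rdiag N f * cadj U * (1\<^sub>m N - T))) + \<theta> * Re (mtrace (V * rdiag N g * cadj V * T))"
proof -
  have c: "U \<in> carrier_mat N N" "V \<in> carrier_mat N N" "T \<in> carrier_mat N N" "cadj U \<in> carrier_mat N N" "cadj V \<in> carrier_mat N N"
    "1\<^sub>m N - T \<in> carrier_mat N N"
    using U V T by (auto simp: unitary_def is_test_carrier minus_carrier_mat)
  have Th: "cadj T = T" using T by (simp add: is_test_def psd_cadj[of N])
  let ?X = "cadj U * (1\<^sub>m N - T) * V" and ?Y = "cadj U * T * V"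
  have YY: "cmod ((cadj V * T * U) $$ (j,i)) = cmod (?Y $$ (i,j))" if "i < N" "j < N" for i j
  proof -
    have "cadj ?Y = cadj V * (T * U)"
      using c Th by (simp add: cadj_mult[of "cadj U * T" N N V N] cadj_mult[of "cadj U" N N T N] mult_carrier_mat[of _ N N _ N])
    then have "cadj ?Y = cadj V * T * U" using c by (simp add: assoc_mult_mat[of _ N N _ N _ N])
    then have "(cadj V * T * U) $$ (j,i) = cadj ?Y $$ (j,i)" by simp
    also have "\<dots> = cnj (?Y $$ (i,j))" using that c by (intro cadj_entry) auto
    finally show ?thesis by simp
  qed
  have XY: "(cadj U * V) $$ (i,j) = ?X $$ (i,j) + ?Y $$ (i,j)" if "i < N" "j < N" for i j
  proof -
    have "(1\<^sub>m N - T) + T = 1\<^sub>m N" by (rule eq_matI) (use c in auto)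
    then have "cadj U * V = cadj U * ((1\<^sub>m N - T) + T) * V" using c by simp
    also have "\<dots> = ?X + ?Y"
      using c by (simp add: mult_add_distrib_mat[of _ N N _ N] add_mult_distrib_mat[of _ N N _ _ N] mult_carrier_mat[of _ N N _ N])
    finally show ?thesis using that c by simp
  qed
  have "(\<Sum>i<N. \<Sum>j<N. if f i \<le> \<delta> * \<theta> * g j then f i * (cmod ((cadj U * V) $$ (i,j)))\<^sup>2 else 0) / (1 + \<delta>)
      = (\<Sum>i<N. \<Sum>j<N. (if f i \<le> \<delta> * \<theta> * g j then f i * (cmod ((cadj U * V) $$ (i,j)))\<^sup>2 else 0) / (1 + \<delta>))"
    by (simp add: sum_divide_distrib)
  also have "\<dots> \<le> (\<Sum>i<N. \<Sum>j<N. f i * (cmod (?X $$ (i,j)))\<^sup>2 + \<theta> * (g j * (cmod (?Y $$ (i,j)))\<^sup>2))"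
  proof (rule sum_mono, rule sum_mono)
    fix i j assume "i \<in> {..<N}" "j \<in> {..<N}"
    then have ij: "i < N" "j < N" by auto
    let ?x = "cmod (?X $$ (i,j))" and ?y = "cmod (?Y $$ (i,j))"
    show "(if f i \<le> \<delta> * \<theta> * g j then f i * (cmod ((cadj U * V) $$ (i,j)))\<^sup>2 else 0) / (1 + \<delta>)
        \<le> f i * ?x\<^sup>2 + \<theta> * (g j * ?y\<^sup>2)"
    proof (cases "f i \<le> \<delta> * \<theta> * g j")
      case True
      have "f i * ((cmod ((cadj U * V) $$ (i,j)))\<^sup>2 / (1 + \<delta>)) \<le> f i * (?x\<^sup>2 + ?y\<^sup>2 / \<delta>)"
        unfolding XY[OF ij] using f[OF ij(1)] add_square_weighted[OF d] by (intro mult_left_mono)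
      \<comment> \<open>The case assumption trades \<open>f i\<close> for
        \<open>\<delta> * \<theta> * g j\<close>. The factor \<delta> cancels the 1 / \<delta> of
        the weighted inequality and leaves \<theta> times a term of the second error.\<close>
      moreover have "f i * (?y\<^sup>2 / \<delta>) \<le> (\<delta> * \<theta> * g j) * (?y\<^sup>2 / \<delta>)"
        using True d by (intro mult_right_mono) auto
      moreover have "(\<delta> * \<theta> * g j) * (?y\<^sup>2 / \<delta>) = \<theta> * (g j * ?y\<^sup>2)"
        using d by simp
      ultimately show ?thesis using True by (simp add: distrib_left)
    next
      case False
      then show ?thesis using f[OF ij(1)] g[OF ij(2)] th by simp
    qed
  qed
  also have "\<dots> = (\<Sum>i<N. \<Sum>j<N. f i * (cmod (?X $$ (i,j)))\<^sup>2) + \<theta> * (\<Sum>j<N. \<Sum>i<N. g j * (cmod ((cadj V * T * U) $$ (j,i)))\<^sup>2)"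
  proof -
    have "(\<Sum>j<N. \<Sum>i<N. g j * (cmod ((cadj V * T * U) $$ (j,i)))\<^sup>2) = (\<Sum>i<N. \<Sum>j<N. g j * (cmod (?Y $$ (i,j)))\<^sup>2)"
      by (subst sum.swap) (auto intro!: sum.cong simp: YY)
    then show ?thesis by (simp add: sum.distrib sum_distrib_left)
  qed
  also have "\<dots> \<le> Re (mtrace (U * rdiag N f * cadj U * (1\<^sub>m N - T))) + \<theta> * Re (mtrace (V * rdiag N g * cadj V * T))"
    using th by (intro add_mono mult_left_mono mtrace_test_ge[OF U V f is_test_compl[OF T]] mtrace_test_ge[OF V U g T]) auto
  finally show ?thesis .
qed

text \<open>The first two clauses make the array \<open>T\<close> an orthogonal projection, and the
  third puts every \<open>\<xi> s\<close> into its range. The clause on vanishing rows is the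
  invariant of the induction: it lets a new vector keep its support when it is orthogonalised
  against the range of \<open>T\<close>.\<close>

definition graded_projection ::
  "nat \<Rightarrow> real \<Rightarrow> (nat \<Rightarrow> real) \<Rightarrow> (nat \<Rightarrow> real) \<Rightarrow> (nat \<Rightarrow> nat \<Rightarrow> complex) \<Rightarrow> nat set \<Rightarrow> (nat \<Rightarrow> nat \<Rightarrow> complex) \<Rightarrow> bool" where
  "graded_projection N \<theta> w l \<xi> S T \<longleftrightarrow>
    (\<forall>i<N. \<forall>j<N. cnj (T i j) = T j i) \<and>
    (\<forall>i<N. \<forall>j<N. (\<Sum>k<N. T i k * T k j) = T i j) \<and>
    (\<forall>s\<in>S. \<forall>i<N. (\<Sum>k<N. T i k * \<xi> s k) = \<xi> s i) \<and>
    (\<forall>i<N. \<forall>j<N. (\<forall>s\<in>S. \<not> \<theta> * w i \<le> l s) \<longrightarrow> T i j = 0) \<and>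
    (\<Sum>i<N. w i * Re (T i i)) \<le> (\<Sum>s\<in>S. l s) / \<theta>"

text \<open>Gram--Schmidt in order of increasing \<open>\<lambda>\<close>: since \<open>\<xi> s\<close> is supported on the coordinates with
  \<open>\<theta> w\<^sub>j \<le> \<lambda>\<^sub>s\<close>, and these supports grow with \<open>\<lambda>\<^sub>s\<close>, each new orthonormal direction adds at most
  \<open>\<lambda>\<^sub>s / \<theta>\<close> to the weighted trace.\<close>

lemma graded_gram_schmidt:
  fixes \<xi> :: "nat \<Rightarrow> nat \<Rightarrow> complex" and w l :: "nat \<Rightarrow> real"
  assumes "finite S" and th: "0 < \<theta>"
    and "\<And>s j. s \<in> S \<Longrightarrow> j < N \<Longrightarrow> \<not> \<theta> * w j \<le> l s \<Longrightarrow> \<xi> s j = 0"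
    and "\<And>s. s \<in> S \<Longrightarrow> 0 \<le> l s"
  shows "\<exists>T. graded_projection N \<theta> w l \<xi> S T"
  using assms(1,3,4)
\<comment> \<open>This induction adds elements in order of \<open>l\<close>, so that
  \<open>l x\<close> is at least every \<open>l s\<close> treated before. The new \<open>x\<close>
  may already belong to \<open>S\<close>.\<close>
proof (induction S rule: finite_ranking_induct[where f = l])
  case empty
  show ?case by (rule exI[of _ "\<lambda>_ _. 0"]) (simp add: graded_projection_def)
next
  case (insert x S)
  have zero: "\<xi> x j = 0" if "j < N" "\<not> \<theta> * w j \<le> l x" for j using insert.prems(1) that by blast
  have "\<exists>T. graded_projection N \<theta> w l \<xi> S T"
    using insert.prems by (intro insert.IH) auto
  then obtain T where T: "\<forall>i<N. \<forall>j<N. cnj (T i j) = T j i" "\<forall>i<N. \<forall>j<N. (\<Sum>k<N. T i k * T k j) = T i j"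
    "\<forall>s\<in>S. \<forall>i<N. (\<Sum>k<N. T i k * \<xi> s k) = \<xi> s i"
    "\<forall>i<N. \<forall>j<N. (\<forall>s\<in>S. \<not> \<theta> * w i \<le> l s) \<longrightarrow> T i j = 0"
    and tr: "(\<Sum>i<N. w i * Re (T i i)) \<le> (\<Sum>s\<in>S. l s) / \<theta>"
    unfolding graded_projection_def by (elim exE conjE) (rule that)
  have herm: "cnj (T i j) = T j i" and idem: "(\<Sum>k<N. T i k * T k j) = T i j"
    and rows: "(\<And>s. s \<in> S \<Longrightarrow> \<not> \<theta> * w i \<le> l s) \<Longrightarrow> T i j = 0" if "i < N" "j < N" for i j
    using T that by blast+
  have fixed: "(\<Sum>k<N. T i k * \<xi> s k) = \<xi> s i" if "s \<in> S" "i < N" for s i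
    using T(3) that by blast
  \<comment> \<open>The component of \<open>\<xi> x\<close> orthogonal to the range of
    \<open>T\<close>.\<close>
  define \<eta> where "\<eta> i = \<xi> x i - (\<Sum>k<N. T i k * \<xi> x k)" for i
  have T\<eta>: "(\<Sum>k<N. T i k * \<eta> k) = 0" if "i < N" for i
  proof -
    have "(\<Sum>k<N. T i k * (\<Sum>m<N. T k m * \<xi> x m)) = (\<Sum>m<N. (\<Sum>k<N. T i k * T k m) * \<xi> x m)"
      by (simp add: sum_distrib_left sum_distrib_right mult.assoc) (rule sum.swap)
    also have "\<dots> = (\<Sum>m<N. T i m * \<xi> x m)"
      by (rule sum.cong[OF refl]) (simp add: idem that)
    finally show ?thesis by (simp add: \<eta>_def right_diff_distrib sum_subtractf)
  qed
  have \<eta>T: "(\<Sum>k<N. cnj (\<eta> k) * T k j) = 0" if "j < N" for j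
  proof -
    have "(\<Sum>k<N. cnj (\<eta> k) * T k j) = cnj (\<Sum>k<N. T j k * \<eta> k)"
      unfolding cnj_sum by (rule sum.cong[OF refl]) (simp add: herm that mult.commute)
    then show ?thesis by (simp add: T\<eta> that)
  qed
  have \<eta>T': "(\<Sum>k<N. cnj (\<eta> k) * (\<Sum>m<N. T k m * v m)) = 0" for v
  proof -
    have "(\<Sum>k<N. cnj (\<eta> k) * (\<Sum>m<N. T k m * v m)) = (\<Sum>m<N. (\<Sum>k<N. cnj (\<eta> k) * T k m) * v m)"
      by (simp add: sum_distrib_left sum_distrib_right mult.assoc) (rule sum.swap)
    also have "\<dots> = 0" by (rule sum.neutral) (simp add: \<eta>T)
    finally show ?thesis .
  qed
  define e where "e = (\<Sum>k<N. (cmod (\<eta> k))\<^sup>2)"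
  have ee: "(\<Sum>k<N. cnj (\<eta> k) * \<eta> k) = complex_of_real e"
    unfolding e_def of_real_sum by (rule sum.cong[OF refl]) (simp only: complex_norm_square mult.commute)
  have \<eta>S: "(\<Sum>k<N. cnj (\<eta> k) * \<xi> s k) = 0" if "s \<in> S" for s
  proof -
    have "(\<Sum>k<N. cnj (\<eta> k) * \<xi> s k) = (\<Sum>k<N. cnj (\<eta> k) * (\<Sum>m<N. T k m * \<xi> s m))"
      by (rule sum.cong[OF refl]) (simp add: fixed that)
    then show ?thesis by (simp add: \<eta>T')
  qed
  have \<eta>x: "(\<Sum>k<N. cnj (\<eta> k) * \<xi> x k) = complex_of_real e"
  proof -
    have "(\<Sum>k<N. cnj (\<eta> k) * \<xi> x k) = (\<Sum>k<N. cnj (\<eta> k) * \<eta> k + cnj (\<eta> k) * (\<Sum>m<N. T k m * \<xi> x m))"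
      by (rule sum.cong[OF refl]) (simp add: \<eta>_def algebra_simps)
    then show ?thesis by (simp add: sum.distrib \<eta>T' ee)
  qed
  \<comment> \<open>A coordinate excluded for \<open>x\<close> is excluded for all earlier
    \<open>s\<close>, whose \<open>l s\<close> is no larger; the row of \<open>T\<close> vanishes
    there, and nothing is added to \<open>\<xi> x\<close>.\<close>
  have \<eta>0: "\<eta> i = 0" if i: "i < N" and n: "\<not> \<theta> * w i \<le> l x" for i
  proof -
    have "\<not> \<theta> * w i \<le> l s" if "s \<in> S" for s using insert.hyps(2)[OF that] n by linarith
    then have "T i k = 0" if "k < N" for k using rows[OF i that] by blast
    then show ?thesis using zero[OF i n] by (simp add: \<eta>_def)
  qed
  have lx: "0 \<le> l x" using insert.prems(2) by simp
  show ?case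
  \<comment> \<open>In these cases \<open>\<xi> x\<close> already lies in the range of
    \<open>T\<close>, which is kept.\<close>
  proof (cases "x \<in> S \<or> e = 0")
    case True
    have fx: "(\<Sum>k<N. T i k * \<xi> x k) = \<xi> x i" if i: "i < N" for i
    proof (cases "x \<in> S")
      case False
      with True have "e = 0" by blast
      then have "\<eta> i = 0" using i by (simp add: e_def sum_nonneg_eq_0_iff)
      then show ?thesis by (simp add: \<eta>_def)
    qed (simp add: fixed i)
    have "(\<Sum>s\<in>S. l s) \<le> (\<Sum>s\<in>insert x S. l s)"
      using insert.hyps(1) insert.prems(2) by (intro sum_mono2) auto
    then have "(\<Sum>i<N. w i * Re (T i i)) \<le> (\<Sum>s\<in>insert x S. l s) / \<theta>"
      using tr th by (meson divide_right_mono less_imp_le order_trans)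
    then show ?thesis
      using herm idem fixed fx rows unfolding graded_projection_def by (intro exI[of _ T]) auto
  next
    case False
    then have xS: "x \<notin> S" and e0: "e \<noteq> 0" by auto
    then have e_pos: "0 < e" by (metis e_def sum_nonneg zero_le_power2 order_le_less)
    \<comment> \<open>\<open>T\<close> plus the orthogonal projection onto the line of
      \<eta>.\<close>
    define T' where "T' i j = T i j + \<eta> i * cnj (\<eta> j) / complex_of_real e" for i j
    have app: "(\<Sum>k<N. T' i k * v k) = (\<Sum>k<N. T i k * v k) + \<eta> i * (\<Sum>k<N. cnj (\<eta> k) * v k) / complex_of_real e" for i v
      by (simp add: T'_def distrib_right sum.distrib sum_distrib_left sum_divide_distrib mult.assoc)
    have h': "cnj (T' i j) = T' j i" if "i < N" "j < N" for i j
      using that by (simp add: T'_def herm mult.commute)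
    have i': "(\<Sum>k<N. T' i k * T' k j) = T' i j" if ij: "i < N" "j < N" for i j
    proof -
      have "(\<Sum>k<N. T i k * T' k j) = (\<Sum>k<N. T i k * T k j) + (\<Sum>k<N. T i k * \<eta> k) * (cnj (\<eta> j) / complex_of_real e)"
        by (simp add: T'_def distrib_left sum.distrib sum_distrib_right mult.assoc sum_divide_distrib)
      then have 1: "(\<Sum>k<N. T i k * T' k j) = T i j" using ij by (simp add: idem T\<eta>)
      have "(\<Sum>k<N. cnj (\<eta> k) * T' k j) = (\<Sum>k<N. cnj (\<eta> k) * T k j) + (\<Sum>k<N. cnj (\<eta> k) * \<eta> k) * (cnj (\<eta> j) / complex_of_real e)"
        by (simp add: T'_def distrib_left sum.distrib sum_distrib_right mult.assoc sum_divide_distrib)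
      then have 2: "(\<Sum>k<N. cnj (\<eta> k) * T' k j) = cnj (\<eta> j)" using ij e0 by (simp add: \<eta>T ee)
      show ?thesis unfolding app 1 2 by (simp add: T'_def)
    qed
    have f': "(\<Sum>k<N. T' i k * \<xi> s k) = \<xi> s i" if s: "s \<in> insert x S" and i: "i < N" for s i
    proof (cases "s = x")
      case True
      show ?thesis unfolding app True \<eta>x using e0 by (simp add: \<eta>_def)
    next
      case False
      then have "s \<in> S" using s by simp
      then show ?thesis unfolding app using i by (simp add: fixed \<eta>S)
    qed
    have r': "T' i j = 0" if ij: "i < N" "j < N" and n: "\<And>s. s \<in> insert x S \<Longrightarrow> \<not> \<theta> * w i \<le> l s" for i j
      using rows[OF ij] \<eta>0[OF ij(1)] n by (simp add: T'_def)
    have "(\<Sum>i<N. w i * Re (T' i i)) \<le> (\<Sum>i<N. w i * Re (T i i) + (l x / \<theta>) * ((cmod (\<eta> i))\<^sup>2 / e))"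
    proof (rule sum_mono)
      fix i assume "i \<in> {..<N}"
      then have i: "i < N" by simp
      have "\<eta> i * cnj (\<eta> i) / complex_of_real e = complex_of_real ((cmod (\<eta> i))\<^sup>2 / e)"
        by (simp only: of_real_divide complex_norm_square)
      then have "Re (T' i i) = Re (T i i) + (cmod (\<eta> i))\<^sup>2 / e"
        unfolding T'_def by (metis plus_complex.sel(1) Re_complex_of_real)
      moreover have "w i * ((cmod (\<eta> i))\<^sup>2 / e) \<le> (l x / \<theta>) * ((cmod (\<eta> i))\<^sup>2 / e)"
      proof (cases "\<eta> i = 0")
        case False
        then have "\<theta> * w i \<le> l x" using \<eta>0[OF i] by blast
        then have "w i \<le> l x / \<theta>" using th by (simp add: field_simps)
        then show ?thesis using e_pos by (intro mult_right_mono) auto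
      qed simp
      ultimately show "w i * Re (T' i i) \<le> w i * Re (T i i) + (l x / \<theta>) * ((cmod (\<eta> i))\<^sup>2 / e)"
        by (simp add: distrib_left)
    qed
    also have "\<dots> = (\<Sum>i<N. w i * Re (T i i)) + l x / \<theta>"
      using e0 by (simp add: sum.distrib sum_distrib_left[symmetric] sum_divide_distrib[symmetric] e_def[symmetric])
    also have "\<dots> \<le> (\<Sum>s\<in>insert x S. l s) / \<theta>"
      using tr insert.hyps(1) xS by (simp add: add_divide_distrib)
    finally show ?thesis using h' i' f' r' unfolding graded_projection_def by (intro exI[of _ T']) blast
  qed
qed

lemma psd_projection:
  assumes c: "P \<in> carrier_mat N N" and h: "cadj P = P" and i: "P * P = P"
  shows "is_test N P"
proof -
  have psd: "psd N Q" if Q: "Q \<in> carrier_mat N N" "cadj Q = Q" "Q * Q = Q" for Q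
    using psd_congruence[OF psd_one Q(1)] Q by (simp add: right_mult_one_mat[of Q N N])
  have "(1\<^sub>m N - P) * (1\<^sub>m N - P) = 1\<^sub>m N - P"
  proof -
    have "(1\<^sub>m N - P) * (1\<^sub>m N - P) = (1\<^sub>m N - P) - (P - P * P)"
      using c by (simp add: mult_minus_distrib_mat[of _ N N _ N] minus_mult_distrib_mat[of _ N N _ _ N] minus_carrier_mat)
    also have "\<dots> = 1\<^sub>m N - P" unfolding i by (rule eq_matI) (use c in auto)
    finally show ?thesis .
  qed
  then show ?thesis
    using c h i by (auto simp: is_test_def cadj_minus[OF one_carrier_mat c] minus_carrier_mat intro!: psd)
qed

lemma is_test_conj:
  assumes Z: "unitary N Z" and T: "is_test N T"
  shows "is_test N (Z * T * cadj Z)"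
proof -
  have c: "Z \<in> carrier_mat N N" "cadj Z \<in> carrier_mat N N" "T \<in> carrier_mat N N" and zz: "Z * cadj Z = 1\<^sub>m N"
    using Z T by (auto simp: unitary_def is_test_carrier)
  have e: "Z * (1\<^sub>m N - T) * cadj Z = 1\<^sub>m N - Z * T * cadj Z"
    using c zz by (simp add: mult_minus_distrib_mat[of _ N N _ N] minus_mult_distrib_mat[of _ N N _ _ N] mult_carrier_mat[of _ N N _ N])
  show ?thesis
    using psd_congruence[of N T "cadj Z" N] psd_congruence[of N "1\<^sub>m N - T" "cadj Z" N] c T e
    by (simp add: is_test_def)
qed

text \<open>In the basis \<open>Z\<close> every column of \<open>U\<close> splits into \<xi>, where
  \<open>f i\<close> passes the threshold, and \<zeta>, where it fails. The graded projection fixes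
  \<xi>, so its complement sees only \<zeta>, whose squared norm is the overlap weight below the
  threshold. The weighted trace bound of the projection is the second error.\<close>

lemma test_achievability:
  assumes U: "unitary N U" and Z: "unitary N Z"
    and f: "\<And>i. i < N \<Longrightarrow> 0 \<le> f i" and f1: "(\<Sum>i<N. f i) \<le> 1" and th: "0 < \<theta>"
  shows "\<exists>T. is_test N T \<and> Re (mtrace (Z * rdiag N w * cadj Z * T)) \<le> 1 / \<theta> \<and>
    Re (mtrace (U * rdiag N f * cadj U * (1\<^sub>m N - T))) \<le>
      (\<Sum>i<N. \<Sum>j<N. if f i < \<theta> * w j then f i * (cmod ((cadj U * Z) $$ (i,j)))\<^sup>2 else 0)"
proof -
  have c: "U \<in> carrier_mat N N" "Z \<in> carrier_mat N N" "cadj U \<in> carrier_mat N N" "cadj Z \<in> carrier_mat N N"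
    and zz: "cadj Z * Z = 1\<^sub>m N" "Z * cadj Z = 1\<^sub>m N" and uu: "cadj U * U = 1\<^sub>m N"
    using U Z by (auto simp: unitary_def)
  define C where "C = cadj Z * U"
  have Cc: "C \<in> carrier_mat N N" using c by (auto simp: C_def)
  \<comment> \<open>\<open>a i\<close> is the coordinate vector of the \<open>i\<close>-th column of
    \<open>U\<close> in the basis \<open>Z\<close>.\<close>
  define a where "a i j = C $$ (j,i)" for i j
  define \<xi> where "\<xi> i j = (if \<theta> * w j \<le> f i then a i j else 0)" for i j
  define \<zeta> where "\<zeta> i j = (if \<theta> * w j \<le> f i then 0 else a i j)" for i j
  have a_eq: "a i j = \<xi> i j + \<zeta> i j" for i j by (simp add: \<xi>_def \<zeta>_def)
  have orth: "cnj (\<xi> i j) * \<zeta> i j = 0" for i j by (simp add: \<xi>_def \<zeta>_def)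
  have "\<exists>T. graded_projection N \<theta> w f \<xi> {..<N} T"
    using th f by (intro graded_gram_schmidt) (auto simp: \<xi>_def)
  then obtain T where T: "\<forall>i<N. \<forall>j<N. cnj (T i j) = T j i" "\<forall>i<N. \<forall>j<N. (\<Sum>k<N. T i k * T k j) = T i j"
    "\<forall>s\<in>{..<N}. \<forall>i<N. (\<Sum>k<N. T i k * \<xi> s k) = \<xi> s i"
    and tr: "(\<Sum>i<N. w i * Re (T i i)) \<le> (\<Sum>s<N. f s) / \<theta>"
    unfolding graded_projection_def by (elim exE conjE) (rule that)
  have herm: "cnj (T i j) = T j i" and idem: "(\<Sum>k<N. T i k * T k j) = T i j"
    and fixed: "(\<Sum>k<N. T j k * \<xi> i k) = \<xi> i j" if "i < N" "j < N" for i j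
    using T that by blast+
  define P where "P = mat N N (\<lambda>(i,j). T i j)"
  have Pc: "P \<in> carrier_mat N N" by (simp add: P_def)
  have Pe: "P $$ (i,j) = T i j" if "i < N" "j < N" for i j using that by (simp add: P_def)
  have Ptest: "is_test N P"
  proof (rule psd_projection[OF Pc])
    show "cadj P = P" by (rule eq_matI) (use Pc in \<open>auto simp: Pe herm\<close>)
    show "P * P = P" by (rule eq_matI) (use Pc in \<open>auto simp: mult_mat_entry[OF Pc Pc] Pe idem\<close>)
  qed
  define Q where "Q = Z * P * cadj Z"
  have Qtest: "is_test N Q" unfolding Q_def by (rule is_test_conj[OF Z Ptest])
  have Qc: "Q \<in> carrier_mat N N" by (rule is_test_carrier[OF Qtest])
  have PQ: "P = cadj Z * Q * Z" using conj_move[OF Z Qc Pc] Q_def by simp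
  have "Re (mtrace (Z * rdiag N w * cadj Z * Q)) = (\<Sum>i<N. w i * Re (T i i))"
    unfolding mtrace_diag_mult[OF Z Qc] PQ[symmetric] by (simp add: Pe)
  also have "\<dots> \<le> 1 / \<theta>" using tr f1 th by (meson divide_right_mono less_imp_le order_trans)
  finally have t1: "Re (mtrace (Z * rdiag N w * cadj Z * Q)) \<le> 1 / \<theta>" .
  have UQU: "cadj U * (1\<^sub>m N - Q) * U = cadj C * (1\<^sub>m N - P) * C"
  proof -
    have "1\<^sub>m N - Q = Z * (1\<^sub>m N - P) * cadj Z"
      unfolding Q_def using c zz Pc by (simp add: mult_minus_distrib_mat[of _ N N _ N] minus_mult_distrib_mat[of _ N N _ _ N] mult_carrier_mat[of _ N N _ N])
    then show ?thesis
      unfolding C_def using c Pc by (simp add: cadj_mult[of "cadj Z" N N U N] assoc_mult_mat[of _ N N _ N _ N] mult_carrier_mat[of _ N N _ N] minus_carrier_mat)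
  qed
  have diag: "Re ((cadj U * (1\<^sub>m N - Q) * U) $$ (i,i)) \<le> (\<Sum>j<N. (cmod (\<zeta> i j))\<^sup>2)" if i: "i < N" for i
  proof -
    define r where "r j = \<zeta> i j - (\<Sum>k<N. T j k * \<zeta> i k)" for j
    have r: "(\<Sum>k<N. (1\<^sub>m N - P) $$ (j,k) * a i k) = r j" if j: "j < N" for j
    proof -
      have "(\<Sum>k<N. (1\<^sub>m N - P) $$ (j,k) * a i k) = (\<Sum>k<N. (if k = j then a i j else 0) - (T j k * \<xi> i k + T j k * \<zeta> i k))"
        by (rule sum.cong[OF refl]) (use j Pc in \<open>auto simp: Pe a_eq algebra_simps\<close>)
      also have "\<dots> = a i j - (\<xi> i j + (\<Sum>k<N. T j k * \<zeta> i k))"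
        using j by (simp add: sum_subtractf sum.distrib fixed[OF i j])
      finally show ?thesis by (simp add: r_def a_eq)
    qed
    have "(cadj C * (1\<^sub>m N - P) * C) $$ (i,i) = (\<Sum>j<N. cnj (a i j) * (\<Sum>k<N. (1\<^sub>m N - P) $$ (j,k) * a i k))"
      unfolding conj_entry[OF cadj_carrier[OF Cc] minus_carrier_mat[OF Pc] Cc i i] sum_distrib_left
      by (intro sum.cong refl) (use i Cc in \<open>simp add: a_def mult.assoc\<close>)
    also have "\<dots> = (\<Sum>j<N. cnj (\<xi> i j) * r j + cnj (\<zeta> i j) * r j)"
      by (rule sum.cong[OF refl]) (simp only: r lessThan_iff, simp add: a_eq distrib_right)
    \<comment> \<open>\<open>r\<close> is \<zeta> minus its projection. The projection fixes \<xi>,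
      and \<xi> and \<zeta> have disjoint supports, so \<open>r\<close> is orthogonal to
      \<xi>.\<close>
    also have "\<dots> = (\<Sum>j<N. cnj (\<zeta> i j) * r j)"
    proof -
      have "(\<Sum>j<N. cnj (\<xi> i j) * r j) = - (\<Sum>j<N. \<Sum>k<N. cnj (\<xi> i j) * (T j k * \<zeta> i k))"
        by (simp add: r_def right_diff_distrib sum_subtractf orth sum_distrib_left sum_negf)
      also have "(\<Sum>j<N. \<Sum>k<N. cnj (\<xi> i j) * (T j k * \<zeta> i k)) = (\<Sum>k<N. \<Sum>j<N. cnj (T k j * \<xi> i j) * \<zeta> i k)"
        by (subst sum.swap) (auto intro!: sum.cong simp: herm)
      also have "\<dots> = (\<Sum>k<N. cnj (\<xi> i k) * \<zeta> i k)"
        by (rule sum.cong[OF refl]) (simp only: sum_distrib_right[symmetric] cnj_sum[symmetric] fixed[OF i] lessThan_iff)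
      finally show ?thesis by (simp add: sum.distrib orth)
    qed
    finally have e: "(cadj C * (1\<^sub>m N - P) * C) $$ (i,i) = (\<Sum>j<N. cnj (\<zeta> i j) * \<zeta> i j) - (\<Sum>j<N. \<Sum>k<N. cnj (\<zeta> i j) * T j k * \<zeta> i k)"
      by (simp add: r_def right_diff_distrib sum_subtractf sum_distrib_left mult.assoc)
    define z where "z = vec N (\<zeta> i)"
    have z: "z \<in> carrier_vec N" by (simp add: z_def)
    have "qform N P z = (\<Sum>j<N. \<Sum>k<N. cnj (\<zeta> i j) * T j k * \<zeta> i k)"
      unfolding qform_eq[OF Pc z] by (intro sum.cong refl) (simp add: z_def Pe)
    \<comment> \<open>The part of \<zeta> inside the range of the projection only lowers the error
      and is dropped.\<close>
    then have "0 \<le> Re (\<Sum>j<N. \<Sum>k<N. cnj (\<zeta> i j) * T j k * \<zeta> i k)"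
      using Ptest z by (metis is_test_def psd_alt)
    moreover have "(\<Sum>j<N. cnj (\<zeta> i j) * \<zeta> i j) = complex_of_real (\<Sum>j<N. (cmod (\<zeta> i j))\<^sup>2)"
      unfolding of_real_sum by (rule sum.cong[OF refl]) (simp only: complex_norm_square mult.commute)
    ultimately show ?thesis unfolding UQU e by simp
  qed
  have "Re (mtrace (U * rdiag N f * cadj U * (1\<^sub>m N - Q))) = (\<Sum>i<N. f i * Re ((cadj U * (1\<^sub>m N - Q) * U) $$ (i,i)))"
    unfolding mtrace_diag_mult[OF U minus_carrier_mat[OF Qc]] by simp
  also have "\<dots> \<le> (\<Sum>i<N. f i * (\<Sum>j<N. (cmod (\<zeta> i j))\<^sup>2))"
    using f diag by (intro sum_mono mult_left_mono) auto
  also have "\<dots> = (\<Sum>i<N. \<Sum>j<N. if f i < \<theta> * w j then f i * (cmod ((cadj U * Z) $$ (i,j)))\<^sup>2 else 0)"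
    unfolding sum_distrib_left
  proof (rule sum.cong[OF refl], rule sum.cong[OF refl])
    fix i j assume "i \<in> {..<N}" "j \<in> {..<N}"
    then have "cnj ((cadj U * Z) $$ (i,j)) = cadj (cadj U * Z) $$ (j,i)" using c by simp
    also have "cadj (cadj U * Z) = C" unfolding C_def using cadj_mult[OF c(3,2)] by simp
    finally have "cmod ((cadj U * Z) $$ (i,j)) = cmod (a i j)" by (metis a_def complex_mod_cnj)
    then show "f i * (cmod (\<zeta> i j))\<^sup>2 = (if f i < \<theta> * w j then f i * (cmod ((cadj U * Z) $$ (i,j)))\<^sup>2 else 0)"
      by (simp add: \<zeta>_def not_le)
  qed
  finally show ?thesis using Qtest t1 by blast
qed

subsection \<open>The central limit theorem for finitely supported weights\<close>

lemma cdf_std_normal: "cdf std_normal_distribution x = std_normal_cdf x"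
proof -
  have "measure std_normal_distribution {..x} = (\<integral>t. indicator {..x} t \<partial>std_normal_distribution)"
    by simp
  also have "\<dots> = (\<integral>t. std_normal_density t *\<^sub>R indicator {..x} t \<partial>lborel)"
    by (subst integral_density) auto
  also have "\<dots> = (\<integral>t. (1 / sqrt (2 * pi)) * (indicator {..x} t *\<^sub>R exp (- (t ^ 2) / 2)) \<partial>lborel)"
    by (rule Bochner_Integration.integral_cong) (auto simp: std_normal_density_def)
  also have "\<dots> = std_normal_cdf x"
    unfolding std_normal_cdf_def set_lebesgue_integral_def by (rule integral_mult_right_zero)
  finally show ?thesis by (simp add: cdf_def)
qed

text \<open>A distribution with a Lebesgue density has no atoms.\<close>

lemma isCont_std_normal_cdf: "isCont std_normal_cdf x"
proof -
  interpret real_distribution std_normal_distribution by (rule real_dist_normal_dist)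
  have "AE t in lborel. t \<notin> {x}" using AE_lborel_singleton[of x] by simp
  then have "emeasure std_normal_distribution {x} = 0"
    by (subst emeasure_density) (auto simp: nn_integral_0_iff_AE indicator_def elim: eventually_mono)
  then have "isCont (cdf std_normal_distribution) x"
    unfolding isCont_cdf by (simp add: measure_def)
  moreover have "cdf std_normal_distribution = std_normal_cdf" using cdf_std_normal by blast
  ultimately show ?thesis by simp
qed

text \<open>By monotonicity \<open>G n (y n)\<close> is caught between the values at two fixed
  points close to \<open>x\<close>, where the limit is known. This absorbs the vanishing shifts of
  the threshold without any uniform convergence.\<close>

lemma mono_tendsto_shift:
  fixes G :: "nat \<Rightarrow> real \<Rightarrow> real"
  assumes mono: "\<And>n. mono (G n)" and lim: "\<And>x. (\<lambda>n. G n x) \<longlonglongrightarrow> F x"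
    and cont: "isCont F x" and y: "y \<longlonglongrightarrow> x"
  shows "(\<lambda>n. G n (y n)) \<longlonglongrightarrow> F x"
proof (rule LIMSEQ_I)
  fix e :: real assume e: "0 < e"
  have "e / 2 > 0" using e by simp
  then obtain s where s: "0 < s" "\<And>z. \<bar>z - x\<bar> < s \<Longrightarrow> \<bar>F z - F x\<bar> < e / 2"
    using cont unfolding continuous_at_eps_delta dist_real_def by metis
  let ?a = "x - s / 2" and ?b = "x + s / 2"
  have Fab: "\<bar>F ?a - F x\<bar> < e / 2" "\<bar>F ?b - F x\<bar> < e / 2" using s(1) by (intro s(2); simp)+
  have "\<forall>\<^sub>F n in sequentially. \<bar>G n ?a - F ?a\<bar> < e / 2" "\<forall>\<^sub>F n in sequentially. \<bar>G n ?b - F ?b\<bar> < e / 2"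
    using tendstoD[OF lim \<open>e / 2 > 0\<close>] by (auto simp: dist_real_def)
  moreover have "\<forall>\<^sub>F n in sequentially. \<bar>y n - x\<bar> < s / 2"
    using tendstoD[OF y, of "s / 2"] s(1) by (auto simp: dist_real_def)
  ultimately have "\<forall>\<^sub>F n in sequentially. norm (G n (y n) - F x) < e"
  proof eventually_elim
    case (elim n)
    have "?a \<le> y n" "y n \<le> ?b" using elim(3) unfolding abs_less_iff by linarith+
    then have "G n ?a \<le> G n (y n)" "G n (y n) \<le> G n ?b" by (auto intro: monoD[OF mono])
    with elim(1,2) Fab show ?case unfolding real_norm_def by linarith
  qed
  then show "\<exists>no. \<forall>n\<ge>no. norm (G n (y n) - F x) < e" by (simp add: eventually_sequentially)
qed

text \<open>An event that depends on the first \<open>n\<close> coordinates is a finite disjoint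
  union of cylinders over single words. It links the infinite product space, on which the central
  limit theorem is applied, to finite sums over words.\<close>

lemma measure_PiM_point_measure:
  fixes p :: "'a \<Rightarrow> real" and n :: nat
  assumes \<Omega>: "finite \<Omega>" and p: "\<And>a. a \<in> \<Omega> \<Longrightarrow> 0 \<le> p a" and p1: "(\<Sum>a\<in>\<Omega>. p a) = 1"
  defines "M \<equiv> point_measure \<Omega> (\<lambda>a. ennreal (p a))"
  shows "measure (\<Pi>\<^sub>M k\<in>(UNIV :: nat set). M) {\<omega> \<in> space (\<Pi>\<^sub>M k\<in>(UNIV :: nat set). M). Q (restrict \<omega> {..<n})}
    = (\<Sum>f\<in>{..<n} \<rightarrow>\<^sub>E \<Omega>. if Q f then \<Prod>k<n. p (f k) else 0)"
proof -
  have "(\<Sum>a\<in>\<Omega>. ennreal (p a)) = 1" using p p1 by (simp add: sum_ennreal)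
  then have pM: "prob_space M" unfolding M_def using \<Omega> by (intro prob_space_point_measure) auto
  interpret M: prob_space M by (rule pM)
  interpret P: product_prob_space "\<lambda>_::nat. M" UNIV by unfold_locales
  let ?P = "\<Pi>\<^sub>M k\<in>(UNIV :: nat set). M"
  have spM: "space M = \<Omega>" by (simp add: M_def space_point_measure)
  have sM: "sets M = Pow \<Omega>" by (simp add: M_def sets_point_measure)
  let ?A = "{f \<in> {..<n} \<rightarrow>\<^sub>E \<Omega>. Q f}"
  let ?E = "\<lambda>f. prod_emb UNIV (\<lambda>_. M) {..<n} (\<Pi>\<^sub>E k\<in>{..<n}. {f k})"
  have E: "?E f = {\<omega> \<in> space ?P. restrict \<omega> {..<n} = f}" if "f \<in> {..<n} \<rightarrow>\<^sub>E \<Omega>" for f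
  proof -
    have "(\<Pi>\<^sub>E k\<in>{..<n}. {f k}) = {f}" using that by (intro PiE_singleton) (auto simp: PiE_def)
    then show ?thesis by (auto simp: prod_emb_def space_PiM)
  qed
  have fin: "finite ?A" using \<Omega> by (auto intro!: finite_PiE)
  have r: "restrict \<omega> {..<n} \<in> {..<n} \<rightarrow>\<^sub>E \<Omega>" if "\<omega> \<in> space ?P" for \<omega>
    using that by (auto simp: space_PiM spM)
  have "{\<omega> \<in> space ?P. Q (restrict \<omega> {..<n})} = (\<Union>f\<in>?A. ?E f)"
  proof (rule equalityI; rule subsetI)
    fix \<omega> assume w: "\<omega> \<in> {\<omega> \<in> space ?P. Q (restrict \<omega> {..<n})}"
    then have "restrict \<omega> {..<n} \<in> ?A" using r by blast
    moreover have "\<omega> \<in> ?E (restrict \<omega> {..<n})" using w r E by blast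
    ultimately show "\<omega> \<in> (\<Union>f\<in>?A. ?E f)" by blast
  next
    fix \<omega> assume "\<omega> \<in> (\<Union>f\<in>?A. ?E f)"
    then obtain f where f: "f \<in> ?A" "\<omega> \<in> ?E f" by (rule UN_E)
    have "\<omega> \<in> {\<omega> \<in> space ?P. restrict \<omega> {..<n} = f}" using f(2) E[of f] f(1) by simp
    then show "\<omega> \<in> {\<omega> \<in> space ?P. Q (restrict \<omega> {..<n})}" using f(1) by simp
  qed
  then have "measure ?P {\<omega> \<in> space ?P. Q (restrict \<omega> {..<n})} = measure ?P (\<Union>f\<in>?A. ?E f)" by simp
  also have "\<dots> = (\<Sum>f\<in>?A. measure ?P (?E f))"
  proof (rule P.finite_measure_finite_Union[OF fin])
    show "?E ` ?A \<subseteq> sets ?P"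
    proof
      fix S assume "S \<in> ?E ` ?A"
      then obtain f where f: "f \<in> ?A" "S = ?E f" by blast
      have "(\<Pi>\<^sub>E k\<in>{..<n}. {f k}) \<in> sets (\<Pi>\<^sub>M k\<in>{..<n}. M)"
        using f by (intro sets_PiM_I_finite) (auto simp: sM)
      then show "S \<in> sets ?P" unfolding f(2) by (intro sets_PiM_I) (use f in \<open>auto simp: sM\<close>)
    qed
    show "disjoint_family_on ?E ?A"
      unfolding disjoint_family_on_def
    proof (intro ballI impI)
      fix f g assume f: "f \<in> ?A" and g: "g \<in> ?A" and "f \<noteq> g"
      then show "?E f \<inter> ?E g = {}" using E[of f] E[of g] by auto
    qed
  qed
  also have "\<dots> = (\<Sum>f\<in>?A. \<Prod>k<n. p (f k))"
  proof (rule sum.cong[OF refl])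
    fix f assume f: "f \<in> ?A"
    then have fk: "f k \<in> \<Omega>" if "k < n" for k using that by auto
    have "measure ?P (?E f) = (\<Prod>k<n. measure M {f k})"
      using fk by (intro P.measure_PiM_emb) (auto simp: sM)
    also have "\<dots> = (\<Prod>k<n. p (f k))"
    proof (rule prod.cong[OF refl])
      fix k assume "k \<in> {..<n}"
      then have "f k \<in> \<Omega>" using fk by simp
      then show "measure M {f k} = p (f k)"
        using \<Omega> p by (simp add: M_def measure_def emeasure_point_measure_finite)
    qed
    finally show "measure ?P (?E f) = (\<Prod>k<n. p (f k))" .
  qed
  also have "\<dots> = (\<Sum>f\<in>{..<n} \<rightarrow>\<^sub>E \<Omega>. if Q f then \<Prod>k<n. p (f k) else 0)"
    using \<Omega> by (intro sum.inter_filter) (auto intro!: finite_PiE)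
  finally show ?thesis .
qed

text \<open>The coordinates of an infinite product of the weights form an i.i.d. sequence. The
  central limit theorem gives convergence at each fixed argument, and
  \<open>mono_tendsto_shift\<close> admits the moving one.\<close>

lemma clt_finite:
  fixes p X :: "'a \<Rightarrow> real" and c :: "nat \<Rightarrow> real"
  assumes \<Omega>: "finite \<Omega>" and p: "\<And>a. a \<in> \<Omega> \<Longrightarrow> 0 \<le> p a" and p1: "(\<Sum>a\<in>\<Omega>. p a) = 1"
    and mean: "(\<Sum>a\<in>\<Omega>. p a * X a) = m" and var: "(\<Sum>a\<in>\<Omega>. p a * (X a - m)\<^sup>2) = v" and v: "0 < v"
    and c: "c \<longlonglongrightarrow> r"
  shows "(\<lambda>n. \<Sum>f\<in>{..<n} \<rightarrow>\<^sub>E \<Omega>. if (\<Sum>k<n. X (f k)) \<le> real n * m + sqrt (real n) * c n then \<Prod>k<n. p (f k) else 0)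
    \<longlonglongrightarrow> std_normal_cdf (r / sqrt v)"
proof -
  define M where "M = point_measure \<Omega> (\<lambda>a. ennreal (p a))"
  have "(\<Sum>a\<in>\<Omega>. ennreal (p a)) = 1" using p p1 by (simp add: sum_ennreal)
  then have pM: "prob_space M" unfolding M_def using \<Omega> by (intro prob_space_point_measure) auto
  interpret M: prob_space M by (rule pM)
  interpret P: product_prob_space "\<lambda>_::nat. M" UNIV by unfold_locales
  let ?P = "\<Pi>\<^sub>M k\<in>(UNIV :: nat set). M"
  have spM: "space M = \<Omega>" by (simp add: M_def space_point_measure)
  have meas: "g \<in> borel_measurable M" for g :: "'a \<Rightarrow> real" by (simp add: M_def)
  have int: "(\<integral>a. g a \<partial>M) = (\<Sum>a\<in>\<Omega>. p a * g a)" for g :: "'a \<Rightarrow> real"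
    unfolding M_def using \<Omega> p by (simp add: lebesgue_integral_point_measure_finite)
  have intg: "integrable M g" for g :: "'a \<Rightarrow> real"
    unfolding M_def by (rule integrable_point_measure_finite[OF \<Omega>])
  have comp: "distr ?P M (\<lambda>\<omega>. \<omega> k) = M" for k by (rule P.PiM_component) simp
  have mc: "(\<lambda>\<omega>. \<omega> k) \<in> measurable ?P M" for k :: nat by (rule measurable_component_singleton) simp
  define Y where "Y k \<omega> = X (\<omega> k) - m" for k :: nat and \<omega> :: "nat \<Rightarrow> 'a"
  have dist: "distr ?P borel (Y k) = distr M borel (\<lambda>a. X a - m)" for k
  proof -
    have "distr M borel (\<lambda>a. X a - m) = distr (distr ?P M (\<lambda>\<omega>. \<omega> k)) borel (\<lambda>a. X a - m)" by (simp add: comp)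
    also have "\<dots> = distr ?P borel (Y k)"
      by (subst distr_distr[OF meas mc]) (simp add: Y_def[abs_def] o_def)
    finally show ?thesis by simp
  qed
  have exp: "P.expectation (\<lambda>\<omega>. g (\<omega> k)) = (\<Sum>a\<in>\<Omega>. p a * g a)" for g :: "'a \<Rightarrow> real" and k
    using integral_distr[OF mc[of k] meas[of g]] by (simp add: comp int)
  have int': "integrable ?P (\<lambda>\<omega>. g (\<omega> k))" for g :: "'a \<Rightarrow> real" and k
    using integrable_distr_eq[OF mc[of k] meas[of g]] by (simp add: comp intg)
  have "P.indep_vars (\<lambda>_. M) (\<lambda>k \<omega>. \<omega> k) UNIV"
  proof (subst P.indep_vars_iff_distr_eq_PiM)
    have "distr ?P ?P (\<lambda>\<omega>. \<lambda>k\<in>UNIV. \<omega> k) = distr ?P ?P (\<lambda>\<omega>. \<omega>)" by (rule distr_cong) auto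
    then show "distr ?P ?P (\<lambda>\<omega>. \<lambda>k\<in>UNIV. \<omega> k) = (\<Pi>\<^sub>M k\<in>UNIV. distr ?P M (\<lambda>\<omega>. \<omega> k))"
      by (simp add: comp)
  qed (auto intro: mc)
  then have indep: "P.indep_vars (\<lambda>_. borel) Y UNIV"
    unfolding Y_def by (rule P.indep_vars_compose2) (rule meas)
  have mean0: "P.expectation (Y k) = 0" for k
    using exp[of "\<lambda>a. X a - m" k] p1 mean by (simp add: Y_def[abs_def] right_diff_distrib sum_subtractf sum_distrib_right[symmetric])
  have var': "P.variance (Y k) = (sqrt v)\<^sup>2" for k
    using exp[of "\<lambda>a. (X a - m)\<^sup>2" k] v var mean0[of k] by (simp add: Y_def[abs_def])
  define G where "G n x = cdf (distr ?P borel (\<lambda>\<omega>. (\<Sum>k<n. Y k \<omega>) / sqrt (real n * (sqrt v)\<^sup>2))) x" for n x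
  have "weak_conv_m (\<lambda>n. distr ?P borel (\<lambda>\<omega>. (\<Sum>k<n. Y k \<omega>) / sqrt (real n * (sqrt v)\<^sup>2))) std_normal_distribution"
    by (rule P.central_limit_theorem_zero_mean[OF indep mean0 _ _ var' dist])
       (use v int'[of "\<lambda>a. (X a - m)\<^sup>2"] in \<open>auto simp: Y_def[abs_def]\<close>)
  then have Glim: "(\<lambda>n. G n x) \<longlonglongrightarrow> std_normal_cdf x" for x
  proof -
    have "cdf std_normal_distribution = std_normal_cdf" using cdf_std_normal by blast
    then show ?thesis
      using \<open>weak_conv_m _ _\<close> isCont_std_normal_cdf[of x] unfolding weak_conv_m_def weak_conv_def G_def by simp
  qed
  have Ym: "Y k \<in> borel_measurable ?P" for k
    using measurable_compose[OF mc[of k] meas[of "\<lambda>a. X a - m"]] by (simp add: Y_def[abs_def])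
  have Zm: "(\<lambda>\<omega>. (\<Sum>k<n. Y k \<omega>) / sqrt (real n * (sqrt v)\<^sup>2)) \<in> borel_measurable ?P" for n
    using Ym by measurable
  have Gmono: "mono (G n)" for n
  proof (rule monoI)
    interpret D: real_distribution "distr ?P borel (\<lambda>\<omega>. (\<Sum>k<n. Y k \<omega>) / sqrt (real n * (sqrt v)\<^sup>2))"
      by (rule P.real_distribution_distr[OF Zm])
    fix x y :: real assume "x \<le> y"
    then show "G n x \<le> G n y" unfolding G_def by (rule D.cdf_nondecreasing)
  qed
  have "(\<lambda>n. c n / sqrt v) \<longlonglongrightarrow> r / sqrt v" using c v by (intro tendsto_divide tendsto_const) auto
  then have lim: "(\<lambda>n. G n (c n / sqrt v)) \<longlonglongrightarrow> std_normal_cdf (r / sqrt v)"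
    by (rule mono_tendsto_shift[OF Gmono Glim isCont_std_normal_cdf])
  \<comment> \<open>At \<open>n = 0\<close> the normalised sum is 0 by the convention for division,
    and the two events may differ if \<open>c 0\<close> is negative; hence the restriction to
    positive \<open>n\<close>.\<close>
  have eq: "G n (c n / sqrt v) = (\<Sum>f\<in>{..<n} \<rightarrow>\<^sub>E \<Omega>. if (\<Sum>k<n. X (f k)) \<le> real n * m + sqrt (real n) * c n then \<Prod>k<n. p (f k) else 0)"
    if n: "0 < n" for n
  proof -
    have "G n (c n / sqrt v) = measure ?P {\<omega> \<in> space ?P. (\<Sum>k<n. Y k \<omega>) / sqrt (real n * (sqrt v)\<^sup>2) \<le> c n / sqrt v}"
      unfolding G_def cdf_def by (subst measure_distr[OF Zm]) (auto intro!: arg_cong[where f = "measure ?P"])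
    also have "\<dots> = measure ?P {\<omega> \<in> space ?P. (\<lambda>f. (\<Sum>k<n. X (f k)) \<le> real n * m + sqrt (real n) * c n) (restrict \<omega> {..<n})}"
    proof (intro arg_cong[where f = "measure ?P"] Collect_cong conj_cong refl)
      fix \<omega> :: "nat \<Rightarrow> 'a"
      have s: "0 < sqrt (real n)" "0 < sqrt v" using n v by auto
      have "sqrt (real n * (sqrt v)\<^sup>2) = sqrt (real n) * sqrt v" using v by (simp add: real_sqrt_mult)
      then have i: "(\<Sum>k<n. Y k \<omega>) / sqrt (real n * (sqrt v)\<^sup>2) \<le> c n / sqrt v \<longleftrightarrow> (\<Sum>k<n. Y k \<omega>) \<le> sqrt (real n) * c n"
        using s by (simp add: field_simps)
      have e: "(\<Sum>k<n. Y k \<omega>) = (\<Sum>k<n. X (restrict \<omega> {..<n} k)) - real n * m"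
        by (simp add: Y_def sum_subtractf)
      show "(\<Sum>k<n. Y k \<omega>) / sqrt (real n * (sqrt v)\<^sup>2) \<le> c n / sqrt v \<longleftrightarrow>
          (\<Sum>k<n. X (restrict \<omega> {..<n} k)) \<le> real n * m + sqrt (real n) * c n"
        by (subst i) (use e in linarith)
    qed
    also have "\<dots> = (\<Sum>f\<in>{..<n} \<rightarrow>\<^sub>E \<Omega>. if (\<Sum>k<n. X (f k)) \<le> real n * m + sqrt (real n) * c n then \<Prod>k<n. p (f k) else 0)"
      unfolding M_def by (rule measure_PiM_point_measure[OF \<Omega> p p1])
    finally show ?thesis .
  qed
  show ?thesis
    by (rule Lim_transform_eventually[OF lim]) (use eq in \<open>auto intro: eventually_mono[OF eventually_gt_at_top[of 0]]\<close>)
qed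

subsection \<open>Overlap weights\<close>


lemma overlap_col_sum:
  assumes U: "U \<in> carrier_mat N N" and Z: "Z \<in> carrier_mat N N" and j: "j < N"
  shows "complex_of_real (\<Sum>i<N. f i * (cmod ((cadj U * Z) $$ (i,j)))\<^sup>2) = (cadj Z * (U * rdiag N f * cadj U) * Z) $$ (j,j)"
proof -
  let ?C = "cadj U * Z"
  have c: "cadj U \<in> carrier_mat N N" "cadj Z \<in> carrier_mat N N" and C: "?C \<in> carrier_mat N N" using U Z by auto
  have "cadj Z * (U * rdiag N f * cadj U) * Z = cadj ?C * rdiag N f * ?C"
    using U Z c by (simp add: cadj_mult[OF c(1) Z] assoc_mult_mat[of _ N N _ N _ N] mult_carrier_mat[of _ N N _ N])
  also have "(cadj ?C * rdiag N f * ?C) $$ (j,j) = (\<Sum>i<N. cnj (?C $$ (i,j)) * complex_of_real (f i) * ?C $$ (i,j))"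
    unfolding conj_cdiag_entry[OF cadj_carrier[OF C] C j j] using j U Z
    by (intro sum.cong refl) simp
  also have "\<dots> = complex_of_real (\<Sum>i<N. f i * (cmod (?C $$ (i,j)))\<^sup>2)"
    by (simp only: of_real_sum of_real_mult complex_norm_square) (simp add: mult_ac)
  finally show ?thesis by simp
qed

text \<open>Summing overlap weights gives a marginal of the diagonal in the basis
  \<open>kron X Y\<close>, that is, the spectrum of the reduced operator when \<open>X\<close> is
  one of its eigenbases. It serves the single-copy weights and also the joint eigenbases with the
  universal operators.\<close>

lemma overlap_marginal_A:
  assumes U: "U \<in> carrier_mat (m * p) (m * p)" and X: "unitary m X" and Y: "unitary p Y"
    and e: "ptrB m p (U * rdiag (m * p) f * cadj U) = X * rdiag m g * cadj X" and k: "k < m"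
  shows "(\<Sum>t<p. \<Sum>i<m * p. f i * (cmod ((cadj U * kron X Y) $$ (i, k * p + t)))\<^sup>2) = g k"
proof -
  let ?R = "U * rdiag (m * p) f * cadj U"
  have Xc: "X \<in> carrier_mat m m" and K: "kron X Y \<in> carrier_mat (m * p) (m * p)" and R: "?R \<in> carrier_mat (m * p) (m * p)"
    and P: "ptrB m p ?R \<in> carrier_mat m m"
    using X Y U by (auto simp: unitary_def ptrB_def)
  have "complex_of_real (\<Sum>t<p. \<Sum>i<m * p. f i * (cmod ((cadj U * kron X Y) $$ (i, k * p + t)))\<^sup>2)
      = (\<Sum>t<p. (cadj (kron X Y) * ?R * kron X Y) $$ (k * p + t, k * p + t))"
    unfolding of_real_sum[of _ "{..<p}"]
    by (rule sum.cong[OF refl], rule overlap_col_sum[OF U K]) (use k in \<open>simp add: mult_add_less\<close>)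
  also have "\<dots> = (cadj X * ptrB m p ?R * X) $$ (k,k)" by (rule ptrB_marginal[OF R Xc Y k])
  also have "\<dots> = complex_of_real (g k)" unfolding conj_undo[OF X P cdiag_carrier e] using k by simp
  finally show ?thesis by (simp only: of_real_eq_iff)
qed

lemma overlap_marginal_B:
  assumes U: "U \<in> carrier_mat (m * p) (m * p)" and X: "unitary m X" and Y: "unitary p Y"
    and e: "ptrA m p (U * rdiag (m * p) f * cadj U) = Y * rdiag p g * cadj Y" and t: "t < p"
  shows "(\<Sum>k<m. \<Sum>i<m * p. f i * (cmod ((cadj U * kron X Y) $$ (i, k * p + t)))\<^sup>2) = g t"
proof -
  let ?R = "U * rdiag (m * p) f * cadj U"
  have Yc: "Y \<in> carrier_mat p p" and K: "kron X Y \<in> carrier_mat (m * p) (m * p)" and R: "?R \<in> carrier_mat (m * p) (m * p)"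
    and P: "ptrA m p ?R \<in> carrier_mat p p"
    using X Y U by (auto simp: unitary_def ptrA_def)
  have "complex_of_real (\<Sum>k<m. \<Sum>i<m * p. f i * (cmod ((cadj U * kron X Y) $$ (i, k * p + t)))\<^sup>2)
      = (\<Sum>k<m. (cadj (kron X Y) * ?R * kron X Y) $$ (k * p + t, k * p + t))"
    unfolding of_real_sum[of _ "{..<m}"]
    by (rule sum.cong[OF refl], rule overlap_col_sum[OF U K]) (use t in \<open>simp add: mult_add_less\<close>)
  also have "\<dots> = (cadj Y * ptrA m p ?R * Y) $$ (t,t)" by (rule ptrA_marginal[OF R X Yc t])
  also have "\<dots> = complex_of_real (g t)" unfolding conj_undo[OF Y P cdiag_carrier e] using t by simp
  finally show ?thesis by (simp only: of_real_eq_iff)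
qed

lemma overlap_row_sum:
  assumes U: "U \<in> carrier_mat N N" and Z: "Z \<in> carrier_mat N N" and i: "i < N"
  shows "complex_of_real (\<Sum>j<N. g j * (cmod ((cadj U * Z) $$ (i,j)))\<^sup>2) = (cadj U * (Z * rdiag N g * cadj Z) * U) $$ (i,i)"
proof -
  let ?C = "cadj U * Z"
  have c: "cadj U \<in> carrier_mat N N" "cadj Z \<in> carrier_mat N N" and C: "?C \<in> carrier_mat N N" using U Z by auto
  have "cadj U * (Z * rdiag N g * cadj Z) * U = ?C * rdiag N g * cadj ?C"
    using U Z c by (simp add: cadj_mult[OF c(1) Z] assoc_mult_mat[of _ N N _ N _ N] mult_carrier_mat[of _ N N _ N])
  also have "(?C * rdiag N g * cadj ?C) $$ (i,i) = (\<Sum>j<N. ?C $$ (i,j) * complex_of_real (g j) * cnj (?C $$ (i,j)))"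
    unfolding conj_cdiag_entry[OF C cadj_carrier[OF C] i i] using i U Z
    by (intro sum.cong refl) simp
  also have "\<dots> = complex_of_real (\<Sum>j<N. g j * (cmod (?C $$ (i,j)))\<^sup>2)"
    by (simp only: of_real_sum of_real_mult complex_norm_square) (simp add: mult_ac)
  finally show ?thesis by simp
qed

text \<open>Both sides are the same diagonal entry of \<open>g\<close> applied to the common
  operator, and that operator does not depend on the eigenbasis.\<close>

lemma overlap_basis_change:
  assumes U: "U \<in> carrier_mat N N" and Z: "unitary N Z" and V: "unitary N V"
    and e: "Z * rdiag N p * cadj Z = V * rdiag N q * cadj V" and i: "i < N"
  shows "(\<Sum>j<N. g (p j) * (cmod ((cadj U * Z) $$ (i,j)))\<^sup>2) = (\<Sum>j<N. g (q j) * (cmod ((cadj U * V) $$ (i,j)))\<^sup>2)"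
proof -
  have "Z * rdiag N (\<lambda>j. g (p j)) * cadj Z = V * rdiag N (\<lambda>j. g (q j)) * cadj V"
    using mat_fun_diag[OF Z e[symmetric], of g] mat_fun_diag[OF V refl, of g q] by simp
  then have "complex_of_real (\<Sum>j<N. g (p j) * (cmod ((cadj U * Z) $$ (i,j)))\<^sup>2)
      = complex_of_real (\<Sum>j<N. g (q j) * (cmod ((cadj U * V) $$ (i,j)))\<^sup>2)"
    unfolding overlap_row_sum[OF U unitary_carrier[OF Z] i] overlap_row_sum[OF U unitary_carrier[OF V] i] by simp
  then show ?thesis by (simp only: of_real_eq_iff)
qed

section \<open>Entropy and information variance in eigenbases\<close>

definition ln0 :: "real \<Rightarrow> real" where
  "ln0 x = (if x > 0 then ln x else 0)"

lemma mlog_conj: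
  assumes "unitary d U"
  shows "mlog (U * rdiag d f * cadj U) = U * rdiag d (\<lambda>i. ln0 (f i)) * cadj U"
  using mlog_diag[OF assms refl] by (simp add: ln0_def)

lemma vN_entropy_conj:
  assumes U: "unitary d U"
  shows "vN_entropy (U * rdiag d f * cadj U) = - (\<Sum>i<d. f i * ln0 (f i))"
proof -
  have "mtrace ((U * rdiag d f * cadj U) * (U * rdiag d (\<lambda>i. ln0 (f i)) * cadj U)) = mtrace (rdiag d f * rdiag d (\<lambda>i. ln0 (f i)))"
    unfolding conj_mult_conj[OF U cdiag_carrier cdiag_carrier] by (rule mtrace_conj[OF U]) auto
  also have "\<dots> = complex_of_real (\<Sum>i<d. f i * ln0 (f i))"
    by (simp add: cdiag_mult_cdiag mtrace_eq[OF cdiag_carrier])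
  finally show ?thesis by (simp add: vN_entropy_def mlog_conj[OF U])
qed

text \<open>Of the two noncommuting terms in \<open>L\<close>, one is diagonal seen from the left in
  the basis \<open>U\<close>, the other seen from the right in the basis \<open>V\<close>. So
  \<open>cadj U * L * V\<close> has entries \<open>x i - y j - c\<close> times the overlap, and the
  diagonal of \<open>L * L\<close> in the basis \<open>U\<close> consists of its squared row
  norms.\<close>

lemma mtrace_log_difference_square:
  fixes f x y :: "nat \<Rightarrow> real" and c :: real
  assumes U: "unitary d U" and V: "unitary d V"
  defines "L \<equiv> U * rdiag d x * cadj U - V * rdiag d y * cadj V - complex_of_real c \<cdot>\<^sub>m 1\<^sub>m d"
  shows "Re (mtrace ((U * rdiag d f * cadj U) * (L * L)))
    = (\<Sum>i<d. \<Sum>j<d. f i * (cmod ((cadj U * V) $$ (i,j)))\<^sup>2 * (x i - y j - c)\<^sup>2)"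
proof -
  have cU: "U \<in> carrier_mat d d" "cadj U \<in> carrier_mat d d" and cV: "V \<in> carrier_mat d d" "cadj V \<in> carrier_mat d d"
    and uu: "cadj U * U = 1\<^sub>m d" and vv: "cadj V * V = 1\<^sub>m d" "V * cadj V = 1\<^sub>m d"
    using U V by (auto simp: unitary_def)
  let ?A = "U * rdiag d x * cadj U" and ?B = "V * rdiag d y * cadj V" and ?I = "complex_of_real c \<cdot>\<^sub>m 1\<^sub>m d"
  have cA: "?A \<in> carrier_mat d d" "?B \<in> carrier_mat d d" "?I \<in> carrier_mat d d" using cU cV by auto
  have Lc: "L \<in> carrier_mat d d" unfolding L_def using cA by (simp add: minus_carrier_mat)
  have Lh: "cadj L = L"
    unfolding L_def using cA
    by (simp add: cadj_minus[of _ d d] minus_carrier_mat cadj_conj[OF cU(1)] cadj_conj[OF cV(1)] cadj_cdiag cadj_smult)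
  define C where "C = cadj U * V"
  have Cc: "C \<in> carrier_mat d d" using cU cV by (auto simp: C_def)
  define G where "G = cadj U * L * V"
  have Gc: "G \<in> carrier_mat d d" using cU cV Lc by (auto simp: G_def)
  have 1: "cadj U * ?A * V = rdiag d x * C"
  proof -
    have "cadj U * ?A = rdiag d x * cadj U"
      using cU uu by (simp add: assoc_mult_mat[of "cadj U" d d U d _ d, symmetric] assoc_mult_mat[of U d d _ d _ d] mult_carrier_mat[of _ d d _ d])
    then show ?thesis using cU cV by (simp add: C_def assoc_mult_mat[of _ d d _ d _ d])
  qed
  have 2: "cadj U * ?B * V = C * rdiag d y"
  proof -
    have "?B * V = V * rdiag d y"
      using cV vv by (simp add: assoc_mult_mat[of _ d d _ d _ d] mult_carrier_mat[of _ d d _ d])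
    then show ?thesis using cU cV cA by (simp add: C_def assoc_mult_mat[of _ d d _ d _ d])
  qed
  have 3: "cadj U * ?I * V = complex_of_real c \<cdot>\<^sub>m C"
    using cU cV by (simp add: C_def mult_smult_distrib[of _ d d _ d] mult_smult_assoc_mat[of _ d d _ d])
  have "G = rdiag d x * C - C * rdiag d y - complex_of_real c \<cdot>\<^sub>m C"
    unfolding G_def L_def 1[symmetric] 2[symmetric] 3[symmetric] using cU cV cA
    by (simp add: mult_minus_distrib_mat[of _ d d _ d] minus_mult_distrib_mat[of _ d d _ _ d] mult_carrier_mat[of _ d d _ d] minus_carrier_mat)
  then have Ge: "G $$ (i,j) = complex_of_real (x i - y j - c) * C $$ (i,j)" if "i < d" "j < d" for i j
    using that Cc by (simp add: cdiag_mult_left[OF Cc that] cdiag_mult_right[OF Cc that] algebra_simps)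
  have GG: "cadj U * (L * L) * U = G * cadj G"
  proof -
    have cG: "cadj G = cadj V * (L * U)"
      unfolding G_def using cU cV Lc Lh
      by (simp add: cadj_mult[of "cadj U * L" d d V d] cadj_mult[of "cadj U" d d L d] mult_carrier_mat[of _ d d _ d])
    have "G * cadj G = (cadj U * L * V) * (cadj V * (L * U))"
      unfolding cG by (simp only: G_def)
    also have "\<dots> = (cadj U * L) * (L * U)"
      using mult_cancel_mid[of "cadj U * L" d d V d "cadj V" "L * U" d] cU cV Lc vv by (simp add: mult_carrier_mat[of _ d d _ d])
    finally show ?thesis using cU Lc by (simp add: assoc_mult_mat[of _ d d _ d _ d] mult_carrier_mat[of _ d d _ d])
  qed
  have "(G * cadj G) $$ (i,i) = complex_of_real (\<Sum>j<d. (cmod (C $$ (i,j)))\<^sup>2 * (x i - y j - c)\<^sup>2)" if i: "i < d" for i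
  proof -
    have "(G * cadj G) $$ (i,i) = (\<Sum>j<d. G $$ (i,j) * cnj (G $$ (i,j)))"
      unfolding mult_mat_entry[OF Gc cadj_carrier[OF Gc] i i] using i Gc by (intro sum.cong refl) auto
    also have "\<dots> = (\<Sum>j<d. complex_of_real ((cmod (G $$ (i,j)))\<^sup>2))" by (simp only: complex_norm_square)
    also have "\<dots> = (\<Sum>j<d. complex_of_real ((cmod (C $$ (i,j)))\<^sup>2 * (x i - y j - c)\<^sup>2))"
    proof (rule sum.cong[OF refl])
      fix j assume "j \<in> {..<d}"
      then have "cmod (G $$ (i,j)) = \<bar>x i - y j - c\<bar> * cmod (C $$ (i,j))" using Ge[OF i] by (simp only: norm_mult norm_of_real lessThan_iff)
      then show "complex_of_real ((cmod (G $$ (i,j)))\<^sup>2) = complex_of_real ((cmod (C $$ (i,j)))\<^sup>2 * (x i - y j - c)\<^sup>2)"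
        by (simp only: power_mult_distrib power2_abs mult.commute)
    qed
    finally show ?thesis by (simp only: of_real_sum)
  qed
  then have "mtrace ((U * rdiag d f * cadj U) * (L * L))
      = (\<Sum>i<d. complex_of_real (f i) * complex_of_real (\<Sum>j<d. (cmod (C $$ (i,j)))\<^sup>2 * (x i - y j - c)\<^sup>2))"
    unfolding mtrace_diag_mult[OF U mult_carrier_mat[OF Lc Lc]] GG by simp
  then show ?thesis
    by (simp add: C_def[symmetric] sum_distrib_left mult.assoc flip: of_real_mult of_real_sum)
qed

lemma sum_PiE_times:
  "(\<Sum>f\<in>S \<rightarrow>\<^sub>E A. \<Sum>g\<in>S \<rightarrow>\<^sub>E B. H f g)
    = (\<Sum>h\<in>S \<rightarrow>\<^sub>E (A \<times> B). H (restrict (fst \<circ> h) S) (restrict (snd \<circ> h) S))"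
proof -
  have "(\<Sum>f\<in>S \<rightarrow>\<^sub>E A. \<Sum>g\<in>S \<rightarrow>\<^sub>E B. H f g) = (\<Sum>p\<in>(S \<rightarrow>\<^sub>E A) \<times> (S \<rightarrow>\<^sub>E B). H (fst p) (snd p))"
    by (simp add: sum.cartesian_product case_prod_unfold)
  also have "\<dots> = (\<Sum>h\<in>S \<rightarrow>\<^sub>E (A \<times> B). H (restrict (fst \<circ> h) S) (restrict (snd \<circ> h) S))"
  proof (rule sum.reindex_bij_witness[of _ "\<lambda>h. (restrict (fst \<circ> h) S, restrict (snd \<circ> h) S)" "\<lambda>p. restrict (\<lambda>k. (fst p k, snd p k)) S"])
    fix p assume p: "p \<in> (S \<rightarrow>\<^sub>E A) \<times> (S \<rightarrow>\<^sub>E B)"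
    have "restrict (fst \<circ> restrict (\<lambda>k. (fst p k, snd p k)) S) S = fst p"
      by (rule ext) (use p in \<open>auto simp: PiE_def extensional_def\<close>)
    moreover have "restrict (snd \<circ> restrict (\<lambda>k. (fst p k, snd p k)) S) S = snd p"
      by (rule ext) (use p in \<open>auto simp: PiE_def extensional_def\<close>)
    ultimately show "(restrict (fst \<circ> restrict (\<lambda>k. (fst p k, snd p k)) S) S, restrict (snd \<circ> restrict (\<lambda>k. (fst p k, snd p k)) S) S) = p"
      and "H (restrict (fst \<circ> restrict (\<lambda>k. (fst p k, snd p k)) S) S) (restrict (snd \<circ> restrict (\<lambda>k. (fst p k, snd p k)) S) S) = H (fst p) (snd p)"
      by simp_all
    show "restrict (\<lambda>k. (fst p k, snd p k)) S \<in> S \<rightarrow>\<^sub>E (A \<times> B)" using p by (auto simp: PiE_iff)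
  next
    fix h assume h: "h \<in> S \<rightarrow>\<^sub>E (A \<times> B)"
    show "(restrict (fst \<circ> h) S, restrict (snd \<circ> h) S) \<in> (S \<rightarrow>\<^sub>E A) \<times> (S \<rightarrow>\<^sub>E B)"
      using h by (force simp: PiE_iff)
    show "restrict (\<lambda>k. (fst (restrict (fst \<circ> h) S, restrict (snd \<circ> h) S) k, snd (restrict (fst \<circ> h) S, restrict (snd \<circ> h) S) k)) S = h"
      by (rule ext) (use h in \<open>auto simp: PiE_def extensional_def\<close>)
  qed
  finally show ?thesis .
qed

subsection \<open>The Nussbaum--Szkola weights of a bipartite state\<close>

text \<open>The eigendecompositions are fixed once, because with degenerate spectra the weights
  below depend on the chosen bases.\<close>

locale bipartite_state =
  fixes dA dB :: nat and \<rho> U VA VB :: "complex mat" and l a b :: "nat \<Rightarrow> real"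
  assumes dens: "density (dA * dB) \<rho>"
    and U: "unitary (dA * dB) U" and \<rho>_eq: "\<rho> = U * rdiag (dA * dB) l * cadj U"
    and l_nonneg: "\<And>i. i < dA * dB \<Longrightarrow> 0 \<le> l i"
    and VA: "unitary dA VA" and A_eq: "ptrB dA dB \<rho> = VA * rdiag dA a * cadj VA"
    and a_nonneg: "\<And>i. i < dA \<Longrightarrow> 0 \<le> a i"
    and VB: "unitary dB VB" and B_eq: "ptrA dA dB \<rho> = VB * rdiag dB b * cadj VB"
    and b_nonneg: "\<And>i. i < dB \<Longrightarrow> 0 \<le> b i"
begin

definition "d = dA * dB"
definition "V = kron VA VB"
definition "\<mu> j = a (j div dB) * b (j mod dB)"
text \<open>The first Nussbaum-Szkola distribution. The second one has \<open>\<mu> j\<close> in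
  place of \<open>l i\<close>, and \<open>llr\<close> is their log-likelihood ratio.\<close>

definition "ns i j = l i * (cmod ((cadj U * V) $$ (i,j)))\<^sup>2"
definition "llr i j = ln0 (l i) - ln0 (\<mu> j)"

lemma V: "unitary d V"
  unfolding d_def V_def by (rule unitary_kron[OF VA VB])

lemma carriers: "U \<in> carrier_mat d d" "V \<in> carrier_mat d d" "VA \<in> carrier_mat dA dA" "VB \<in> carrier_mat dB dB"
  "\<rho> \<in> carrier_mat d d" "ptrB dA dB \<rho> \<in> carrier_mat dA dA" "ptrA dA dB \<rho> \<in> carrier_mat dB dB"
  using U V VA VB dens by (auto simp: unitary_def d_def density_def ptrB_def ptrA_def dest: psd_carrier)

lemma \<mu>_nonneg: "j < d \<Longrightarrow> 0 \<le> \<mu> j"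
  unfolding \<mu>_def d_def by (intro mult_nonneg_nonneg a_nonneg b_nonneg div_mod_less)

lemma ns_nonneg: "i < d \<Longrightarrow> 0 \<le> ns i j"
  using l_nonneg by (simp add: ns_def d_def)

lemma kron_marginals: "kron (ptrB dA dB \<rho>) (ptrA dA dB \<rho>) = V * rdiag d \<mu> * cadj V"
  unfolding A_eq B_eq kron_conj[OF carriers(3) cdiag_carrier carriers(4) cdiag_carrier] kron_cdiag V_def d_def \<mu>_def
  by simp

lemma ns_row_sum: "i < d \<Longrightarrow> (\<Sum>j<d. ns i j) = l i"
proof -
  assume i: "i < d"
  have "complex_of_real (\<Sum>j<d. 1 * (cmod ((cadj U * V) $$ (i,j)))\<^sup>2) = (cadj U * (V * rdiag d (\<lambda>_. 1) * cadj V) * U) $$ (i,i)"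
    by (rule overlap_row_sum[OF carriers(1,2) i])
  also have "V * rdiag d (\<lambda>_. 1) * cadj V = 1\<^sub>m d"
    using V carriers(2) by (simp add: unitary_def one_eq_cdiag[symmetric])
  also have "(cadj U * 1\<^sub>m d * U) $$ (i,i) = 1"
  proof -
    have "cadj U * 1\<^sub>m d = cadj U" using carriers(1) by (intro right_mult_one_mat[of _ d]) auto
    then show ?thesis using U i by (simp add: unitary_def d_def)
  qed
  finally have "(\<Sum>j<d. (cmod ((cadj U * V) $$ (i,j)))\<^sup>2) = 1" by (simp add: of_real_eq_1_iff del: of_real_sum)
  then show ?thesis by (simp add: ns_def sum_distrib_left[symmetric])
qed

lemma ns_marginal_A: "k < dA \<Longrightarrow> (\<Sum>m<dB. \<Sum>i<d. ns i (k * dB + m)) = a k"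
  unfolding ns_def V_def d_def
  by (rule overlap_marginal_A[OF carriers(1)[unfolded d_def] VA VB A_eq[unfolded \<rho>_eq]])

lemma ns_marginal_B: "m < dB \<Longrightarrow> (\<Sum>k<dA. \<Sum>i<d. ns i (k * dB + m)) = b m"
  unfolding ns_def V_def d_def
  by (rule overlap_marginal_B[OF carriers(1)[unfolded d_def] VA VB B_eq[unfolded \<rho>_eq]])

lemma l_sum: "(\<Sum>i<d. l i) = 1"
proof -
  have "complex_of_real (\<Sum>i<d. l i) = mtrace (rdiag d l)" by (simp add: mtrace_eq[OF cdiag_carrier])
  also have "\<dots> = mtrace \<rho>" using mtrace_conj[OF U cdiag_carrier] by (simp add: \<rho>_eq d_def)
  also have "\<dots> = 1" using dens by (simp add: density_def)
  finally show ?thesis by (simp only: of_real_eq_1_iff)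
qed

lemma ns_sum: "(\<Sum>i<d. \<Sum>j<d. ns i j) = 1"
  by (simp add: ns_row_sum l_sum)

text \<open>A weight is at most each of the marginals to which it contributes. So where the weight
  is positive all eigenvalues involved are positive, and the value 0 assigned by \<open>ln0\<close>
  off the support does not enter.\<close>

lemma ns_pos:
  assumes i: "i < d" and j: "j < d" and p: "0 < ns i j"
  shows "0 < l i" "0 < a (j div dB)" "0 < b (j mod dB)" "0 < \<mu> j"
proof -
  show "0 < l i" using p l_nonneg[of i] i by (cases "l i = 0") (auto simp: ns_def d_def)
  note jj = div_mod_less[OF j[unfolded d_def]]
  have e: "j div dB * dB + j mod dB = j" by (rule div_mult_mod_eq)
  have less: "k * dB + m < d" if "k < dA" "m < dB" for k m using that by (simp add: d_def mult_add_less)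
  have "ns i (j div dB * dB + j mod dB) \<le> (\<Sum>i<d. ns i (j div dB * dB + j mod dB))"
    using i ns_nonneg by (intro member_le_sum) auto
  also have "\<dots> \<le> (\<Sum>m<dB. \<Sum>i<d. ns i (j div dB * dB + m))"
    using jj ns_nonneg by (intro member_le_sum[of "j mod dB" "{..<dB}" "\<lambda>m. \<Sum>i<d. ns i (j div dB * dB + m)"] sum_nonneg) auto
  finally show 1: "0 < a (j div dB)" using p ns_marginal_A[OF jj(1)] by (simp add: e)
  have "ns i (j div dB * dB + j mod dB) \<le> (\<Sum>i<d. ns i (j div dB * dB + j mod dB))"
    using i ns_nonneg by (intro member_le_sum) auto
  also have "\<dots> \<le> (\<Sum>k<dA. \<Sum>i<d. ns i (k * dB + j mod dB))"
    using jj ns_nonneg by (intro member_le_sum[of "j div dB" "{..<dA}" "\<lambda>k. \<Sum>i<d. ns i (k * dB + j mod dB)"] sum_nonneg) auto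
  finally show 2: "0 < b (j mod dB)" using p ns_marginal_B[OF jj(2)] by (simp add: e)
  show "0 < \<mu> j" using 1 2 by (simp add: \<mu>_def)
qed

text \<open>On the support of \<open>ns\<close> the ratio splits into three logarithms, and summing
  each against the matching marginal \<open>l\<close>, \<open>a\<close> or \<open>b\<close> gives
  minus an entropy.\<close>

lemma mutual_info_ns: "mutual_info dA dB \<rho> = (\<Sum>i<d. \<Sum>j<d. ns i j * llr i j)"
proof -
  have "(\<Sum>i<d. \<Sum>j<d. ns i j * llr i j) = (\<Sum>i<d. \<Sum>j<d. ns i j * ln0 (l i)
      - (ns i j * ln0 (a (j div dB)) + ns i j * ln0 (b (j mod dB))))"
  proof (rule sum.cong[OF refl], rule sum.cong[OF refl])
    fix i j assume "i \<in> {..<d}" "j \<in> {..<d}"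
    then have ij: "i < d" "j < d" by auto
    show "ns i j * llr i j = ns i j * ln0 (l i) - (ns i j * ln0 (a (j div dB)) + ns i j * ln0 (b (j mod dB)))"
    proof (cases "ns i j = 0")
      case False
      then have "0 < ns i j" using ns_nonneg[OF ij(1), of j] by simp
      from ns_pos[OF ij this] show ?thesis by (simp add: llr_def ln0_def \<mu>_def ln_mult algebra_simps)
    qed simp
  qed
  also have "\<dots> = (\<Sum>i<d. \<Sum>j<d. ns i j * ln0 (l i)) - ((\<Sum>i<d. \<Sum>j<d. ns i j * ln0 (a (j div dB)))
      + (\<Sum>i<d. \<Sum>j<d. ns i j * ln0 (b (j mod dB))))"
    by (simp only: sum_subtractf sum.distrib)
  also have "(\<Sum>i<d. \<Sum>j<d. ns i j * ln0 (l i)) = - vN_entropy \<rho>"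
    unfolding \<rho>_eq vN_entropy_conj[OF U] by (simp add: sum_distrib_right[symmetric] ns_row_sum d_def[symmetric])
  also have "(\<Sum>i<d. \<Sum>j<d. ns i j * ln0 (a (j div dB))) = - vN_entropy (ptrB dA dB \<rho>)"
  proof -
    have "(\<Sum>i<d. \<Sum>j<d. ns i j * ln0 (a (j div dB))) = (\<Sum>j<dA * dB. \<Sum>i<d. ns i j * ln0 (a (j div dB)))"
      unfolding d_def[symmetric] by (rule sum.swap)
    also have "\<dots> = (\<Sum>k<dA. \<Sum>m<dB. (\<Sum>i<d. ns i (k * dB + m)) * ln0 (a k))"
      unfolding sum_div_mod sum_distrib_right by (intro sum.cong refl) (simp add: mult_add_div_mod)
    also have "\<dots> = (\<Sum>k<dA. a k * ln0 (a k))"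
      by (rule sum.cong[OF refl]) (simp add: sum_distrib_right[symmetric] ns_marginal_A)
    finally show ?thesis unfolding A_eq vN_entropy_conj[OF VA] by simp
  qed
  also have "(\<Sum>i<d. \<Sum>j<d. ns i j * ln0 (b (j mod dB))) = - vN_entropy (ptrA dA dB \<rho>)"
  proof -
    have "(\<Sum>i<d. \<Sum>j<d. ns i j * ln0 (b (j mod dB))) = (\<Sum>j<dA * dB. \<Sum>i<d. ns i j * ln0 (b (j mod dB)))"
      unfolding d_def[symmetric] by (rule sum.swap)
    also have "\<dots> = (\<Sum>k<dA. \<Sum>m<dB. (\<Sum>i<d. ns i (k * dB + m)) * ln0 (b m))"
      unfolding sum_div_mod sum_distrib_right by (intro sum.cong refl) (simp add: mult_add_div_mod)
    also have "\<dots> = (\<Sum>m<dB. \<Sum>k<dA. (\<Sum>i<d. ns i (k * dB + m)) * ln0 (b m))"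
      by (rule sum.swap)
    also have "\<dots> = (\<Sum>m<dB. b m * ln0 (b m))"
      by (rule sum.cong[OF refl]) (simp add: sum_distrib_right[symmetric] ns_marginal_B)
    finally show ?thesis unfolding B_eq vN_entropy_conj[OF VB] by simp
  qed
  finally show ?thesis by (simp add: mutual_info_def)
qed

lemma mutual_info_var_ns:
  "mutual_info_var dA dB \<rho> = (\<Sum>i<d. \<Sum>j<d. ns i j * (llr i j - mutual_info dA dB \<rho>)\<^sup>2)"
proof -
  have m1: "mlog \<rho> = U * rdiag d (\<lambda>i. ln0 (l i)) * cadj U"
    using mlog_conj[OF U] by (simp add: \<rho>_eq d_def)
  have m2: "mlog (kron (ptrB dA dB \<rho>) (ptrA dA dB \<rho>)) = V * rdiag d (\<lambda>j. ln0 (\<mu> j)) * cadj V"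
    unfolding kron_marginals by (rule mlog_conj[OF V])
  have r: "\<rho> = U * rdiag d l * cadj U" using \<rho>_eq by (simp add: d_def)
  have "mutual_info_var dA dB \<rho> = (\<Sum>i<d. \<Sum>j<d. l i * (cmod ((cadj U * V) $$ (i,j)))\<^sup>2 * (ln0 (l i) - ln0 (\<mu> j) - mutual_info dA dB \<rho>)\<^sup>2)"
    unfolding mutual_info_var_def Let_def m1 m2 d_def[symmetric]
    using mtrace_log_difference_square[OF U[folded d_def] V, of l "\<lambda>i. ln0 (l i)" "\<lambda>j. ln0 (\<mu> j)" "mutual_info dA dB \<rho>"]
    by (simp only: r[symmetric])
  then show ?thesis by (simp add: ns_def llr_def)
qed

subsection \<open>Tensor powers of the state\<close>

abbreviation "dn n \<equiv> dA ^ n * dB ^ n"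
definition "Upow n = tensor_power (dn n) n (pair_digit dA dB n) U"
definition "Vpow n = tensor_power (dn n) n (pair_digit dA dB n) V"
definition "l_pow n I = (\<Prod>k<n. l (pair_digit dA dB n I k))"
definition "mu_pow n J = (\<Prod>k<n. \<mu> (pair_digit dA dB n J k))"
definition "ns_prod n I J = l_pow n I * (cmod ((cadj (Upow n) * Vpow n) $$ (I,J)))\<^sup>2"
text \<open>The distribution function at \<open>x\<close> of a sum of \<open>n\<close> independent
  copies of \<open>llr\<close> under \<open>ns\<close>.\<close>

definition "ns_cdf n x = (\<Sum>f\<in>{..<n} \<rightarrow>\<^sub>E ({..<d} \<times> {..<d}).
  if (\<Sum>k<n. case_prod llr (f k)) \<le> x then \<Prod>k<n. case_prod ns (f k) else 0)"

lemma word: "word_index (dn n) d n (pair_digit dA dB n)"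
  unfolding d_def by (rule word_index_pair_digit)

lemma Upow: "unitary (dn n) (Upow n)" and Vpow: "unitary (dn n) (Vpow n)"
  unfolding Upow_def Vpow_def by (rule unitary_tensor_power[OF word U[folded d_def]], rule unitary_tensor_power[OF word V])

lemma rho_pow_diag: "rho_pow dA dB n \<rho> = Upow n * rdiag (dn n) (l_pow n) * cadj (Upow n)"
  unfolding rho_pow_eq Upow_def l_pow_def \<rho>_eq d_def[symmetric]
  by (rule tensor_power_diag[OF word carriers(1)])

lemma marginals_pow_diag:
  "kron (tpow dA n (ptrB dA dB \<rho>)) (tpow dB n (ptrA dA dB \<rho>)) = Vpow n * rdiag (dn n) (mu_pow n) * cadj (Vpow n)"
  unfolding kron_tpow[OF carriers(6,7)] kron_marginals rho_pow_eq Vpow_def mu_pow_def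
  by (rule tensor_power_diag[OF word carriers(2)])

lemma l_pow_nonneg: "I < dn n \<Longrightarrow> 0 \<le> l_pow n I" and mu_pow_nonneg: "I < dn n \<Longrightarrow> 0 \<le> mu_pow n I"
  unfolding l_pow_def mu_pow_def using word_index_less[OF word]
  by (auto intro!: prod_nonneg l_nonneg \<mu>_nonneg simp: d_def)

lemma ns_prod_nonneg: "I < dn n \<Longrightarrow> 0 \<le> ns_prod n I J"
  by (simp add: ns_prod_def l_pow_nonneg)

lemma l_pow_sum: "(\<Sum>I<dn n. l_pow n I) = 1"
  unfolding l_pow_def sum_prod_word_index[OF word, of "\<lambda>_. l"] by (simp add: l_sum)

lemma psd_rho_pow: "psd (dn n) (rho_pow dA dB n \<rho>)"
  unfolding rho_pow_diag by (rule psd_conj_rdiag[OF unitary_carrier[OF Upow] l_pow_nonneg])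

lemma ns_prod_eq:
  assumes "I < dn n" "J < dn n"
  shows "ns_prod n I J = (\<Prod>k<n. ns (pair_digit dA dB n I k) (pair_digit dA dB n J k))"
proof -
  have c: "cadj U \<in> carrier_mat d d" using carriers(1) by auto
  have "cadj (Upow n) * Vpow n = tensor_power (dn n) n (pair_digit dA dB n) (cadj U * V)"
    unfolding Upow_def Vpow_def cadj_tensor_power[OF word carriers(1)] by (rule tensor_power_mult[OF word c carriers(2)])
  then show ?thesis
    using assms by (simp add: ns_prod_def l_pow_def ns_def tensor_power_entry prod.distrib prod_norm[symmetric] prod_power_distrib)
qed

text \<open>Overlaps of tensor-power bases factorise, and a pair of words is a word of pairs. Words
  of zero weight contribute nothing to either side; on the others, taking logarithms turns the
  comparison of products into one of sums.\<close>

lemma ns_cdf_eq: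
  assumes t: "0 < t"
  shows "ns_cdf n (ln t) = (\<Sum>I<dn n. \<Sum>J<dn n. if l_pow n I \<le> t * mu_pow n J then ns_prod n I J else 0)"
proof -
  let ?\<delta> = "pair_digit dA dB n" and ?S = "{..<n}"
  define H where "H f g = (if (\<Prod>k<n. l (f k)) \<le> t * (\<Prod>k<n. \<mu> (g k)) then \<Prod>k<n. ns (f k) (g k) else 0)" for f g :: "nat \<Rightarrow> nat"
  have Hr: "H (restrict f ?S) (restrict g ?S) = H f g" for f g
    unfolding H_def by (intro if_cong arg_cong2[where f = "(\<le>)"] arg_cong2[where f = "(*)"] prod.cong refl) auto
  have "(\<Sum>I<dn n. \<Sum>J<dn n. if l_pow n I \<le> t * mu_pow n J then ns_prod n I J else 0)
      = (\<Sum>I<dn n. \<Sum>J<dn n. H (restrict (?\<delta> I) ?S) (restrict (?\<delta> J) ?S))"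
    unfolding Hr by (intro sum.cong refl) (simp add: H_def l_pow_def mu_pow_def ns_prod_eq)
  also have "\<dots> = (\<Sum>f\<in>?S \<rightarrow>\<^sub>E {..<d}. \<Sum>g\<in>?S \<rightarrow>\<^sub>E {..<d}. H f g)"
    by (simp only: sum_word_index[OF word, of "\<lambda>g. H _ g"] sum_word_index[OF word, of "\<lambda>f. \<Sum>g\<in>?S \<rightarrow>\<^sub>E {..<d}. H f g"])
  also have "\<dots> = (\<Sum>h\<in>?S \<rightarrow>\<^sub>E ({..<d} \<times> {..<d}). H (fst \<circ> h) (snd \<circ> h))"
    unfolding sum_PiE_times Hr ..
  also have "\<dots> = ns_cdf n (ln t)"
    unfolding ns_cdf_def
  proof (rule sum.cong[OF refl])
    fix h assume h: "h \<in> ?S \<rightarrow>\<^sub>E ({..<d} \<times> {..<d})"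
    have hk: "fst (h k) < d" "snd (h k) < d" if "k < n" for k using h that by (auto dest!: PiE_mem[of _ _ _ k] simp: mem_Times_iff)
    show "H (fst \<circ> h) (snd \<circ> h) = (if (\<Sum>k<n. case_prod llr (h k)) \<le> ln t then \<Prod>k<n. case_prod ns (h k) else 0)"
    proof (cases "\<exists>k<n. ns (fst (h k)) (snd (h k)) = 0")
      case True
      then have "(\<Prod>k<n. ns (fst (h k)) (snd (h k))) = 0" by auto
      then show ?thesis by (simp add: H_def case_prod_unfold)
    next
      case False
      then have "0 < ns (fst (h k)) (snd (h k))" if "k < n" for k
        using ns_nonneg[OF hk(1)[OF that], of "snd (h k)"] that by force
      note pos = ns_pos[OF hk this]
      have L: "0 < (\<Prod>k<n. l (fst (h k)))" and M: "0 < (\<Prod>k<n. \<mu> (snd (h k)))" by (auto intro!: prod_pos pos)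
      have "(\<Sum>k<n. case_prod llr (h k)) = (\<Sum>k<n. ln (l (fst (h k))) - ln (\<mu> (snd (h k))))"
        by (rule sum.cong[OF refl]) (use pos in \<open>simp add: case_prod_unfold llr_def ln0_def\<close>)
      also have "\<dots> = ln (\<Prod>k<n. l (fst (h k))) - ln (\<Prod>k<n. \<mu> (snd (h k)))"
      proof -
        have "l (fst (h k)) \<noteq> 0" "\<mu> (snd (h k)) \<noteq> 0" if "k < n" for k using pos(1,4)[of k] that by auto
        then show ?thesis unfolding sum_subtractf by (subst (1 2) ln_prod) auto
      qed
      finally have s: "(\<Sum>k<n. case_prod llr (h k)) = ln (\<Prod>k<n. l (fst (h k))) - ln (\<Prod>k<n. \<mu> (snd (h k)))" .
      have "(\<Prod>k<n. l (fst (h k))) \<le> t * (\<Prod>k<n. \<mu> (snd (h k))) \<longleftrightarrow> ln (\<Prod>k<n. l (fst (h k))) \<le> ln (t * (\<Prod>k<n. \<mu> (snd (h k))))"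
        using L M t by (subst ln_le_cancel_iff) auto
      also have "ln (t * (\<Prod>k<n. \<mu> (snd (h k)))) = ln t + ln (\<Prod>k<n. \<mu> (snd (h k)))"
        by (rule ln_mult_pos[OF t M])
      finally show ?thesis unfolding s H_def by (simp add: case_prod_unfold le_diff_eq diff_le_eq)
    qed
  qed
  finally show ?thesis by simp
qed

lemma ns_cdf_limit:
  assumes v: "mutual_info_var dA dB \<rho> \<noteq> 0" and c: "c \<longlonglongrightarrow> r"
  shows "(\<lambda>n. ns_cdf n (real n * mutual_info dA dB \<rho> + sqrt (real n) * c n))
    \<longlonglongrightarrow> std_normal_cdf (r / sqrt (mutual_info_var dA dB \<rho>))"
  unfolding ns_cdf_def
proof (rule clt_finite[OF _ _ _ _ _ _ c])
  let ?\<Omega> = "{..<d} \<times> {..<d}"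
  show "finite ?\<Omega>" by simp
  show "0 \<le> case_prod ns p" if "p \<in> ?\<Omega>" for p using that ns_nonneg by auto
  show "(\<Sum>p\<in>?\<Omega>. case_prod ns p) = 1" using ns_sum by (simp add: sum.cartesian_product)
  show "(\<Sum>p\<in>?\<Omega>. case_prod ns p * case_prod llr p) = mutual_info dA dB \<rho>"
    unfolding mutual_info_ns by (simp add: sum.cartesian_product case_prod_unfold)
  show "(\<Sum>p\<in>?\<Omega>. case_prod ns p * (case_prod llr p - mutual_info dA dB \<rho>)\<^sup>2) = mutual_info_var dA dB \<rho>"
    unfolding mutual_info_var_ns by (simp add: sum.cartesian_product case_prod_unfold)
  have "0 \<le> mutual_info_var dA dB \<rho>"
    unfolding mutual_info_var_ns by (intro sum_nonneg mult_nonneg_nonneg ns_nonneg) auto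
  with v show "0 < mutual_info_var dA dB \<rho>" by simp
qed

lemma converse_bound:
  assumes T: "is_test (dn n) T" and \<delta>: "0 < \<delta>" and \<theta>: "0 < \<theta>"
    and \<beta>: "Re (mtrace (kron (tpow dA n (ptrB dA dB \<rho>)) (tpow dB n (ptrA dA dB \<rho>)) * T)) \<le> \<beta>"
  shows "ns_cdf n (ln (\<delta> * \<theta>)) / (1 + \<delta>) - \<theta> * \<beta> \<le> Re (mtrace (rho_pow dA dB n \<rho> * (1\<^sub>m (dn n) - T)))"
proof -
  have "ns_cdf n (ln (\<delta> * \<theta>)) / (1 + \<delta>) \<le> Re (mtrace (rho_pow dA dB n \<rho> * (1\<^sub>m (dn n) - T)))
      + \<theta> * Re (mtrace (kron (tpow dA n (ptrB dA dB \<rho>)) (tpow dB n (ptrA dA dB \<rho>)) * T))"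
    using test_converse[where f = "l_pow n" and g = "mu_pow n", OF Upow Vpow l_pow_nonneg mu_pow_nonneg T \<delta> \<theta>]
    unfolding ns_cdf_eq[OF mult_pos_pos[OF \<delta> \<theta>]] ns_prod_def rho_pow_diag marginals_pow_diag .
  moreover have "\<theta> * Re (mtrace (kron (tpow dA n (ptrB dA dB \<rho>)) (tpow dB n (ptrA dA dB \<rho>)) * T)) \<le> \<theta> * \<beta>"
    using \<beta> \<theta> by (intro mult_left_mono) auto
  ultimately show ?thesis by linarith
qed

text \<open>Both marginals of the overlap weights in a joint eigenbasis are the spectra of \<open>\<rho>\<^sub>A\<^sup>\<otimes>\<^sup>n\<close> and
  \<open>\<rho>\<^sub>B\<^sup>\<otimes>\<^sup>n\<close>. As the universal operators have polynomial trace, Markov's inequality shows that their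
  eigenvalues exceed those spectra by more than a polynomial factor only with small weight.\<close>

lemma achievability_bound:
  assumes \<theta>: "0 < \<theta>" and K: "0 < K"
  shows "\<exists>T. is_test (dn n) T \<and>
    (\<forall>\<sigma>\<in>sym_states dA n. \<forall>\<tau>\<in>sym_states dB n. Re (mtrace (kron \<sigma> \<tau> * T)) \<le> 1 / \<theta>) \<and>
    Re (mtrace (rho_pow dA dB n \<rho> * (1\<^sub>m (dn n) - T)))
      \<le> ns_cdf n (ln (\<theta> * K\<^sup>2)) + (real ((n + 1) ^ (dA * dA)) + real ((n + 1) ^ (dB * dB))) / K"
proof -
  let ?NA = "dA ^ n" and ?NB = "dB ^ n"
  have a0: "\<forall>i<dA. 0 \<le> a i" and b0: "\<forall>i<dB. 0 \<le> b i" using a_nonneg b_nonneg by auto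
  obtain WA ZA wA pA where WA: "psd ?NA WA" "\<forall>\<sigma>\<in>sym_states dA n. psd ?NA (WA - \<sigma>)" "unitary ?NA ZA"
    "WA = ZA * rdiag ?NA wA * cadj ZA" "tpow dA n (ptrB dA dB \<rho>) = ZA * rdiag ?NA pA * cadj ZA"
    "\<forall>i<?NA. 0 \<le> wA i" "\<forall>i<?NA. 0 \<le> pA i" "(\<Sum>i<?NA. wA i) \<le> real ((n + 1) ^ (dA * dA))"
    using universal_operator[where n = n and q = a, OF VA a0, folded A_eq] by (elim exE conjE) (rule that)
  obtain WB ZB wB pB where WB: "psd ?NB WB" "\<forall>\<sigma>\<in>sym_states dB n. psd ?NB (WB - \<sigma>)" "unitary ?NB ZB"
    "WB = ZB * rdiag ?NB wB * cadj ZB" "tpow dB n (ptrA dA dB \<rho>) = ZB * rdiag ?NB pB * cadj ZB"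
    "\<forall>i<?NB. 0 \<le> wB i" "\<forall>i<?NB. 0 \<le> pB i" "(\<Sum>i<?NB. wB i) \<le> real ((n + 1) ^ (dB * dB))"
    using universal_operator[where n = n and q = b, OF VB b0, folded B_eq] by (elim exE conjE) (rule that)
  have ZAc: "ZA \<in> carrier_mat ?NA ?NA" and ZBc: "ZB \<in> carrier_mat ?NB ?NB"
    using WA(3) WB(3) by (auto dest: unitary_carrier)
  define Z where "Z = kron ZA ZB"
  define w where "w j = wA (j div ?NB) * wB (j mod ?NB)" for j
  define p where "p j = pA (j div ?NB) * pB (j mod ?NB)" for j
  have Z: "unitary (dn n) Z" unfolding Z_def by (rule unitary_kron[OF WA(3) WB(3)])
  have Uc: "Upow n \<in> carrier_mat (dn n) (dn n)" by (rule unitary_carrier[OF Upow])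
  have Wk: "kron WA WB = Z * rdiag (dn n) w * cadj Z"
    unfolding WA(4) WB(4) kron_conj[OF ZAc cdiag_carrier ZBc cdiag_carrier] kron_cdiag Z_def w_def by simp
  have Pk: "kron (tpow dA n (ptrB dA dB \<rho>)) (tpow dB n (ptrA dA dB \<rho>)) = Z * rdiag (dn n) p * cadj Z"
    unfolding WA(5) WB(5) kron_conj[OF ZAc cdiag_carrier ZBc cdiag_carrier] kron_cdiag Z_def p_def by simp
  obtain T where T: "is_test (dn n) T" "Re (mtrace (Z * rdiag (dn n) w * cadj Z * T)) \<le> 1 / \<theta>"
    "Re (mtrace (Upow n * rdiag (dn n) (l_pow n) * cadj (Upow n) * (1\<^sub>m (dn n) - T))) \<le>
      (\<Sum>i<dn n. \<Sum>j<dn n. if l_pow n i < \<theta> * w j then l_pow n i * (cmod ((cadj (Upow n) * Z) $$ (i,j)))\<^sup>2 else 0)"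
    using test_achievability[where f = "l_pow n" and w = w, OF Upow Z l_pow_nonneg _ \<theta>] l_pow_sum by auto
  \<comment> \<open>The overlap weights of \<open>rho_pow\<close> in the joint eigenbasis
    \<open>Z\<close>, where the universal product has eigenvalues \<open>w\<close> and the product
    of the marginals has eigenvalues \<open>p\<close>.\<close>
  define q where "q i j = l_pow n i * (cmod ((cadj (Upow n) * Z) $$ (i,j)))\<^sup>2" for i j
  have q0: "0 \<le> q i j" if "i < dn n" for i j using l_pow_nonneg[OF that] by (simp add: q_def)
  have qA: "(\<Sum>m<?NB. \<Sum>i<dn n. q i (k * ?NB + m)) = pA k" if "k < ?NA" for k
    unfolding q_def Z_def
    by (rule overlap_marginal_A[OF Uc WA(3) WB(3) _ that]) (simp add: rho_pow_diag[symmetric] ptrB_rho_pow WA(5))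
  have qB: "(\<Sum>k<?NA. \<Sum>i<dn n. q i (k * ?NB + m)) = pB m" if "m < ?NB" for m
    unfolding q_def Z_def
    by (rule overlap_marginal_B[OF Uc WA(3) WB(3) _ that]) (simp add: rho_pow_diag[symmetric] ptrA_rho_pow WB(5))
  \<comment> \<open>Where \<open>K * u k < x k\<close>, the weight \<open>u k\<close> is below
    \<open>x k / K\<close>.\<close>
  have markov: "(\<Sum>k<m. if K * u k < x k then u k else 0) \<le> (\<Sum>k<m. x k) / K" if "\<forall>k<m. 0 \<le> x k" for u x :: "nat \<Rightarrow> real" and m
    unfolding sum_divide_distrib by (rule sum_mono) (use that K in \<open>auto simp: field_simps\<close>)
  have tailA: "(\<Sum>i<dn n. \<Sum>j<dn n. if K * pA (j div ?NB) < wA (j div ?NB) then q i j else 0) \<le> real ((n + 1) ^ (dA * dA)) / K"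
  proof -
    have "(\<Sum>i<dn n. \<Sum>j<dn n. if K * pA (j div ?NB) < wA (j div ?NB) then q i j else 0)
        = (\<Sum>j<?NA * ?NB. if K * pA (j div ?NB) < wA (j div ?NB) then \<Sum>i<dn n. q i j else 0)"
      by (subst sum.swap) (auto intro!: sum.cong)
    also have "\<dots> = (\<Sum>k<?NA. \<Sum>m<?NB. if K * pA k < wA k then \<Sum>i<dn n. q i (k * ?NB + m) else 0)"
      unfolding sum_div_mod by (rule sum.cong[OF refl], rule sum.cong[OF refl]) (simp add: mult_add_div_mod)
    also have "\<dots> = (\<Sum>k<?NA. if K * pA k < wA k then pA k else 0)"
      by (rule sum.cong[OF refl]) (auto simp: qA)
    also have "\<dots> \<le> (\<Sum>k<?NA. wA k) / K" by (rule markov[OF WA(6)])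
    also have "\<dots> \<le> real ((n + 1) ^ (dA * dA)) / K" using WA(8) K by (intro divide_right_mono) auto
    finally show ?thesis .
  qed
  have tailB: "(\<Sum>i<dn n. \<Sum>j<dn n. if K * pB (j mod ?NB) < wB (j mod ?NB) then q i j else 0) \<le> real ((n + 1) ^ (dB * dB)) / K"
  proof -
    have "(\<Sum>i<dn n. \<Sum>j<dn n. if K * pB (j mod ?NB) < wB (j mod ?NB) then q i j else 0)
        = (\<Sum>j<?NA * ?NB. if K * pB (j mod ?NB) < wB (j mod ?NB) then \<Sum>i<dn n. q i j else 0)"
      by (subst sum.swap) (auto intro!: sum.cong)
    also have "\<dots> = (\<Sum>k<?NA. \<Sum>m<?NB. if K * pB m < wB m then \<Sum>i<dn n. q i (k * ?NB + m) else 0)"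
      unfolding sum_div_mod by (rule sum.cong[OF refl], rule sum.cong[OF refl]) (simp add: mult_add_div_mod)
    also have "\<dots> = (\<Sum>m<?NB. \<Sum>k<?NA. if K * pB m < wB m then \<Sum>i<dn n. q i (k * ?NB + m) else 0)"
      by (rule sum.swap)
    also have "\<dots> = (\<Sum>m<?NB. if K * pB m < wB m then pB m else 0)"
      by (rule sum.cong[OF refl]) (auto simp: qB)
    also have "\<dots> \<le> (\<Sum>m<?NB. wB m) / K" by (rule markov[OF WB(6)])
    also have "\<dots> \<le> real ((n + 1) ^ (dB * dB)) / K" using WB(8) K by (intro divide_right_mono) auto
    finally show ?thesis .
  qed
  \<comment> \<open>Here the threshold involves \<open>p\<close> only. For fixed \<open>i\<close> it
    is a function of the eigenvalues of the product marginals, so \<open>Z\<close> can be exchanged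
    for the product eigenbasis \<open>Vpow\<close>.\<close>
  have main: "(\<Sum>i<dn n. \<Sum>j<dn n. if l_pow n i < \<theta> * K\<^sup>2 * p j then q i j else 0) \<le> ns_cdf n (ln (\<theta> * K\<^sup>2))"
  proof -
    have t: "0 < \<theta> * K\<^sup>2" using \<theta> K by simp
    have e: "Z * rdiag (dn n) p * cadj Z = Vpow n * rdiag (dn n) (mu_pow n) * cadj (Vpow n)"
      using Pk marginals_pow_diag by simp
    have "(\<Sum>i<dn n. \<Sum>j<dn n. if l_pow n i < \<theta> * K\<^sup>2 * p j then q i j else 0)
        = (\<Sum>i<dn n. \<Sum>j<dn n. if l_pow n i < \<theta> * K\<^sup>2 * mu_pow n j then ns_prod n i j else 0)"
    proof (rule sum.cong[OF refl])
      fix i assume "i \<in> {..<dn n}"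
      then have i: "i < dn n" by simp
      let ?g = "\<lambda>x. if l_pow n i < \<theta> * K\<^sup>2 * x then l_pow n i else 0"
      have "(\<Sum>j<dn n. if l_pow n i < \<theta> * K\<^sup>2 * p j then q i j else 0) = (\<Sum>j<dn n. ?g (p j) * (cmod ((cadj (Upow n) * Z) $$ (i,j)))\<^sup>2)"
        by (rule sum.cong[OF refl]) (simp add: q_def)
      also have "\<dots> = (\<Sum>j<dn n. ?g (mu_pow n j) * (cmod ((cadj (Upow n) * Vpow n) $$ (i,j)))\<^sup>2)"
        by (rule overlap_basis_change[OF Uc Z Vpow e i])
      also have "\<dots> = (\<Sum>j<dn n. if l_pow n i < \<theta> * K\<^sup>2 * mu_pow n j then ns_prod n i j else 0)"
        by (rule sum.cong[OF refl]) (simp add: ns_prod_def)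
      finally show "(\<Sum>j<dn n. if l_pow n i < \<theta> * K\<^sup>2 * p j then q i j else 0)
        = (\<Sum>j<dn n. if l_pow n i < \<theta> * K\<^sup>2 * mu_pow n j then ns_prod n i j else 0)" .
    qed
    also have "\<dots> \<le> ns_cdf n (ln (\<theta> * K\<^sup>2))"
      unfolding ns_cdf_eq[OF t] by (rule sum_mono, rule sum_mono) (auto simp: ns_prod_nonneg)
    finally show ?thesis .
  qed
  have "Re (mtrace (rho_pow dA dB n \<rho> * (1\<^sub>m (dn n) - T))) \<le> (\<Sum>i<dn n. \<Sum>j<dn n. if l_pow n i < \<theta> * w j then q i j else 0)"
    using T(3) unfolding rho_pow_diag q_def .
  also have "\<dots> \<le> (\<Sum>i<dn n. \<Sum>j<dn n. (if l_pow n i < \<theta> * K\<^sup>2 * p j then q i j else 0)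
      + (if K * pA (j div ?NB) < wA (j div ?NB) then q i j else 0) + (if K * pB (j mod ?NB) < wB (j mod ?NB) then q i j else 0))"
  proof (rule sum_mono, rule sum_mono)
    fix i j assume "i \<in> {..<dn n}" "j \<in> {..<dn n}"
    then have i: "i < dn n" and j: "j < dn n" by auto
    note jj = div_mod_less[OF j]
    \<comment> \<open>Outside both tails each party loses one factor \<open>K\<close>, which gives
      \<open>K\<^sup>2\<close>.\<close>
    have "\<theta> * w j \<le> \<theta> * K\<^sup>2 * p j" if "wA (j div ?NB) \<le> K * pA (j div ?NB)" "wB (j mod ?NB) \<le> K * pB (j mod ?NB)"
    proof -
      have "w j \<le> (K * pA (j div ?NB)) * (K * pB (j mod ?NB))"
        unfolding w_def using that WA(6,7) WB(6,7) jj K by (intro mult_mono) auto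
      then have "\<theta> * w j \<le> \<theta> * ((K * pA (j div ?NB)) * (K * pB (j mod ?NB)))" using \<theta> by (intro mult_left_mono) auto
      then show ?thesis by (simp add: p_def power2_eq_square mult_ac)
    qed
    then show "(if l_pow n i < \<theta> * w j then q i j else 0) \<le> (if l_pow n i < \<theta> * K\<^sup>2 * p j then q i j else 0)
      + (if K * pA (j div ?NB) < wA (j div ?NB) then q i j else 0) + (if K * pB (j mod ?NB) < wB (j mod ?NB) then q i j else 0)"
      using q0[OF i, of j] by (auto simp: not_less)
  qed
  also have "\<dots> \<le> ns_cdf n (ln (\<theta> * K\<^sup>2)) + (real ((n + 1) ^ (dA * dA)) + real ((n + 1) ^ (dB * dB))) / K"
    using main tailA tailB by (simp only: sum.distrib add_divide_distrib)
  finally have bound: "Re (mtrace (rho_pow dA dB n \<rho> * (1\<^sub>m (dn n) - T)))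
      \<le> ns_cdf n (ln (\<theta> * K\<^sup>2)) + (real ((n + 1) ^ (dA * dA)) + real ((n + 1) ^ (dB * dB))) / K" .
  have "Re (mtrace (kron \<sigma> \<tau> * T)) \<le> 1 / \<theta>" if s: "\<sigma> \<in> sym_states dA n" and t: "\<tau> \<in> sym_states dB n" for \<sigma> \<tau>
  proof -
    have "Re (mtrace (kron \<sigma> \<tau> * T)) \<le> Re (mtrace (kron WA WB * T))"
    proof (rule mtrace_kron_mono)
      show "psd ?NA \<sigma>" "psd ?NB \<tau>" using s t by (auto simp: sym_states_def density_def)
      show "psd ?NA (WA - \<sigma>)" "psd ?NB (WB - \<tau>)" using WA(2) WB(2) s t by auto
      show "psd ?NA WA" "psd ?NB WB" by (rule WA(1), rule WB(1))
      show "psd (dn n) T" using T(1) by (simp add: is_test_def)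
    qed
    also have "\<dots> \<le> 1 / \<theta>" using T(2) by (simp add: Wk)
    finally show ?thesis .
  qed
  with T(1) bound show ?thesis by blast
qed

section \<open>The two optimal errors and their common limit\<close>

definition "sym_errors n x = {Re (mtrace (rho_pow dA dB n \<rho> * (1\<^sub>m (dn n) - T))) | T. is_test (dn n) T \<and>
  (\<forall>\<sigma>\<in>sym_states dA n. \<forall>\<tau>\<in>sym_states dB n. Re (mtrace (kron \<sigma> \<tau> * T)) \<le> x)}"

definition "iid_errors n x = {Re (mtrace (rho_pow dA dB n \<rho> * (1\<^sub>m (dn n) - T))) | T. is_test (dn n) T \<and>
  (\<forall>\<sigma> \<tau>. density dA \<sigma> \<longrightarrow> density dB \<tau> \<longrightarrow> Re (mtrace (kron (tpow dA n \<sigma>) (tpow dB n \<tau>) * T)) \<le> x)}"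

text \<open>Tensor powers of states are symmetric states, so the constraint with symmetric
  competitors admits fewer tests.\<close>

lemma sym_errors_subset: "sym_errors n x \<subseteq> iid_errors n x"
proof
  fix y assume "y \<in> sym_errors n x"
  then obtain T where "y = Re (mtrace (rho_pow dA dB n \<rho> * (1\<^sub>m (dn n) - T)))" "is_test (dn n) T"
    "\<forall>\<sigma>\<in>sym_states dA n. \<forall>\<tau>\<in>sym_states dB n. Re (mtrace (kron \<sigma> \<tau> * T)) \<le> x"
    unfolding sym_errors_def by blast
  then show "y \<in> iid_errors n x" unfolding iid_errors_def using tpow_sym_state by blast
qed

lemma bdd_below_iid_errors: "bdd_below (iid_errors n x)"
proof (rule bdd_belowI)
  fix y assume "y \<in> iid_errors n x"
  then show "0 \<le> y" unfolding iid_errors_def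
    by (auto simp: is_test_def intro!: mtrace_psd_mult_nonneg[OF psd_rho_pow])
qed

text \<open>Nonemptiness is recorded alongside the bound, since comparisons and lower bounds of
  infima require it.\<close>

lemma alpha_hat_le:
  assumes "0 < \<theta>" "0 < K"
  shows "sym_errors n (1 / \<theta>) \<noteq> {}"
    "alpha_hat dA dB n \<rho> (1 / \<theta>) \<le> ns_cdf n (ln (\<theta> * K\<^sup>2)) + (real ((n + 1) ^ (dA * dA)) + real ((n + 1) ^ (dB * dB))) / K"
proof -
  obtain T where T: "is_test (dn n) T"
    "\<forall>\<sigma>\<in>sym_states dA n. \<forall>\<tau>\<in>sym_states dB n. Re (mtrace (kron \<sigma> \<tau> * T)) \<le> 1 / \<theta>"
    and b: "Re (mtrace (rho_pow dA dB n \<rho> * (1\<^sub>m (dn n) - T)))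
      \<le> ns_cdf n (ln (\<theta> * K\<^sup>2)) + (real ((n + 1) ^ (dA * dA)) + real ((n + 1) ^ (dB * dB))) / K"
    using achievability_bound[OF assms, of n] by blast
  from T have m: "Re (mtrace (rho_pow dA dB n \<rho> * (1\<^sub>m (dn n) - T))) \<in> sym_errors n (1 / \<theta>)"
    unfolding sym_errors_def by blast
  then show "sym_errors n (1 / \<theta>) \<noteq> {}" by blast
  have "bdd_below (sym_errors n (1 / \<theta>))"
    by (rule bdd_below_mono[OF bdd_below_iid_errors sym_errors_subset])
  then have "Inf (sym_errors n (1 / \<theta>)) \<le> Re (mtrace (rho_pow dA dB n \<rho> * (1\<^sub>m (dn n) - T)))"
    by (rule cInf_lower[OF m])
  with b show "alpha_hat dA dB n \<rho> (1 / \<theta>) \<le> ns_cdf n (ln (\<theta> * K\<^sup>2)) + (real ((n + 1) ^ (dA * dA)) + real ((n + 1) ^ (dB * dB))) / K"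
    unfolding alpha_hat_def sym_errors_def by linarith
qed

lemma alpha_hat_iid_le: "0 < \<theta> \<Longrightarrow> alpha_hat_iid dA dB n \<rho> (1 / \<theta>) \<le> alpha_hat dA dB n \<rho> (1 / \<theta>)"
  using cInf_superset_mono[OF alpha_hat_le(1)[of \<theta> 1 n] bdd_below_iid_errors sym_errors_subset]
  unfolding alpha_hat_def alpha_hat_iid_def sym_errors_def iid_errors_def by simp

text \<open>\<open>converse_bound\<close> is used with \<open>\<delta> * \<theta>\<close> in place
  of \<theta>: the second error, at most 1 / \<theta>, then costs \<delta>, and the threshold
  becomes \<open>\<delta>\<^sup>2 * \<theta>\<close>. The marginals are states and hence admissible
  competitors.\<close>

lemma alpha_hat_iid_ge:
  assumes \<theta>: "0 < \<theta>" and \<delta>: "0 < \<delta>"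
  shows "ns_cdf n (ln (\<delta>\<^sup>2 * \<theta>)) / (1 + \<delta>) - \<delta> \<le> alpha_hat_iid dA dB n \<rho> (1 / \<theta>)"
proof -
  have "iid_errors n (1 / \<theta>) \<noteq> {}" using alpha_hat_le(1)[of \<theta> 1 n] \<theta> sym_errors_subset[of n "1 / \<theta>"] by auto
  then have "ns_cdf n (ln (\<delta>\<^sup>2 * \<theta>)) / (1 + \<delta>) - \<delta> \<le> Inf (iid_errors n (1 / \<theta>))"
  proof (rule cInf_greatest)
    fix y assume "y \<in> iid_errors n (1 / \<theta>)"
    then obtain T where T: "y = Re (mtrace (rho_pow dA dB n \<rho> * (1\<^sub>m (dn n) - T)))" "is_test (dn n) T"
      "Re (mtrace (kron (tpow dA n (ptrB dA dB \<rho>)) (tpow dB n (ptrA dA dB \<rho>)) * T)) \<le> 1 / \<theta>"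
      unfolding iid_errors_def using density_ptr[OF dens] by blast
    have "0 < \<delta> * \<theta>" using \<theta> \<delta> by simp
    from converse_bound[OF T(2) \<delta> this T(3)] show "ns_cdf n (ln (\<delta>\<^sup>2 * \<theta>)) / (1 + \<delta>) - \<delta> \<le> y"
      using \<theta> by (simp add: T(1) power2_eq_square mult.assoc)
  qed
  then show ?thesis unfolding alpha_hat_iid_def iid_errors_def by simp
qed

lemma second_order:
  fixes r :: real
  assumes v: "mutual_info_var dA dB \<rho> \<noteq> 0"
  defines "\<theta> \<equiv> \<lambda>n::nat. exp (real n * (mutual_info dA dB \<rho> + r / sqrt (real n)))"
  shows "(\<lambda>n. alpha_hat dA dB n \<rho> (1 / \<theta> n)) \<longlonglongrightarrow> std_normal_cdf (r / sqrt (mutual_info_var dA dB \<rho>))"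
    "(\<lambda>n. alpha_hat_iid dA dB n \<rho> (1 / \<theta> n)) \<longlonglongrightarrow> std_normal_cdf (r / sqrt (mutual_info_var dA dB \<rho>))"
proof -
  let ?\<Phi> = "std_normal_cdf (r / sqrt (mutual_info_var dA dB \<rho>))" and ?I = "mutual_info dA dB \<rho>"
  \<comment> \<open>One more than the sum of the two trace exponents, so that the Markov error
    divided by \<open>K n\<close> is at most twice \<open>1 / (real n + 1)\<close>.\<close>
  define E where "E = dA * dA + dB * dB + 1"
  define \<delta> where "\<delta> n = 1 / (real n + 1)" for n
  define K where "K n = (real n + 1) ^ E" for n
  \<comment> \<open>The factors \<open>(\<delta> n)\<^sup>2\<close> and \<open>(K n)\<^sup>2\<close>
    move the log-threshold by multiples of \<open>ln (real n + 1)\<close>. Measured in units of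
    \<open>sqrt (real n)\<close>, these are the corrections in \<open>cl\<close> and
    \<open>cu\<close>, and they vanish in the limit.\<close>
  define cl where "cl n = r - 2 * ln (real n + 1) / sqrt (real n)" for n
  define cu where "cu n = r + 2 * real E * (ln (real n + 1) / sqrt (real n))" for n
  have \<theta>: "0 < \<theta> n" for n by (simp add: \<theta>_def)
  have \<delta>: "0 < \<delta> n" for n by (simp add: \<delta>_def)
  have K: "0 < K n" for n by (simp add: K_def)
  have ls: "(\<lambda>n. ln (real n + 1) / sqrt (real n)) \<longlonglongrightarrow> 0" by real_asymp
  have cl: "cl \<longlonglongrightarrow> r" unfolding cl_def[abs_def] using tendsto_diff[OF tendsto_const[of r] tendsto_mult_left[OF ls, of 2]] by simp
  have cu: "cu \<longlonglongrightarrow> r" unfolding cu_def[abs_def] using tendsto_add[OF tendsto_const[of r] tendsto_mult_left[OF ls, of "2 * real E"]] by simp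
  have ln\<theta>: "ln (\<theta> n) = real n * ?I + sqrt (real n) * r" for n
  proof -
    have "ln (\<theta> n) = real n * ?I + real n / sqrt (real n) * r" by (simp add: \<theta>_def distrib_left)
    also have "real n / sqrt (real n) = sqrt (real n)" by (rule real_div_sqrt) simp
    finally show ?thesis .
  qed
  have lower_eq: "ln ((\<delta> n)\<^sup>2 * \<theta> n) = real n * ?I + sqrt (real n) * cl n" if n: "0 < n" for n
  proof -
    have "ln ((\<delta> n)\<^sup>2 * \<theta> n) = 2 * ln (\<delta> n) + ln (\<theta> n)" using \<delta>[of n] \<theta>[of n] by (simp add: ln_mult ln_realpow)
    also have "ln (\<delta> n) = - ln (real n + 1)" by (simp add: \<delta>_def ln_div)
    finally show ?thesis using n by (simp add: ln\<theta> cl_def right_diff_distrib)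
  qed
  have upper_eq: "ln (\<theta> n * (K n)\<^sup>2) = real n * ?I + sqrt (real n) * cu n" if n: "0 < n" for n
  proof -
    have "ln (\<theta> n * (K n)\<^sup>2) = ln (\<theta> n) + 2 * ln (K n)" using K[of n] \<theta>[of n] by (simp add: ln_mult ln_realpow)
    also have "ln (K n) = real E * ln (real n + 1)" by (simp add: K_def ln_realpow)
    finally show ?thesis using n by (simp add: ln\<theta> cu_def distrib_left)
  qed
  have err: "(real ((n + 1) ^ (dA * dA)) + real ((n + 1) ^ (dB * dB))) / K n \<le> 2 * \<delta> n" for n
  proof -
    have "real ((n + 1) ^ m) \<le> (real n + 1) ^ (dA * dA + dB * dB)" if "m \<le> dA * dA + dB * dB" for m
      using power_increasing[OF that, of "real n + 1"] by (simp add: add.commute)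
    from this[of "dA * dA"] this[of "dB * dB"]
    have "real ((n + 1) ^ (dA * dA)) + real ((n + 1) ^ (dB * dB)) \<le> 2 * (real n + 1) ^ (dA * dA + dB * dB)" by simp
    then have "(real ((n + 1) ^ (dA * dA)) + real ((n + 1) ^ (dB * dB))) / K n \<le> 2 * (real n + 1) ^ (dA * dA + dB * dB) / K n"
      using K[of n] by (intro divide_right_mono) auto
    also have "\<dots> = 2 * \<delta> n" by (simp add: K_def E_def \<delta>_def)
    finally show ?thesis .
  qed
  have \<delta>0: "\<delta> \<longlonglongrightarrow> 0" unfolding \<delta>_def[abs_def] by real_asymp
  have pos: "\<forall>\<^sub>F n in sequentially. 0 < n" by (rule eventually_gt_at_top)
  have L: "(\<lambda>n. ns_cdf n (real n * ?I + sqrt (real n) * cl n) / (1 + \<delta> n) - \<delta> n) \<longlonglongrightarrow> ?\<Phi>"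
    using tendsto_diff[OF tendsto_divide[OF ns_cdf_limit[OF v cl] tendsto_add[OF tendsto_const[of 1] \<delta>0]] \<delta>0] by simp
  have H: "(\<lambda>n. ns_cdf n (real n * ?I + sqrt (real n) * cu n) + 2 * \<delta> n) \<longlonglongrightarrow> ?\<Phi>"
    using tendsto_add[OF ns_cdf_limit[OF v cu] tendsto_mult_left[OF \<delta>0, of 2]] by simp
  have lo: "\<forall>\<^sub>F n in sequentially. ns_cdf n (real n * ?I + sqrt (real n) * cl n) / (1 + \<delta> n) - \<delta> n \<le> alpha_hat_iid dA dB n \<rho> (1 / \<theta> n)"
    using pos by eventually_elim (metis alpha_hat_iid_ge[OF \<theta> \<delta>] lower_eq)
  have mid: "alpha_hat_iid dA dB n \<rho> (1 / \<theta> n) \<le> alpha_hat dA dB n \<rho> (1 / \<theta> n)" for n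
    by (rule alpha_hat_iid_le[OF \<theta>])
  have hi: "\<forall>\<^sub>F n in sequentially. alpha_hat dA dB n \<rho> (1 / \<theta> n) \<le> ns_cdf n (real n * ?I + sqrt (real n) * cu n) + 2 * \<delta> n"
    using pos
  proof eventually_elim
    case (elim n)
    show ?case using alpha_hat_le(2)[OF \<theta> K, of n n n] err[of n] unfolding upper_eq[OF elim] by linarith
  qed
  show "(\<lambda>n. alpha_hat dA dB n \<rho> (1 / \<theta> n)) \<longlonglongrightarrow> ?\<Phi>"
    by (rule tendsto_sandwich[OF eventually_mono[OF lo order_trans[OF _ mid]] hi L H])
  show "(\<lambda>n. alpha_hat_iid dA dB n \<rho> (1 / \<theta> n)) \<longlonglongrightarrow> ?\<Phi>"
    by (rule tendsto_sandwich[OF lo eventually_mono[OF hi order_trans[OF mid]] L H])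
qed

end

theorem mainTheorem13:
  fixes dA dB :: nat and \<rho> :: "complex mat" and r :: real
  assumes "density (dA * dB) \<rho>"
    and "mutual_info_var dA dB \<rho> \<noteq> 0"
  defines "R \<equiv> \<lambda>n::nat. mutual_info dA dB \<rho> + r / sqrt (real n)"
  shows "(\<lambda>n. alpha_hat dA dB n \<rho> (exp (- real n * R n)))
            \<longlonglongrightarrow> std_normal_cdf (r / sqrt (mutual_info_var dA dB \<rho>))
       \<and> (\<lambda>n. alpha_hat_iid dA dB n \<rho> (exp (- real n * R n)))
            \<longlonglongrightarrow> std_normal_cdf (r / sqrt (mutual_info_var dA dB \<rho>))"
proof -
  have psd: "psd (dA * dB) \<rho>" "psd dA (ptrB dA dB \<rho>)" "psd dB (ptrA dA dB \<rho>)"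
    using assms(1) density_ptr[OF assms(1)] by (auto simp: density_def)
  obtain U l where "unitary (dA * dB) U" "\<rho> = U * rdiag (dA * dB) l * cadj U" "\<forall>i<dA * dB. 0 \<le> l i"
    using spectral_psd[OF psd(1)] by blast
  moreover obtain VA a where "unitary dA VA" "ptrB dA dB \<rho> = VA * rdiag dA a * cadj VA" "\<forall>i<dA. 0 \<le> a i"
    using spectral_psd[OF psd(2)] by blast
  moreover obtain VB b where "unitary dB VB" "ptrA dA dB \<rho> = VB * rdiag dB b * cadj VB" "\<forall>i<dB. 0 \<le> b i"
    using spectral_psd[OF psd(3)] by blast
  ultimately interpret bipartite_state dA dB \<rho> U VA VB l a b
    using assms(1) by unfold_locales auto
  have "exp (- real n * R n) = 1 / exp (real n * (mutual_info dA dB \<rho> + r / sqrt (real n)))" for n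
    by (simp add: R_def exp_minus inverse_eq_divide)
  then show ?thesis using second_order[OF assms(2), of r] by simp
qed

end
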